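(* Let $0<\alpha<1$ and let $\zeta$ be a non-negative random variable. Let $(P_i)$ be a sequence with law $\mathbb P_\alpha(\zeta)$, written as $(\tilde P_1,(P^*_k))$, where $\tilde P_1$ is a size-biased pick from $(P_i)$ and $(P^*_k)$ are the remaining terms. Let $(Q_i)$ be a $\mathrm{PD}(\alpha,1-\alpha)$ sequence independent of $(P_i)$. Then $$\mathrm{Rank}\big(\tilde P_1(Q_i),(P^*_k)\big)\sim\mathbb P_\alpha(\gamma_{1/\alpha}+\zeta),$$ where $\gamma_{1/\alpha}$ is a Gamma$(1/\alpha,1)$ variable independent of $\zeta$. That is, $\mathrm{Frag}$-$\mathrm{PD}(\alpha,1-\alpha)$ maps $\mathbb P_\alpha(\zeta)$ to $\mathbb P_\alpha(\gamma_{1/\alpha}+\zeta)$.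
   Context: $\mathcal P=\{(s_1,s_2,\dots):s_1\ge s_2\ge\dots\ge0,\ \sum s_i=1\}$, and $\mathrm{Rank}$ orders a countable family of non-negative numbers summing to $1$ decreasingly. $\mathrm{Rank}(\tilde P_1(Q_i),(P^*_k))$ denotes the ranking of the family $\{\tilde P_1Q_i\}_i\cup\{P^*_k\}_k$. $\mathrm{PD}(\alpha,\theta)$ is the two-parameter Poisson–Dirichlet law. A size-biased pick from $(P_i)$ equals $P_i$ with conditional probability $P_i$. For $0<\alpha<1$, let $T$ be positive stable with $Ee^{-\omega T}=e^{-\omega^\alpha}$. $\mathrm{PD}(\alpha|t)$ is the conditional law of the normalized ranked jumps of the stable subordinator on $[0,1]$ given $T=t$, and $\mathrm{PK}_\alpha(\eta)=\int\mathrm{PD}(\alpha|t)\eta(dt)$. A generalized gamma subordinator satisfies $Ee^{-\omega\tau_\alpha(s)}=\exp(-s((1+\omega)^\alpha-1))$. For a non-negative random variable $\zeta$ independent of $\tau_\alpha$, $\mathbb P_\alpha(\zeta):=\mathrm{PK}_\alpha(\eta^* )$, where $\eta^*$ is the law of $\tau_\alpha(\zeta)/\zeta^{1/\alpha}$. *)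

theory Defs
  imports "HOL-Probability.Probability"
begin

text \<open>rank f n is the (n+1)-th largest value (with multiplicity) of a countable
  family of non-negative reals f; zeros are padded at the end.\<close>
definition rank :: "('i \<Rightarrow> real) \<Rightarrow> nat \<Rightarrow> real" where
  "rank f n = (if \<exists>x>0. n < card {i. x \<le> f i}
               then Sup {x. 0 < x \<and> n < card {i. x \<le> f i}} else 0)"

definition seqM :: "(nat \<Rightarrow> real) measure" where
  "seqM = (\<Pi>\<^sub>M i\<in>UNIV. (borel :: real measure))"

definition beta_density :: "real \<Rightarrow> real \<Rightarrow> real \<Rightarrow> real" where
  "beta_density a b x = (if 0 < x \<and> x < 1
     then x powr (a - 1) * (1 - x) powr (b - 1) * Gamma (a + b) / (Gamma a * Gamma b) else 0)"

definition beta_law :: "real \<Rightarrow> real \<Rightarrow> real measure" where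
  "beta_law a b = density lborel (\<lambda>x. ennreal (beta_density a b x))"

definition gamma_density :: "real \<Rightarrow> real \<Rightarrow> real" where
  "gamma_density k x = (if 0 < x then x powr (k - 1) * exp (- x) / Gamma k else 0)"

definition gamma_law :: "real \<Rightarrow> real measure" where
  "gamma_law k = density lborel (\<lambda>x. ennreal (gamma_density k x))"

definition GEM_space :: "real \<Rightarrow> real \<Rightarrow> (nat \<Rightarrow> real) measure" where
  "GEM_space \<alpha> \<theta> = (\<Pi>\<^sub>M i\<in>UNIV. beta_law (1 - \<alpha>) (\<theta> + real (Suc i) * \<alpha>))"

definition stick :: "(nat \<Rightarrow> real) \<Rightarrow> nat \<Rightarrow> real" where
  "stick W i = W i * (\<Prod>j<i. 1 - W j)"

definition PD :: "real \<Rightarrow> real \<Rightarrow> (nat \<Rightarrow> real) measure" where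
  "PD \<alpha> \<theta> = distr (GEM_space \<alpha> \<theta>) seqM (\<lambda>W. rank (stick W))"

section \<open>Ranked jumps of the stable subordinator on [0,1] (Ferguson--Klass / LePage)\<close>

text \<open>Base space: i.i.d. standard exponentials E_0, E_1, ...; Gamma_i = E_0 + ... + E_i are
  the points of a unit Poisson process; the ranked jumps of the alpha-stable subordinator
  with Laplace exponent omega^alpha (Levy tail x^(-alpha)/Gamma(1-alpha)) on [0,1] are
  J_i = (Gamma(1-alpha) * Gamma_i)^(-1/alpha), and T = sum of the J_i.\<close>
definition exp_space :: "(nat \<Rightarrow> real) measure" where
  "exp_space = (\<Pi>\<^sub>M i\<in>UNIV. density lborel (exponential_density 1))"

definition stable_jump :: "real \<Rightarrow> (nat \<Rightarrow> real) \<Rightarrow> nat \<Rightarrow> real" where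
  "stable_jump \<alpha> E i = (Gamma (1 - \<alpha>) * (\<Sum>j\<le>i. E j)) powr (- 1 / \<alpha>)"

definition stable_T :: "real \<Rightarrow> (nat \<Rightarrow> real) \<Rightarrow> real" where
  "stable_T \<alpha> E = (\<Sum>i. stable_jump \<alpha> E i)"

definition stable_law :: "real \<Rightarrow> real measure" where
  "stable_law \<alpha> = distr exp_space borel (stable_T \<alpha>)"

text \<open>Poisson--Kingman law PK_alpha(eta) = integral of PD(alpha|t) eta(dt). Since PD(alpha|t)
  is the conditional law of the normalized ranked jumps given T = t (defined for
  law(T)-a.e. t), the mixture is the law of the normalized ranked jumps under the base
  measure reweighted by d eta / d law(T) evaluated at T.\<close>
definition PK :: "real \<Rightarrow> real measure \<Rightarrow> (nat \<Rightarrow> real) measure" where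
  "PK \<alpha> \<eta> = distr (density exp_space (\<lambda>E. RN_deriv (stable_law \<alpha>) \<eta> (stable_T \<alpha> E)))
                   seqM (\<lambda>E i. stable_jump \<alpha> E i / stable_T \<alpha> E)"

definition gengamma_law :: "real \<Rightarrow> real \<Rightarrow> real measure" where
  "gengamma_law \<alpha> s = (THE N. prob_space N \<and> sets N = sets borel \<and> (AE x in N. 0 \<le> x) \<and>
      (\<forall>\<omega>\<ge>0. (\<integral>x. exp (- \<omega> * x) \<partial>N) = exp (- s * ((1 + \<omega>) powr \<alpha> - 1))))"

text \<open>Law of tau_alpha(zeta)/zeta^(1/alpha) for zeta independent of tau_alpha with law mu.
  At zeta = 0 we use the (distributional) limit value T.\<close>
definition eta_star :: "real \<Rightarrow> real measure \<Rightarrow> real measure" where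
  "eta_star \<alpha> \<mu> = \<mu> \<bind> (\<lambda>s. if s = 0 then stable_law \<alpha>
                              else distr (gengamma_law \<alpha> s) borel (\<lambda>x. x / s powr (1 / \<alpha>)))"

definition Palpha :: "real \<Rightarrow> real measure \<Rightarrow> (nat \<Rightarrow> real) measure" where
  "Palpha \<alpha> \<mu> = PK \<alpha> (eta_star \<alpha> \<mu>)"

end

(*
  Everything is transported to the ranked jumps J of the stable subordinator and their sum T.
  Conditioning on zeta = s turns tau_alpha(s)/s^(1/alpha) into T tilted by exp(s - s^(1/alpha) T), so
  Palpha mu is the law of J/T under the density h(T), where h(t) is the mu-integral over s of
  exp(s - s^(1/alpha) t). Likewise, iterating Mecke's equation identifies PD(alpha, theta), defined by
  stick breaking, with the law of J/T under a density proportional to T^(-theta).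

  By Mecke's equation a size-biased jump x is independent of the other jumps and has the Levy measure
  as intensity. With Q = J'/T' for an independent copy tilted by T'^(alpha - 1), put x = y T'. The
  fragmented sequence becomes the normalised superposition of y J' and J, which is distributed as b J
  with b^alpha = 1 + y^alpha. Hence its law is that of J/T under the density proportional to
  the integral of y h(b T)/(b T) against the Levy measure, and a change of variables shows that this is a
  constant multiple of the tilt belonging to Gamma(1/alpha) * mu.
*)
theory Submission
  imports Defs
begin

section \<open>Ranking\<close>

text \<open>None of the laws involved has an explicit density: the stable law is accessible only
  through its Laplace transform, and a ranking only through a supremum over thresholds. Ranks are
  therefore replaced by counts: \<open>q\<close> is at most the \<open>n\<close>-th rank iff more
  than \<open>n\<close> entries reach \<open>q\<close> (\<open>le_rank_iff\<close>). Counts add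
  under superposition and are sums over the jumps, so joint laws of ranks and totals can be read off
  from Laplace functionals. These follow from Mecke's equation through a differential equation in
  the Laplace parameter. The exponent \<alpha> - 1 of the tilt of T' has a reason: the substitution
  x = y T' in the Levy measure produces T' to the power - \<alpha>, and the size-biased weight x /
  (x + T) contributes one factor T'. The tilt removes both, so that J' enters only through the
  superposition; this singles out PD(\<alpha>, 1 - \<alpha>). The intensity of the superposition is
  1 + y^\<alpha> times the Levy measure, which by self-similarity is the image of the Levy measure
  under multiplication by b.\<close>

lemma card_superlevel_finite:
  assumes "n < card {i. x \<le> f i}" shows "finite {i. x \<le> f i}"
  using assms card.infinite by fastforce

text \<open>A superlevel set with positive count is finite, so the threshold can be raised to the
  least value in it without changing the set. Thresholds may thus be taken among the values of
  \<open>f\<close>.\<close>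

lemma superlevel_attained:
  fixes f :: "'i \<Rightarrow> real"
  assumes "0 < x" "n < card {i. x \<le> f i}"
  obtains i where "x \<le> f i" "n < card {j. f i \<le> f j}"
proof -
  let ?S = "{i. x \<le> f i}"
  have fin: "finite ?S" using assms(2) by (rule card_superlevel_finite)
  have ne: "?S \<noteq> {}" using assms(2) by force
  define m where "m = Min (f ` ?S)"
  have "m \<in> f ` ?S" unfolding m_def using fin ne by (intro Min_in) auto
  then obtain i where i: "i \<in> ?S" "m = f i" by auto
  have "?S = {j. f i \<le> f j}"
  proof safe
    fix j assume "x \<le> f j"
    then have "m \<le> f j" unfolding m_def using fin by (intro Min_le) auto
    then show "f i \<le> f j" using i by simp
  next
    fix j assume "f i \<le> f j" then show "x \<le> f j" using i by auto
  qed
  with i assms(2) show thesis by (intro that[of i]) auto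
qed

text \<open>Without this bound the \<open>Sup\<close> in \<open>rank\<close> would be an unspecified
  real.\<close>

lemma bdd_above_superlevel:
  fixes f :: "'i \<Rightarrow> real"
  shows "bdd_above {x. 0 < x \<and> n < card {i. x \<le> f i}}" (is "bdd_above ?A")
proof (cases "?A = {}")
  case False
  then obtain a where a: "0 < a" "n < card {i. a \<le> f i}" by auto
  have fin: "finite {i. a \<le> f i}" using a(2) by (rule card_superlevel_finite)
  have ne: "{i. a \<le> f i} \<noteq> {}" using a(2) by force
  show ?thesis
  proof (rule bdd_aboveI)
    fix x assume "x \<in> ?A"
    then obtain i where i: "x \<le> f i" using superlevel_attained[of x n f] by blast
    show "x \<le> Max (f ` {i. a \<le> f i})"
    proof (cases "a \<le> x")
      case True
      with i have "f i \<le> Max (f ` {i. a \<le> f i})" using fin by (intro Max_ge) auto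
      with i show ?thesis by simp
    next
      case False
      obtain j where j: "a \<le> f j" using ne by blast
      then have "f j \<le> Max (f ` {i. a \<le> f i})" using fin by (intro Max_ge) auto
      with j False show ?thesis by simp
    qed
  qed
next
  case True then show ?thesis by (simp only: bdd_above_empty)
qed

lemma rank_ge:
  assumes "0 < x" "n < card {i. x \<le> f i}" shows "x \<le> rank f n"
proof -
  have "rank f n = Sup {x. 0 < x \<and> n < card {i. x \<le> f i}}" unfolding rank_def using assms by auto
  then show ?thesis using assms by (auto intro!: cSup_upper bdd_above_superlevel)
qed

lemma rank_nonneg: "0 \<le> rank f n"
proof (cases "\<exists>x>0. n < card {i. x \<le> f i}")
  case True
  then obtain x where "0 < x" "n < card {i. x \<le> f i}" by auto
  then show ?thesis using rank_ge[of x n f] by simp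
qed (auto simp: rank_def)

text \<open>The supremum is attained: only finitely many entries exceed \<open>x/2\<close>, so no
  value lies in some interval just below \<open>x\<close>, and the count is constant there. This
  equivalence is the bridge from ranks to counts everywhere below.\<close>

lemma le_rank_iff:
  assumes fin: "\<And>x. 0 < x \<Longrightarrow> finite {i. x \<le> f i}" and x: "0 < x"
  shows "x \<le> rank f n \<longleftrightarrow> n < card {i. x \<le> f i}"
proof
  assume le: "x \<le> rank f n"
  show "n < card {i. x \<le> f i}"
  proof (rule ccontr)
    assume n: "\<not> n < card {i. x \<le> f i}"
    let ?A = "{x. 0 < x \<and> n < card {i. x \<le> f i}}"
    have ex: "\<exists>x>0. n < card {i. x \<le> f i}"
      using le x by (auto simp: rank_def split: if_splits)
    then have eq: "rank f n = Sup ?A" by (auto simp: rank_def)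
    let ?B = "f ` {i. x/2 \<le> f i \<and> f i < x}"
    have finB: "finite ?B"
      by (rule finite_imageI, rule finite_subset[OF _ fin[of "x/2"]]) (use x in auto)
    \<comment> \<open>The largest value in \<open>{x/2..<x}\<close>, with \<open>x/2\<close>
      inserted in case there is none; \<open>z\<close> then lies in the gap between \<open>m\<close>
      and \<open>x\<close>.\<close>
    define m where "m = Max (insert (x/2) ?B)"
    have m: "m < x" unfolding m_def using finB x by (subst Max_less_iff) auto
    have m2: "x/2 \<le> m" unfolding m_def using finB by (intro Max_ge) auto
    define z where "z = (m + x) / 2"
    have z: "m < z" "z < x" "0 < z" using m m2 x unfolding z_def by auto
    have eqset: "{i. z \<le> f i} = {i. x \<le> f i}"
    proof safe
      fix i assume i: "z \<le> f i"
      show "x \<le> f i"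
      proof (rule ccontr)
        assume "\<not> x \<le> f i"
        then have "f i \<in> insert (x/2) ?B" using i z m2 by auto
        then have "f i \<le> m" unfolding m_def using finB by (intro Max_ge) auto
        then show False using i z by simp
      qed
    qed (use z in auto)
    have "Sup ?A \<le> z"
    proof (rule cSup_least)
      show "?A \<noteq> {}" using ex by auto
      fix a assume a: "a \<in> ?A"
      show "a \<le> z"
      proof (rule ccontr)
        assume "\<not> a \<le> z"
        then have "card {i. a \<le> f i} \<le> card {i. z \<le> f i}"
          by (intro card_mono fin z) auto
        then show False using a n eqset by auto
      qed
    qed
    then show False using le eq z by simp
  qed
qed (rule rank_ge[OF x])

text \<open>\<open>rank\<close> sees a family only through its counts at positive thresholds, so
  families over different index types can be compared.\<close>

lemma rank_eqI:
  assumes "\<And>x. 0 < x \<Longrightarrow> card {i. x \<le> f i} = card {j. x \<le> g j}"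
  shows "rank f = rank g"
proof
  fix n
  have "{x. 0 < x \<and> n < card {i. x \<le> f i}} = {x. 0 < x \<and> n < card {i. x \<le> g i}}"
    using assms by auto
  moreover have "(\<exists>x>0. n < card {i. x \<le> f i}) \<longleftrightarrow> (\<exists>x>0. n < card {i. x \<le> g i})"
    using assms by auto
  ultimately show "rank f n = rank g n" unfolding rank_def by (simp only:)
qed

lemma rank_reindex:
  assumes "bij h" shows "rank (\<lambda>i. f (h i)) = rank f"
proof (rule rank_eqI)
  fix x :: real
  have "h ` {i. x \<le> f (h i)} = {j. x \<le> f j}"
    using assms by (auto simp: image_iff) (metis bij_pointE)
  moreover have "inj_on h {i. x \<le> f (h i)}" using assms by (auto simp: bij_def inj_on_def)
  ultimately show "card {i. x \<le> f (h i)} = card {j. x \<le> f j}"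
    using card_image by fastforce
qed

lemma eq_by_pos_thresholds:
  fixes a b :: real
  assumes "0 \<le> a" "0 \<le> b" "\<And>x. 0 < x \<Longrightarrow> x \<le> a \<longleftrightarrow> x \<le> b"
  shows "a = b"
  using assms(3)[of a] assms(3)[of b] assms(1,2) by linarith

lemma rank_scale:
  assumes fin: "\<And>x. 0 < x \<Longrightarrow> finite {i. x \<le> f i}" and c: "0 < c"
  shows "rank (\<lambda>i. c * f i) n = c * rank f n"
proof (rule eq_by_pos_thresholds)
  have eq: "{i. x \<le> c * f i} = {i. x / c \<le> f i}" for x using c by (auto simp: field_simps)
  fix x :: real assume x: "0 < x"
  have "x \<le> rank (\<lambda>i. c * f i) n \<longleftrightarrow> n < card {i. x / c \<le> f i}"
    by (subst le_rank_iff[OF _ x]) (use fin c in \<open>auto simp: eq\<close>)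
  also have "\<dots> \<longleftrightarrow> x / c \<le> rank f n" by (subst le_rank_iff[OF fin]) (use x c in auto)
  also have "\<dots> \<longleftrightarrow> x \<le> c * rank f n" using c by (auto simp: field_simps)
  finally show "x \<le> rank (\<lambda>i. c * f i) n \<longleftrightarrow> x \<le> c * rank f n" .
qed (use c in \<open>auto intro: rank_nonneg mult_nonneg_nonneg\<close>)

lemma rank_decseq:
  fixes f :: "nat \<Rightarrow> real"
  assumes fin: "\<And>x. 0 < x \<Longrightarrow> finite {i. x \<le> f i}" and f: "decseq f" "\<And>i. 0 \<le> f i"
  shows "rank f = f"
proof
  fix n
  show "rank f n = f n"
  proof (rule eq_by_pos_thresholds)
    fix x :: real assume x: "0 < x"
    have "n < card {i. x \<le> f i} \<longleftrightarrow> x \<le> f n"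
    proof
      assume "x \<le> f n"
      then have "{..n} \<subseteq> {i. x \<le> f i}" using f(1) by (auto simp: decseq_def intro: order_trans)
      then have "card {..n} \<le> card {i. x \<le> f i}" by (intro card_mono fin x)
      then show "n < card {i. x \<le> f i}" by simp
    next
      assume n: "n < card {i. x \<le> f i}"
      show "x \<le> f n"
      proof (rule ccontr)
        assume "\<not> x \<le> f n"
        then have "{i. x \<le> f i} \<subseteq> {..<n}"
          using f(1) by (auto simp: decseq_def) (meson leI order_trans)
        then have "card {i. x \<le> f i} \<le> card {..<n}" by (intro card_mono) auto
        then show False using n by simp
      qed
    qed
    then show "x \<le> rank f n \<longleftrightarrow> x \<le> f n" using le_rank_iff[OF fin x] by simp
  qed (use f rank_nonneg in auto)
qed

lemma finite_superlevel_summable: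
  fixes f :: "nat \<Rightarrow> real"
  assumes "summable f" "0 < x"
  shows "finite {i. x \<le> f i}"
proof -
  have "eventually (\<lambda>i. f i < x) sequentially"
    using summable_LIMSEQ_zero[OF assms(1)] assms(2) by (intro order_tendstoD)
  then obtain N where "\<And>i. i \<ge> N \<Longrightarrow> f i < x" by (auto simp: eventually_sequentially)
  then have "{i. x \<le> f i} \<subseteq> {..<N}" by (auto simp: not_less[symmetric])
  then show ?thesis by (rule finite_subset) simp
qed

lemma superlevel_case_sum:
  "{j. x \<le> case_sum f g j} = Inl ` {i. x \<le> f i} \<union> Inr ` {k. x \<le> g k}"
proof safe
  fix j assume "x \<le> case_sum f g j" "j \<notin> Inr ` {k. x \<le> g k}"
  then show "j \<in> Inl ` {i. x \<le> f i}" by (cases j) auto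
qed auto

text \<open>Finiteness is essential, since \<open>card\<close> of an infinite set is
  \<open>0\<close>.\<close>

lemma card_superlevel_case_sum:
  fixes f :: "'i \<Rightarrow> real" and g :: "'j \<Rightarrow> real"
  assumes "finite {i. x \<le> f i}" "finite {k. x \<le> g k}"
  shows "card {j. x \<le> case_sum f g j} = card {i. x \<le> f i} + card {k. x \<le> g k}"
  unfolding superlevel_case_sum
  by (subst card_Un_disjoint) (use assms in \<open>auto simp: card_image\<close>)

section \<open>Measurability of rankings and identification of laws on sequences\<close>

lemma space_seqM [simp]: "space seqM = UNIV"
  by (simp add: seqM_def space_PiM PiE_UNIV_domain)

lemma measurable_seqM_iff: "F \<in> measurable M seqM \<longleftrightarrow> (\<forall>n. (\<lambda>w. F w n) \<in> borel_measurable M)"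
proof
  assume "F \<in> measurable M seqM"
  then show "\<forall>n. (\<lambda>w. F w n) \<in> borel_measurable M"
    unfolding seqM_def by (auto intro: measurable_PiM_component_rev)
next
  assume "\<forall>n. (\<lambda>w. F w n) \<in> borel_measurable M"
  then show "F \<in> measurable M seqM" unfolding seqM_def by (intro measurable_PiM_single') auto
qed

lemma measurable_seqM_component:
  "F \<in> measurable M seqM \<Longrightarrow> (\<lambda>w. F w n) \<in> borel_measurable M"
  by (simp add: measurable_seqM_iff)

lemma measurable_seqM_component' [measurable_dest]:
  "F \<in> measurable M seqM \<Longrightarrow> g \<in> measurable L M \<Longrightarrow> (\<lambda>w. F (g w) n) \<in> borel_measurable L"
  using measurable_seqM_component[of "\<lambda>w. F (g w)" L n] measurable_compose[of g L M F seqM] by simp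

lemma measurable_seqM_proj [measurable (raw)]: "(\<lambda>x. x n) \<in> borel_measurable seqM"
  by (rule measurable_seqM_component) simp

lemma measurable_seqMI: "(\<And>n. (\<lambda>w. F w n) \<in> borel_measurable M) \<Longrightarrow> F \<in> measurable M seqM"
  by (simp add: measurable_seqM_iff)

text \<open>By \<open>superlevel_attained\<close> the supremum over a continuum of thresholds
  reduces to one over the countably many values of \<open>f\<close>, which gives measurability of
  \<open>rank\<close>.\<close>

lemma rank_eq_SUP:
  fixes f :: "nat \<Rightarrow> real"
  shows "rank f n = (SUP i. if 0 < f i \<and> n < card {j. f i \<le> f j} then f i else 0)"
    and "bdd_above (range (\<lambda>i. if 0 < f i \<and> n < card {j. f i \<le> f j} then f i else 0))"
proof -
  let ?g = "\<lambda>i. if 0 < f i \<and> n < card {j. f i \<le> f j} then f i else 0"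
  have le: "?g i \<le> rank f n" for i using rank_ge[of "f i" n f] rank_nonneg[of f n] by auto
  show bdd: "bdd_above (range ?g)" by (rule bdd_aboveI2) (rule le)
  show "rank f n = (SUP i. ?g i)"
  proof (rule antisym)
    show "(SUP i. ?g i) \<le> rank f n" by (rule cSUP_least) (use le in auto)
    have g0: "0 \<le> ?g 0" by simp
    have S0: "0 \<le> (SUP i. ?g i)" by (rule cSUP_upper2[OF bdd _ g0]) simp
    show "rank f n \<le> (SUP i. ?g i)"
    proof (cases "\<exists>x>0. n < card {i. x \<le> f i}")
      case True
      then have "rank f n = Sup {x. 0 < x \<and> n < card {i. x \<le> f i}}" by (auto simp: rank_def)
      also have "\<dots> \<le> (SUP i. ?g i)"
      proof (rule cSup_least)
        show "{x. 0 < x \<and> n < card {i. x \<le> f i}} \<noteq> {}" using True by auto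
        fix x assume "x \<in> {x. 0 < x \<and> n < card {i. x \<le> f i}}"
        then have x: "0 < x" "n < card {i. x \<le> f i}" by auto
        obtain i where i: "x \<le> f i" "n < card {j. f i \<le> f j}" by (rule superlevel_attained[OF x])
        have "x \<le> ?g i" using i x by auto
        then show "x \<le> (SUP i. ?g i)" by (rule cSUP_upper2[OF bdd UNIV_I])
      qed
      finally show ?thesis .
    next
      case False
      then have "rank f n = 0" unfolding rank_def by (rule if_not_P)
      then show ?thesis using S0 by simp
    qed
  qed
qed

lemma measurable_rank [measurable (raw)]:
  assumes [measurable]: "F \<in> measurable M seqM"
  shows "(\<lambda>w. rank (F w)) \<in> measurable M seqM"
proof (rule measurable_seqMI)
  fix n
  have [measurable]: "(\<lambda>w. card {j. F w i \<le> F w j}) \<in> measurable M (count_space UNIV)" for i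
    by (rule measurable_card) measurable
  show "(\<lambda>w. rank (F w) n) \<in> borel_measurable M"
    unfolding rank_eq_SUP(1)
  proof (rule borel_measurable_cSUP)
    fix w show "bdd_above (range (\<lambda>i. if 0 < F w i \<and> n < card {j. F w i \<le> F w j} then F w i else 0))"
      by (rule rank_eq_SUP(2))
  qed auto
qed

lemma measurable_rank_component [measurable (raw)]:
  "F \<in> measurable M seqM \<Longrightarrow> (\<lambda>w. rank (F w) n) \<in> borel_measurable M"
  by (rule measurable_seqM_component[OF measurable_rank])

lemma measurable_rank_case_sum [measurable (raw)]:
  assumes [measurable]: "F \<in> measurable M seqM" "G \<in> measurable M seqM"
  shows "(\<lambda>w. rank (case_sum (F w) (G w))) \<in> measurable M seqM"
proof -
  have eq: "rank (case_sum (F w) (G w)) = rank (\<lambda>n. case_sum (F w) (G w) (sum_decode n))" for w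
    by (rule rank_reindex[symmetric]) (rule bij_sum_decode)
  have "(\<lambda>w n. case_sum (F w) (G w) (sum_decode n)) \<in> measurable M seqM"
  proof (rule measurable_seqMI)
    fix n
    show "(\<lambda>w. case_sum (F w) (G w) (sum_decode n)) \<in> borel_measurable M"
      by (cases "sum_decode n") simp_all
  qed
  then show ?thesis unfolding eq by measurable
qed

text \<open>Finite conjunctions of lower bounds on coordinates form an intersection-stable
  generator. Lower bounds are chosen because \<open>le_rank_iff\<close> turns exactly these events
  into conditions on counts.\<close>

lemma measure_eqI_seqM:
  assumes sets: "sets M = sets seqM" "sets N = sets seqM" and fin: "finite_measure M"
    and eq: "\<And>L. emeasure M {s. \<forall>(k, q)\<in>set L. q \<le> s k} = emeasure N {s. \<forall>(k, q)\<in>set L. q \<le> s k}"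
  shows "M = N"
proof -
  let ?E = "range (\<lambda>L. {s. \<forall>(k, q)\<in>set L. q \<le> s k}) :: (nat \<Rightarrow> real) set set"
  have sets_gen: "sets seqM = sigma_sets UNIV ?E"
  proof
    show "sigma_sets UNIV ?E \<subseteq> sets seqM"
    proof (rule sets.sigma_sets_subset[of _ seqM, simplified])
      show "?E \<subseteq> sets seqM"
      proof safe
        fix L :: "(nat \<times> real) list"
        have "{s \<in> space seqM. \<forall>p\<in>set L. snd p \<le> s (fst p)} \<in> sets seqM"
          by measurable
        then show "{s. \<forall>(k, q)\<in>set L. q \<le> s k} \<in> sets seqM" by (simp add: case_prod_beta)
      qed
    qed
    have id: "(\<lambda>s. s) \<in> measurable (sigma UNIV ?E) seqM"
    proof (rule measurable_seqMI)
      fix n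
      show "(\<lambda>s. s n) \<in> borel_measurable (sigma UNIV ?E)"
      proof (rule borel_measurable_iff_ge[THEN iffD2], rule allI)
        fix a :: real
        have "{w \<in> space (sigma UNIV ?E). a \<le> w n} = {s. \<forall>(k, q)\<in>set [(n, a)]. q \<le> s k}"
          by (simp add: space_measure_of_conv)
        also have "\<dots> \<in> sets (sigma UNIV ?E)" by (subst sets_measure_of) (simp, rule sigma_sets.Basic, rule rangeI)
        finally show "{w \<in> space (sigma UNIV ?E). a \<le> w n} \<in> sets (sigma UNIV ?E)" .
      qed
    qed
    show "sets seqM \<subseteq> sigma_sets UNIV ?E"
    proof
      fix A assume "A \<in> sets seqM"
      from measurable_sets[OF id this] show "A \<in> sigma_sets UNIV ?E"
        by (simp add: space_measure_of_conv)
    qed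
  qed
  show ?thesis
  proof (rule measure_eqI_generator_eq[where A = "\<lambda>_. UNIV" and E = ?E and \<Omega> = UNIV])
    show "Int_stable ?E"
    proof (rule Int_stableI)
      fix A B assume "A \<in> ?E" "B \<in> ?E"
      then obtain L1 L2 where "A = {s. \<forall>(k, q)\<in>set L1. q \<le> s k}" "B = {s. \<forall>(k, q)\<in>set L2. q \<le> s k}"
        by auto
      then have "A \<inter> B = {s. \<forall>(k, q)\<in>set (L1 @ L2). q \<le> s k}" by auto
      then show "A \<inter> B \<in> ?E" by blast
    qed
    have "UNIV = (\<lambda>L :: (nat \<times> real) list. {s :: nat \<Rightarrow> real. \<forall>(k, q)\<in>set L. q \<le> s k}) []" by simp
    then have "UNIV \<in> ?E" by (rule range_eqI)
    then show "range (\<lambda>_. UNIV) \<subseteq> ?E" by auto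
    show "emeasure M UNIV \<noteq> \<infinity>" using finite_measure.emeasure_finite[OF fin] by auto
  qed (use sets sets_gen eq in auto)
qed


section \<open>Arrival times of a unit Poisson process\<close>

text \<open>The factors may differ from each other because the sticks of \<open>GEM_space\<close>
  are independent but not identically distributed.\<close>

lemma distr_case_nat_PiM:
  fixes M :: "nat \<Rightarrow> 'a measure"
  assumes "\<And>i. prob_space (M i)"
  shows "distr (M 0 \<Otimes>\<^sub>M PiM UNIV (\<lambda>i. M (Suc i))) (PiM UNIV M) (\<lambda>(s, w). case_nat s w) = PiM UNIV M"
    (is "?D = _")
proof -
  interpret A: product_prob_space M UNIV using assms by (intro product_prob_spaceI)
  interpret B: product_prob_space "\<lambda>i. M (Suc i)" UNIV using assms by (intro product_prob_spaceI)
  have B: "prob_space (PiM UNIV (\<lambda>i. M (Suc i)))" by (intro prob_space_PiM assms)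
  have meas: "(\<lambda>(s, w). case_nat s w) \<in> measurable (M 0 \<Otimes>\<^sub>M PiM UNIV (\<lambda>i. M (Suc i))) (PiM UNIV M)"
  proof (rule measurable_PiM_single')
    fix i :: nat
    show "(\<lambda>w. (case w of (s, w) \<Rightarrow> case_nat s w) i) \<in> measurable (M 0 \<Otimes>\<^sub>M PiM UNIV (\<lambda>i. M (Suc i))) (M i)"
      by (cases i) (simp_all add: case_prod_beta)
  qed (auto simp: space_pair_measure space_PiM PiE_iff split: nat.split)
  show ?thesis
  proof (rule A.PiM_eq)
    fix J :: "nat set" and E assume J: "finite J" "J \<subseteq> UNIV" "\<And>j. j \<in> J \<Longrightarrow> E j \<in> sets (M j)"
    let ?X = "prod_emb UNIV M J (\<Pi>\<^sub>E j\<in>J. E j)"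
    let ?f = "\<lambda>(s, w). case_nat s w"
    have "\<And>j x. j \<in> J \<Longrightarrow> x \<in> E j \<Longrightarrow> x \<in> space (M j)"
      using J(3)[THEN sets.sets_into_space] by (auto simp: space_PiM Pi_iff subset_eq)
    with J have "?f -` ?X \<inter> space (M 0 \<Otimes>\<^sub>M PiM UNIV (\<lambda>i. M (Suc i))) = (if 0 \<in> J then E 0 else space (M 0)) \<times>
      (prod_emb UNIV (\<lambda>i. M (Suc i)) (Suc -` J) (\<Pi>\<^sub>E j\<in>Suc -` J. E (Suc j)))" (is "_ = ?E \<times> ?F")
     by (auto simp: space_pair_measure space_PiM PiE_iff prod_emb_def all_conj_distrib
        split: nat.split nat.split_asm)
    then have "emeasure ?D ?X = emeasure (M 0 \<Otimes>\<^sub>M PiM UNIV (\<lambda>i. M (Suc i))) (?E \<times> ?F)"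
      by (subst emeasure_distr[OF meas]) (auto intro!: sets_PiM_I simp: split_beta' J)
    also have "\<dots> = emeasure (M 0) ?E * emeasure (PiM UNIV (\<lambda>i. M (Suc i))) ?F"
      using J by (intro sigma_finite_measure.emeasure_pair_measure_Times[OF prob_space_imp_sigma_finite[OF B]]) (auto intro!: sets_PiM_I finite_vimageI)
    also have "emeasure (PiM UNIV (\<lambda>i. M (Suc i))) ?F = (\<Prod>j\<in>Suc -` J. emeasure (M (Suc j)) (E (Suc j)))"
      using J by (intro B.emeasure_PiM_emb) (simp_all add: finite_vimageI)
    also have "\<dots> = (\<Prod>j\<in>J - {0}. emeasure (M j) (E j))"
      by (intro prod.reindex_bij_witness[of _ "\<lambda>x. x - 1" Suc]) auto
    also have "emeasure (M 0) ?E * (\<Prod>j\<in>J - {0}. emeasure (M j) (E j)) = (\<Prod>j\<in>J. emeasure (M j) (E j))"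
      by (auto simp: prob_space.emeasure_space_1[OF assms] prod.remove J)
    finally show "emeasure ?D ?X = (\<Prod>j\<in>J. emeasure (M j) (E j))" .
  qed simp_all
qed

definition expo :: "real measure" where
  "expo = density lborel (\<lambda>x. ennreal (exponential_density 1 x))"

lemma exp_space_eq: "exp_space = PiM UNIV (\<lambda>_. expo)"
  by (simp add: exp_space_def expo_def)

lemma sets_expo [simp, measurable_cong]: "sets expo = sets borel"
  and space_expo [simp]: "space expo = UNIV"
  by (simp_all add: expo_def)

lemma prob_space_expo: "prob_space expo"
  unfolding expo_def by (rule prob_space_exponential_density) simp

lemma sets_exp_space [simp, measurable_cong]: "sets exp_space = sets seqM"
  unfolding exp_space_eq seqM_def by (intro sets_PiM_cong) auto

lemma space_exp_space [simp]: "space exp_space = UNIV"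
  using sets_eq_imp_space_eq[OF sets_exp_space] by simp

lemma prob_space_exp_space: "prob_space exp_space"
  unfolding exp_space_eq by (intro prob_space_PiM prob_space_expo)

interpretation expo: prob_space expo by (rule prob_space_expo)
interpretation es: prob_space exp_space by (rule prob_space_exp_space)
interpretation es_pair: pair_sigma_finite exp_space exp_space ..
interpretation lb_es: pair_sigma_finite lborel exp_space ..
interpretation lb_expo: pair_sigma_finite lborel expo ..

lemma measurable_case_nat_seqM [measurable (raw)]:
  assumes [measurable]: "f \<in> borel_measurable M" "F \<in> measurable M seqM"
  shows "(\<lambda>w. case_nat (f w) (F w)) \<in> measurable M seqM"
proof (rule measurable_seqMI)
  fix n show "(\<lambda>w. case_nat (f w) (F w) n) \<in> borel_measurable M" by (cases n) simp_all
qed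

lemma nn_integral_expo:
  assumes [measurable]: "f \<in> borel_measurable borel"
  shows "(\<integral>\<^sup>+x. f x \<partial>expo) = (\<integral>\<^sup>+x. ennreal (exp (- x)) * f x * indicator {0..} x \<partial>lborel)"
  unfolding expo_def
  by (subst nn_integral_density, simp, simp, rule nn_integral_cong)
    (auto simp: exponential_density_def indicator_def)

lemma nn_integral_exp_space:
  assumes [measurable]: "g \<in> borel_measurable seqM"
  shows "(\<integral>\<^sup>+E. g E \<partial>exp_space) = (\<integral>\<^sup>+e. \<integral>\<^sup>+E. g (case_nat e E) \<partial>exp_space \<partial>expo)"
proof -
  have "(\<integral>\<^sup>+E. g E \<partial>exp_space) =
      (\<integral>\<^sup>+E. g E \<partial>distr (expo \<Otimes>\<^sub>M exp_space) exp_space (\<lambda>(s, w). case_nat s w))"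
    using distr_case_nat_PiM[of "\<lambda>_. expo"] prob_space_expo by (simp add: exp_space_eq)
  also have "\<dots> = (\<integral>\<^sup>+p. g (case p of (s, w) \<Rightarrow> case_nat s w) \<partial>(expo \<Otimes>\<^sub>M exp_space))"
    by (rule nn_integral_distr) measurable
  also have "\<dots> = (\<integral>\<^sup>+e. \<integral>\<^sup>+E. g (case_nat e E) \<partial>exp_space \<partial>expo)"
    by (subst es.nn_integral_fst[symmetric]) (simp_all add: case_prod_beta)
  finally show ?thesis .
qed

lemma nn_integral_lborel_shift:
  fixes f :: "real \<Rightarrow> ennreal"
  assumes "f \<in> borel_measurable borel"
  shows "(\<integral>\<^sup>+x. f x \<partial>lborel) = (\<integral>\<^sup>+x. f (x - t) \<partial>lborel)"
  using nn_integral_real_affine[OF assms, of 1 "- t"] by simp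

section \<open>Arrival times, deletion of an arrival, and the Mecke equation\<close>

definition arrival :: "(nat \<Rightarrow> real) \<Rightarrow> nat \<Rightarrow> real" where
  "arrival E i = (\<Sum>j\<le>i. E j)"

text \<open>Deleting the \<open>i\<close>-th arrival of a point process merges its gaps \<open>i\<close> and \<open>i + 1\<close>.\<close>
definition merge_gap :: "nat \<Rightarrow> (nat \<Rightarrow> real) \<Rightarrow> nat \<Rightarrow> real" where
  "merge_gap i E j = (if j < i then E j else if j = i then E i + E (Suc i) else E (Suc j))"

lemma arrival_0 [simp]: "arrival E 0 = E 0"
  and arrival_Suc: "arrival E (Suc i) = arrival E i + E (Suc i)"
  by (simp_all add: arrival_def)

lemma arrival_case_nat_Suc [simp]: "arrival (case_nat e E) (Suc i) = e + arrival E i"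
  unfolding arrival_def by (subst sum.atMost_Suc_shift) simp

lemma arrival_merge_gap:
  "arrival (merge_gap i E) j = (if j < i then arrival E j else arrival E (Suc j))"
proof (induction j)
  case 0
  then show ?case by (auto simp: merge_gap_def arrival_Suc)
next
  case (Suc j)
  then show ?case
    by (cases "Suc j = i") (auto simp: arrival_Suc merge_gap_def not_less le_Suc_eq less_Suc_eq)
qed

lemma merge_gap_0: "merge_gap 0 (case_nat a (case_nat b E)) = case_nat (a + b) E"
  by (rule ext) (auto simp: merge_gap_def split: nat.split)

lemma merge_gap_Suc: "merge_gap (Suc i) (case_nat e E) = case_nat e (merge_gap i E)"
  by (rule ext) (auto simp: merge_gap_def split: nat.split)

lemma measurable_arrival [measurable (raw)]:
  "F \<in> measurable M seqM \<Longrightarrow> (\<lambda>w. arrival (F w) i) \<in> borel_measurable M"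
  unfolding arrival_def by (intro borel_measurable_sum measurable_seqM_component)

lemma measurable_merge_gap [measurable (raw)]:
  assumes [measurable]: "F \<in> measurable M seqM"
  shows "(\<lambda>w. merge_gap i (F w)) \<in> measurable M seqM"
  unfolding merge_gap_def by (rule measurable_seqMI) simp

text \<open>All arrivals before the \<open>i\<close>-th are required to precede \<open>u\<close>, not only the last of them, so that
  the recursion \<open>passage_Suc\<close> needs no positivity of the gaps.\<close>
definition passage :: "nat \<Rightarrow> real \<Rightarrow> (nat \<Rightarrow> real) \<Rightarrow> bool" where
  "passage i u E \<longleftrightarrow> (\<forall>j<i. arrival E j \<le> u) \<and> u < arrival E i"

lemma passage_0: "passage 0 u (case_nat e E) \<longleftrightarrow> u < e"
  by (simp add: passage_def)

lemma passage_Suc: "passage (Suc i) v (case_nat e E) \<longleftrightarrow> e \<le> v \<and> passage i (v - e) E"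
proof -
  have "(\<forall>j<Suc i. arrival (case_nat e E) j \<le> v) \<longleftrightarrow>
      arrival (case_nat e E) 0 \<le> v \<and> (\<forall>j<i. arrival (case_nat e E) (Suc j) \<le> v)"
    by (rule All_less_Suc2)
  then show ?thesis by (auto simp: passage_def algebra_simps)
qed

lemma measurable_passage [measurable (raw)]:
  assumes [measurable]: "f \<in> borel_measurable M" "F \<in> measurable M seqM"
  shows "Measurable.pred M (\<lambda>w. passage i (f w) (F w))"
  unfolding passage_def by measurable

lemma suminf_passage:
  assumes "\<exists>n. u < arrival E n"
  shows "(\<Sum>i. of_bool (passage i u E) :: ennreal) = 1"
proof -
  define n where "n = (LEAST n. u < arrival E n)"
  have n: "u < arrival E n" unfolding n_def using assms by (rule LeastI_ex)
  have less: "\<not> u < arrival E j" if "j < n" for j using that unfolding n_def by (rule not_less_Least)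
  have "passage i u E \<longleftrightarrow> i = n" for i
    using n less by (auto simp: passage_def not_less) (metis less n linorder_neqE_nat not_less)
  then have "(\<Sum>i. of_bool (passage i u E) :: ennreal) = (\<Sum>i\<in>{n}. of_bool (passage i u E))"
    by (intro suminf_finite) auto
  also have "\<dots> = 1" using n less by (simp add: passage_def not_less)
  finally show ?thesis .
qed

lemma expo_AE_pos: "AE e in expo. 0 < e"
  unfolding expo_def
  by (subst AE_density, simp, rule AE_mp[OF AE_lborel_singleton[of 0]])
    (auto simp: exponential_density_def intro!: AE_I2)

text \<open>\<open>passage i u E\<close> says that a point inserted at \<open>u\<close> becomes
  arrival number \<open>i\<close> of \<open>E\<close>. Deleting that arrival and inserting it again
  are inverse to each other, and the exponential weights of the two gaps beside it multiply to the
  weight of the merged gap. The induction peels off the first gap.\<close>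

lemma mecke_single:
  assumes [measurable]: "(\<lambda>x. g (fst x) (snd x)) \<in> borel_measurable (borel \<Otimes>\<^sub>M seqM)"
  shows "(\<integral>\<^sup>+E. g (arrival E i) (merge_gap i E) \<partial>exp_space) =
    (\<integral>\<^sup>+u. indicator {0..} u * (\<integral>\<^sup>+E. g u E * of_bool (passage i u E) \<partial>exp_space) \<partial>lborel)"
  using assms
proof (induction i arbitrary: g)
  case (0 g)
  note [measurable] = 0
  have g[measurable (raw)]: "(\<lambda>w. g (f w) (F w)) \<in> borel_measurable M"
    if [measurable]: "f \<in> borel_measurable M" "F \<in> measurable M seqM" for f F and M :: "'z measure"
    using measurable_compose[OF _ 0, of "\<lambda>w. (f w, F w)" M] that by simp
  define h where "h a e = (\<integral>\<^sup>+E. g a (case_nat e E) \<partial>exp_space)" for a e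
  have h[measurable]: "(\<lambda>x. h (fst x) (snd x)) \<in> borel_measurable (borel \<Otimes>\<^sub>M borel)"
    unfolding h_def by measurable
  have h'[measurable (raw)]: "(\<lambda>w. h (f w) (f' w)) \<in> borel_measurable M"
    if [measurable]: "f \<in> borel_measurable M" "f' \<in> borel_measurable M" for f f' and M :: "'y measure"
    using measurable_compose[OF _ h, of "\<lambda>w. (f w, f' w)" M] that by simp
  have "(\<integral>\<^sup>+E. g (arrival E 0) (merge_gap 0 E) \<partial>exp_space) = (\<integral>\<^sup>+a. \<integral>\<^sup>+b. h a (a + b) \<partial>expo \<partial>expo)"
    by (subst nn_integral_exp_space, measurable)
      (subst nn_integral_exp_space, measurable, simp add: merge_gap_0 h_def)
  also have "\<dots> = (\<integral>\<^sup>+a. ennreal (exp (- a)) * (\<integral>\<^sup>+b. ennreal (exp (- b)) * h a (a + b) * indicator {0..} b \<partial>lborel)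
      * indicator {0..} a \<partial>lborel)"
    by (subst nn_integral_expo, measurable) (subst nn_integral_expo, measurable)
  \<comment> \<open>In the variable \<open>e = a + b\<close> the weights combine to
    \<open>exp (- a) * exp (- b) = exp (- e)\<close>: the merged gap \<open>e\<close> is exponential
    again, while \<open>a\<close> runs over Lebesgue measure below \<open>e\<close>.\<close>
  also have "\<dots> = (\<integral>\<^sup>+a. indicator {0..} a * (\<integral>\<^sup>+e. ennreal (exp (- e)) * (h a e * of_bool (a < e)) * indicator {0..} e \<partial>lborel) \<partial>lborel)"
  proof (rule nn_integral_cong)
    fix a :: real
    show "ennreal (exp (- a)) * (\<integral>\<^sup>+b. ennreal (exp (- b)) * h a (a + b) * indicator {0..} b \<partial>lborel) * indicator {0..} a
      = indicator {0..} a * (\<integral>\<^sup>+e. ennreal (exp (- e)) * (h a e * of_bool (a < e)) * indicator {0..} e \<partial>lborel)"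
    proof (cases "0 \<le> a")
      case True
      have shift: "(\<integral>\<^sup>+b. ennreal (exp (- b)) * h a (a + b) * indicator {0..} b \<partial>lborel)
          = (\<integral>\<^sup>+e. ennreal (exp (- (e - a))) * h a (a + (e - a)) * indicator {0..} (e - a) \<partial>lborel)"
        by (rule nn_integral_lborel_shift) measurable
      have "ennreal (exp (- a)) * (\<integral>\<^sup>+e. ennreal (exp (- (e - a))) * h a (a + (e - a)) * indicator {0..} (e - a) \<partial>lborel) =
          (\<integral>\<^sup>+e. ennreal (exp (- a)) * (ennreal (exp (- (e - a))) * h a (a + (e - a)) * indicator {0..} (e - a)) \<partial>lborel)"
        by (rule nn_integral_cmult[symmetric]) (subst measurable_lborel2, measurable)
      also have "\<dots> = (\<integral>\<^sup>+e. ennreal (exp (- e)) * (h a e * of_bool (a < e)) * indicator {0..} e \<partial>lborel)"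
      proof (rule nn_integral_cong_AE)
        show "AE e in lborel. ennreal (exp (- a)) * (ennreal (exp (- (e - a))) * h a (a + (e - a)) * indicator {0..} (e - a))
          = ennreal (exp (- e)) * (h a e * of_bool (a < e)) * indicator {0..} e"
          using AE_lborel_singleton[of a]
        proof eventually_elim
          case (elim e)
          show ?case
          proof (cases "a < e")
            case e: True
            have "ennreal (exp (- a)) * ennreal (exp (- (e - a))) = ennreal (exp (- e))"
              by (subst ennreal_mult'[symmetric]) (simp_all add: mult_exp_exp)
            moreover have "indicator {0..} (e - a) = (1::ennreal)" "indicator {0..} e = (1::ennreal)"
              using True e by simp_all
            moreover have "a + (e - a) = e" by simp
            ultimately show ?thesis using e by (simp only: mult_1_right of_bool_eq mult.assoc[symmetric])
          next
            case False
            then have "indicator {0..} (e - a) = (0::ennreal)" using elim by simp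
            then show ?thesis using False by (simp only: mult_zero_right mult_zero_left of_bool_eq)
          qed
        qed
      qed
      finally have eq: "ennreal (exp (- a)) * (\<integral>\<^sup>+b. ennreal (exp (- b)) * h a (a + b) * indicator {0..} b \<partial>lborel)
        = (\<integral>\<^sup>+e. ennreal (exp (- e)) * (h a e * of_bool (a < e)) * indicator {0..} e \<partial>lborel)"
        unfolding shift .
      have "indicator {0..} a = (1::ennreal)" using True by simp
      then show ?thesis unfolding eq by (simp only: mult_1_left mult_1_right)
    qed simp
  qed
  also have "\<dots> = (\<integral>\<^sup>+u. indicator {0..} u * (\<integral>\<^sup>+E. g u E * of_bool (passage 0 u E) \<partial>exp_space) \<partial>lborel)"
  proof (rule nn_integral_cong)
    fix u :: real
    have "(\<integral>\<^sup>+E. g u E * of_bool (passage 0 u E) \<partial>exp_space) = (\<integral>\<^sup>+e. h u e * of_bool (u < e) \<partial>expo)"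
      unfolding h_def
      by (subst nn_integral_exp_space, measurable) (simp add: passage_0 nn_integral_multc)
    also have "\<dots> = (\<integral>\<^sup>+e. ennreal (exp (- e)) * (h u e * of_bool (u < e)) * indicator {0..} e \<partial>lborel)"
      by (rule nn_integral_expo) measurable
    finally show "indicator {0..} u * (\<integral>\<^sup>+e. ennreal (exp (- e)) * (h u e * of_bool (u < e)) * indicator {0..} e \<partial>lborel)
       = indicator {0..} u * (\<integral>\<^sup>+E. g u E * of_bool (passage 0 u E) \<partial>exp_space)" by simp
  qed
  finally show ?case .
next
  case (Suc i g)
  note [measurable] = Suc.prems
  have g[measurable (raw)]: "(\<lambda>w. g (f w) (F w)) \<in> borel_measurable M"
    if [measurable]: "f \<in> borel_measurable M" "F \<in> measurable M seqM" for f F and M :: "'z measure"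
    using measurable_compose[OF _ Suc.prems, of "\<lambda>w. (f w, F w)" M] that by simp
  \<comment> \<open>\<open>e\<close> is the first gap. In the process behind it the deleted arrival
    sits at \<open>u\<close>, hence at \<open>e + u\<close> in the whole process.\<close>
  define k where "k e u = (\<integral>\<^sup>+E. g (e + u) (case_nat e E) * of_bool (passage i u E) \<partial>exp_space)" for e u
  have k[measurable]: "(\<lambda>x. k (fst x) (snd x)) \<in> borel_measurable (borel \<Otimes>\<^sub>M borel)"
    unfolding k_def by measurable
  have k'[measurable (raw)]: "(\<lambda>w. k (f w) (f' w)) \<in> borel_measurable M"
    if [measurable]: "f \<in> borel_measurable M" "f' \<in> borel_measurable M" for f f' and M :: "'y measure"
    using measurable_compose[OF _ k, of "\<lambda>w. (f w, f' w)" M] that by simp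
  have "(\<integral>\<^sup>+E. g (arrival E (Suc i)) (merge_gap (Suc i) E) \<partial>exp_space) =
      (\<integral>\<^sup>+e. \<integral>\<^sup>+E. g (e + arrival E i) (case_nat e (merge_gap i E)) \<partial>exp_space \<partial>expo)"
    by (subst nn_integral_exp_space, measurable) (simp add: merge_gap_Suc)
  also have "\<dots> = (\<integral>\<^sup>+e. (\<integral>\<^sup>+u. indicator {0..} u * k e u \<partial>lborel) \<partial>expo)"
    unfolding k_def by (intro nn_integral_cong Suc.IH) measurable
  also have "\<dots> = (\<integral>\<^sup>+e. (\<integral>\<^sup>+v. indicator {0..} v * (k e (v - e) * of_bool (e \<le> v)) \<partial>lborel) \<partial>expo)"
  proof (rule nn_integral_cong_AE)
    show "AE e in expo. (\<integral>\<^sup>+u. indicator {0..} u * k e u \<partial>lborel) =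
       (\<integral>\<^sup>+v. indicator {0..} v * (k e (v - e) * of_bool (e \<le> v)) \<partial>lborel)"
      using expo_AE_pos
    proof eventually_elim
      case (elim e)
      have "(\<integral>\<^sup>+u. indicator {0..} u * k e u \<partial>lborel) = (\<integral>\<^sup>+v. indicator {0..} (v - e) * k e (v - e) \<partial>lborel)"
        by (rule nn_integral_lborel_shift) measurable
      also have "\<dots> = (\<integral>\<^sup>+v. indicator {0..} v * (k e (v - e) * of_bool (e \<le> v)) \<partial>lborel)"
        using elim by (intro nn_integral_cong) (auto simp: indicator_def)
      finally show ?case .
    qed
  qed
  also have "\<dots> = (\<integral>\<^sup>+v. (\<integral>\<^sup>+e. indicator {0..} v * (k e (v - e) * of_bool (e \<le> v)) \<partial>expo) \<partial>lborel)"
    by (rule lb_expo.Fubini') measurable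
  also have "\<dots> = (\<integral>\<^sup>+u. indicator {0..} u * (\<integral>\<^sup>+E. g u E * of_bool (passage (Suc i) u E) \<partial>exp_space) \<partial>lborel)"
  proof (rule nn_integral_cong)
    fix v :: real
    have "(\<integral>\<^sup>+E. g v E * of_bool (passage (Suc i) v E) \<partial>exp_space) = (\<integral>\<^sup>+e. k e (v - e) * of_bool (e \<le> v) \<partial>expo)"
      unfolding k_def
      by (subst nn_integral_exp_space, measurable, rule nn_integral_cong, subst nn_integral_multc[symmetric])
        (measurable, auto intro!: nn_integral_cong simp: passage_Suc)
    moreover have "(\<integral>\<^sup>+e. indicator {0..} v * (k e (v - e) * of_bool (e \<le> v)) \<partial>expo) =
        indicator {0..} v * (\<integral>\<^sup>+e. k e (v - e) * of_bool (e \<le> v) \<partial>expo)"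
      by (rule nn_integral_cmult) (subst measurable_cong_sets[OF sets_expo refl], measurable)
    ultimately show "(\<integral>\<^sup>+e. indicator {0..} v * (k e (v - e) * of_bool (e \<le> v)) \<partial>expo) =
        indicator {0..} v * (\<integral>\<^sup>+E. g v E * of_bool (passage (Suc i) v E) \<partial>exp_space)"
      by (simp only:)
  qed
  finally show ?case .
qed

text \<open>Each gap contributes 1/2, the Laplace transform of the exponential law at 1. The
  geometric decay is what forces the arrivals to infinity in
  \<open>AE_arrival_exceeds\<close>.\<close>

lemma nn_integral_exp_arrival:
  "(\<integral>\<^sup>+E. ennreal (exp (- arrival E n)) \<partial>exp_space) = ennreal ((1/2) ^ Suc n)"
proof -
  have one: "(\<integral>\<^sup>+e. ennreal (exp (- e)) \<partial>expo) = ennreal (1/2)"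
  proof -
    have "(\<integral>\<^sup>+e. ennreal (exp (- e)) \<partial>expo) = (\<integral>\<^sup>+x. ennreal (exp (- 2 * x)) * indicator {0..} x \<partial>lborel)"
      by (subst nn_integral_expo) (auto simp: ennreal_mult'[symmetric] mult_exp_exp intro!: nn_integral_cong)
    also have "\<dots> = ennreal (0 - (- exp (- 2 * 0) / 2))"
    proof (rule nn_integral_FTC_atLeast)
      show "((\<lambda>x::real. - exp (- 2 * x) / 2) \<longlongrightarrow> 0) at_top" by real_asymp
    qed (auto intro!: derivative_eq_intros)
    finally show ?thesis by simp
  qed
  show ?thesis
  proof (induction n)
    case 0
    have "(\<integral>\<^sup>+E. ennreal (exp (- arrival E 0)) \<partial>exp_space) = (\<integral>\<^sup>+e. ennreal (exp (- e)) \<partial>expo)"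
      by (subst nn_integral_exp_space, measurable) (simp add: es.emeasure_space_1[simplified])
    then show ?case using one by simp
  next
    case (Suc n)
    have "(\<integral>\<^sup>+E. ennreal (exp (- arrival E (Suc n))) \<partial>exp_space) =
        (\<integral>\<^sup>+e. ennreal (exp (- e)) * (\<integral>\<^sup>+E. ennreal (exp (- arrival E n)) \<partial>exp_space) \<partial>expo)"
      by (subst nn_integral_exp_space, measurable, subst nn_integral_cmult[symmetric], measurable)
        (simp add: ennreal_mult'[symmetric] mult_exp_exp)
    also have "\<dots> = ennreal (1/2) * ennreal ((1/2) ^ Suc n)"
      unfolding Suc one[symmetric] by (rule nn_integral_multc) (simp add: expo_def)
    also have "\<dots> = ennreal ((1/2) ^ Suc (Suc n))" by (subst ennreal_mult'[symmetric]) simp_all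
    finally show ?case .
  qed
qed

lemma AE_arrival_exceeds: "AE E in exp_space. \<forall>u. \<exists>n. u < arrival E n"
proof -
  have "AE E in exp_space. \<exists>n. real m < arrival E n" for m :: nat
  proof -
    let ?A = "{E \<in> space exp_space. \<forall>n. arrival E n \<le> real m}"
    have [measurable]: "?A \<in> sets exp_space" by measurable
    \<comment> \<open>Markov's inequality: on \<open>?A\<close> one has
      \<open>1 \<le> exp m * exp (- arrival E n)\<close> for every \<open>n\<close>.\<close>
    have "emeasure exp_space ?A \<le> ennreal (exp (real m) * (1/2) ^ Suc n)" for n
    proof -
      have "emeasure exp_space ?A = (\<integral>\<^sup>+E. indicator ?A E \<partial>exp_space)"
        by (rule nn_integral_indicator[symmetric]) measurable
      also have "\<dots> \<le> (\<integral>\<^sup>+E. ennreal (exp (real m)) * ennreal (exp (- arrival E n)) \<partial>exp_space)"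
        by (rule nn_integral_mono)
          (auto simp: indicator_def ennreal_mult'[symmetric] mult_exp_exp)
      also have "\<dots> = ennreal (exp (real m)) * ennreal ((1/2) ^ Suc n)"
        by (subst nn_integral_cmult) (simp_all only: nn_integral_exp_arrival, measurable)
      also have "\<dots> = ennreal (exp (real m) * (1/2) ^ Suc n)" by (subst ennreal_mult') simp_all
      finally show ?thesis .
    qed
    moreover have "(\<lambda>n. ennreal (exp (real m) * (1/2) ^ Suc n)) \<longlonglongrightarrow> ennreal 0"
      by (intro tendsto_ennrealI) real_asymp
    ultimately have "emeasure exp_space ?A \<le> ennreal 0" by (intro LIMSEQ_le_const) auto
    then have "emeasure exp_space ?A = 0" by simp
    then show ?thesis
      using AE_iff_measurable[OF \<open>?A \<in> sets exp_space\<close>, of "\<lambda>E. \<exists>n. real m < arrival E n"]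
      by (simp add: not_less)
  qed
  then have "AE E in exp_space. \<forall>m::nat. \<exists>n. real m < arrival E n" by (simp add: AE_all_countable)
  then show ?thesis
  proof eventually_elim
    case (elim E)
    show ?case
    proof
      fix u :: real
      obtain m :: nat where "u \<le> real m" using real_arch_simple by blast
      then show "\<exists>n. u < arrival E n" using elim by (meson le_less_trans)
    qed
  qed
qed

lemma AE_exp_space_pos: "AE E in exp_space. \<forall>i. 0 < E i"
proof -
  interpret product_prob_space "\<lambda>_. expo" "UNIV :: nat set"
    by (intro product_prob_spaceI prob_space_expo)
  show ?thesis unfolding exp_space_eq AE_all_countable
    by (intro allI AE_component expo_AE_pos) auto
qed

text \<open>Almost surely every \<open>u\<close> is passed for the first time at exactly one index,
  so summing \<open>mecke_single\<close> over \<open>i\<close> removes the passage condition and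
  leaves the full Lebesgue intensity.\<close>

lemma mecke:
  assumes [measurable]: "(\<lambda>x. g (fst x) (snd x)) \<in> borel_measurable (borel \<Otimes>\<^sub>M seqM)"
  shows "(\<integral>\<^sup>+E. (\<Sum>i. g (arrival E i) (merge_gap i E)) \<partial>exp_space) =
    (\<integral>\<^sup>+u. indicator {0..} u * (\<integral>\<^sup>+E. g u E \<partial>exp_space) \<partial>lborel)"
proof -
  have g[measurable (raw)]: "(\<lambda>w. g (f w) (F w)) \<in> borel_measurable M"
    if [measurable]: "f \<in> borel_measurable M" "F \<in> measurable M seqM" for f F and M :: "'z measure"
    using measurable_compose[OF _ assms, of "\<lambda>w. (f w, F w)" M] that by simp
  have "(\<integral>\<^sup>+E. (\<Sum>i. g (arrival E i) (merge_gap i E)) \<partial>exp_space) =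
    (\<Sum>i. \<integral>\<^sup>+u. indicator {0..} u * (\<integral>\<^sup>+E. g u E * of_bool (passage i u E) \<partial>exp_space) \<partial>lborel)"
    by (subst nn_integral_suminf, measurable) (simp add: mecke_single)
  also have "\<dots> = (\<integral>\<^sup>+u. indicator {0..} u * (\<integral>\<^sup>+E. (\<Sum>i. g u E * of_bool (passage i u E)) \<partial>exp_space) \<partial>lborel)"
  proof -
    have "(\<Sum>i. \<integral>\<^sup>+u. indicator {0..} u * (\<integral>\<^sup>+E. g u E * of_bool (passage i u E) \<partial>exp_space) \<partial>lborel)
        = (\<integral>\<^sup>+u. (\<Sum>i. indicator {0..} u * (\<integral>\<^sup>+E. g u E * of_bool (passage i u E) \<partial>exp_space)) \<partial>lborel)"
      by (rule nn_integral_suminf[symmetric]) measurable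
    also have "\<dots> = (\<integral>\<^sup>+u. indicator {0..} u * (\<integral>\<^sup>+E. (\<Sum>i. g u E * of_bool (passage i u E)) \<partial>exp_space) \<partial>lborel)"
    proof (rule nn_integral_cong)
    fix u :: real
    have "(\<integral>\<^sup>+E. (\<Sum>i. g u E * of_bool (passage i u E)) \<partial>exp_space) =
        (\<Sum>i. \<integral>\<^sup>+E. g u E * of_bool (passage i u E) \<partial>exp_space)"
      by (rule nn_integral_suminf) measurable
    then show "(\<Sum>i. indicator {0..} u * (\<integral>\<^sup>+E. g u E * of_bool (passage i u E) \<partial>exp_space)) =
        indicator {0..} u * (\<integral>\<^sup>+E. (\<Sum>i. g u E * of_bool (passage i u E)) \<partial>exp_space)"
      by (simp only: ennreal_suminf_cmult)
    qed
    finally show ?thesis .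
  qed
  also have "\<dots> = (\<integral>\<^sup>+u. indicator {0..} u * (\<integral>\<^sup>+E. g u E \<partial>exp_space) \<partial>lborel)"
  proof (rule nn_integral_cong, rule arg_cong2[where f = times, OF refl], rule nn_integral_cong_AE)
    fix u :: real
    show "AE E in exp_space. (\<Sum>i. g u E * of_bool (passage i u E)) = g u E"
      using AE_arrival_exceeds
      by eventually_elim (simp add: ennreal_suminf_cmult suminf_passage)
  qed
  finally show ?thesis .
qed

section \<open>Uniqueness for Laplace transforms\<close>

text \<open>Laplace values at the integers are the moments of \<open>exp (- x)\<close>, a variable
  with values in \<open>[0, 1]\<close>. By Weierstrass approximation the moments determine the
  integrals of continuous functions of it, and limits of these are the indicators of
  \<open>{a<..}\<close>.\<close>

lemma laplace_unique:
  fixes M N :: "real measure"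
  assumes fin: "finite_measure M" "finite_measure N"
    and sets [measurable_cong]: "sets M = sets borel" "sets N = sets borel"
    and pos: "AE x in M. 0 \<le> x" "AE x in N. 0 \<le> x"
    and eq: "\<And>k :: nat. (\<integral>\<^sup>+x. ennreal (exp (- (real k * x))) \<partial>M) = (\<integral>\<^sup>+x. ennreal (exp (- (real k * x))) \<partial>N)"
  shows "M = N"
proof -
  interpret M: finite_measure M by fact
  interpret N: finite_measure N by fact
  \<comment> \<open>Truncation at \<open>0\<close> keeps \<open>z\<close> in \<open>[0, 1]\<close>
    also on the null set of negative points, so approximations on \<open>[0, 1]\<close> hold
    everywhere.\<close>
  define z where "z x = exp (- max 0 x)" for x :: real
  have z: "0 \<le> z x" "z x \<le> 1" "z x \<in> {0..1}" for x by (auto simp: z_def)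
  have [measurable]: "z \<in> borel_measurable borel" unfolding z_def by measurable
  have zpow: "z x ^ k = exp (- (real k * x))" if "0 \<le> x" for x k
    using that by (simp add: z_def exp_of_nat_mult[symmetric])
  have mom: "(LINT x|M. z x ^ k) = (LINT x|N. z x ^ k)" for k
  proof -
    have "(\<integral>\<^sup>+x. ennreal (z x ^ k) \<partial>M) = (\<integral>\<^sup>+x. ennreal (exp (- (real k * x))) \<partial>M)"
      using pos(1) by (intro nn_integral_cong_AE) (auto elim!: eventually_mono simp: zpow)
    moreover have "(\<integral>\<^sup>+x. ennreal (z x ^ k) \<partial>N) = (\<integral>\<^sup>+x. ennreal (exp (- (real k * x))) \<partial>N)"
      using pos(2) by (intro nn_integral_cong_AE) (auto elim!: eventually_mono simp: zpow)
    ultimately have "(\<integral>\<^sup>+x. ennreal (z x ^ k) \<partial>M) = (\<integral>\<^sup>+x. ennreal (z x ^ k) \<partial>N)" using eq by simp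
    then show ?thesis by (subst (1 2) integral_eq_nn_integral) (measurable, auto simp: z)
  qed
  have int: "integrable M (\<lambda>x. z x ^ k)" "integrable N (\<lambda>x. z x ^ k)" for k
    by (auto intro!: M.integrable_const_bound[where B = 1] N.integrable_const_bound[where B = 1]
        simp: z power_le_one)
  have cont: "(LINT x|M. f (z x)) = (LINT x|N. f (z x))"
    if f: "continuous_on UNIV f" and f01: "\<And>x. 0 \<le> f x" "\<And>x. f x \<le> 1" for f :: "real \<Rightarrow> real"
  proof -
    have [measurable]: "f \<in> borel_measurable borel" by (rule borel_measurable_continuous_onI[OF f])
    have fi: "integrable M (\<lambda>x. f (z x))" "integrable N (\<lambda>x. f (z x))"
      by (auto intro!: M.integrable_const_bound[where B = 1] N.integrable_const_bound[where B = 1] simp: f01)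
    define C where "C = measure M (space M) + measure N (space N)"
    have "\<bar>(LINT x|M. f (z x)) - (LINT x|N. f (z x))\<bar> \<le> e * C" if e: "0 < e" for e
    proof -
      obtain g where g: "real_polynomial_function g" "\<And>x. x \<in> {0..1} \<Longrightarrow> \<bar>f x - g x\<bar> < e"
        using Stone_Weierstrass_real_polynomial_function[OF _ continuous_on_subset[OF f] e, of "{0..1}"]
        by auto
      obtain a n where ga: "g = (\<lambda>x. \<Sum>i\<le>n. a i * x ^ i)"
        using g(1) by (auto simp: real_polynomial_function_iff_sum)
      have gi: "integrable M (\<lambda>x. g (z x))" "integrable N (\<lambda>x. g (z x))"
        unfolding ga by (auto intro!: Bochner_Integration.integrable_sum integrable_mult_right int)
      have geq: "(LINT x|M. g (z x)) = (LINT x|N. g (z x))"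
        unfolding ga by (simp add: Bochner_Integration.integral_sum int mom)
      have "\<bar>(LINT x|M. f (z x)) - (LINT x|M. g (z x))\<bar> = \<bar>LINT x|M. f (z x) - g (z x)\<bar>"
        by (simp add: fi gi)
      also have "\<dots> \<le> (LINT x|M. \<bar>f (z x) - g (z x)\<bar>)" by (rule integral_abs_bound)
      also have "\<dots> \<le> (LINT x|M. e)"
        by (intro integral_mono) (use g(2)[OF z(3)] in \<open>auto intro!: integrable_abs fi gi simp: less_imp_le\<close>)
      finally have 1: "\<bar>(LINT x|M. f (z x)) - (LINT x|M. g (z x))\<bar> \<le> e * measure M (space M)" by (simp add: mult.commute)
      have "\<bar>(LINT x|N. f (z x)) - (LINT x|N. g (z x))\<bar> = \<bar>LINT x|N. f (z x) - g (z x)\<bar>"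
        by (simp add: fi gi)
      also have "\<dots> \<le> (LINT x|N. \<bar>f (z x) - g (z x)\<bar>)" by (rule integral_abs_bound)
      also have "\<dots> \<le> (LINT x|N. e)"
        by (intro integral_mono) (use g(2)[OF z(3)] in \<open>auto intro!: integrable_abs fi gi simp: less_imp_le\<close>)
      finally have 2: "\<bar>(LINT x|N. f (z x)) - (LINT x|N. g (z x))\<bar> \<le> e * measure N (space N)" by (simp add: mult.commute)
      show ?thesis using 1 2 geq unfolding C_def by (simp add: algebra_simps abs_le_iff)
    qed
    moreover have "0 \<le> C" unfolding C_def by simp
    ultimately have "\<bar>(LINT x|M. f (z x)) - (LINT x|N. f (z x))\<bar> \<le> 0 + e" if "0 < e" for e
    proof -
      assume *: "\<And>e. 0 < e \<Longrightarrow> \<bar>(LINT x|M. f (z x)) - (LINT x|N. f (z x))\<bar> \<le> e * C"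
      have "\<bar>(LINT x|M. f (z x)) - (LINT x|N. f (z x))\<bar> \<le> e / (C + 1) * C"
        using *[of "e / (C + 1)"] that \<open>0 \<le> C\<close> by simp
      also have "\<dots> \<le> e" using that \<open>0 \<le> C\<close> by (simp add: field_simps)
      finally show ?thesis by simp
    qed
    then have "\<bar>(LINT x|M. f (z x)) - (LINT x|N. f (z x))\<bar> \<le> 0" by (rule field_le_epsilon)
    then show ?thesis by simp
  qed
  show ?thesis
  proof (rule measure_eqI_lessThan[OF sets])
    fix a :: real
    show "emeasure M {a<..} < \<infinity>" using M.emeasure_finite by (simp add: top.not_eq_extremum[symmetric])
    show "emeasure M {a<..} = emeasure N {a<..}"
    proof (cases "0 \<le> a")
      case True
      define c where "c = exp (- a)"
      have zc: "z x < c \<longleftrightarrow> a < x" for x using True by (auto simp: z_def c_def max_def)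
      \<comment> \<open>Continuous ramps increasing to the indicator of \<open>t < c\<close>; with
        \<open>c = exp (- a)\<close> the event \<open>a < x\<close> is
        \<open>z x < c\<close>.\<close>
      define f where "f n t = min 1 (real n * max 0 (c - t))" for n t
      have lim: "(\<lambda>n. f n (z x)) \<longlonglongrightarrow> indicator {a<..} x" for x
      proof (cases "a < x")
        case True
        then have "0 < c - z x" using zc[of x] by simp
        then have "eventually (\<lambda>n. 1 \<le> real n * (c - z x)) sequentially" by real_asymp
        then have "eventually (\<lambda>n. f n (z x) = 1) sequentially"
          by eventually_elim (use \<open>0 < c - z x\<close> in \<open>auto simp: f_def\<close>)
        then show ?thesis using True by (simp add: tendsto_eventually)
      next
        case False
        then have "c \<le> z x" using zc[of x] by simp
        then show ?thesis using False by (simp add: f_def)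
      qed
      have feq: "(LINT x|M. f n (z x)) = (LINT x|N. f n (z x))" for n
        by (rule cont) (auto simp: f_def intro!: continuous_intros)
      have [measurable]: "(\<lambda>x. f n (z x)) \<in> borel_measurable borel" for n unfolding f_def by measurable
      have "(\<lambda>n. LINT x|M. f n (z x)) \<longlonglongrightarrow> (LINT x|M. indicator {a<..} x)"
        by (rule integral_dominated_convergence[where w = "\<lambda>_. 1"])
          (use lim in \<open>auto simp: f_def\<close>)
      moreover have "(\<lambda>n. LINT x|N. f n (z x)) \<longlonglongrightarrow> (LINT x|N. indicator {a<..} x)"
        by (rule integral_dominated_convergence[where w = "\<lambda>_. 1"])
          (use lim in \<open>auto simp: f_def\<close>)
      ultimately have "(LINT x|M. indicator {a<..} x) = (LINT x|N. indicator {a<..} x :: real)"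
        unfolding feq by (rule LIMSEQ_unique)
      then show ?thesis
        by (simp add: M.emeasure_eq_measure N.emeasure_eq_measure sets_eq_imp_space_eq[OF sets(1)] sets_eq_imp_space_eq[OF sets(2)])
    next
      case False
      have "emeasure M {a<..} = emeasure M (space M)"
        using pos(1) False by (intro emeasure_eq_AE) (auto simp: sets_eq_imp_space_eq[OF sets(1)])
      moreover have "emeasure N {a<..} = emeasure N (space N)"
        using pos(2) False by (intro emeasure_eq_AE) (auto simp: sets_eq_imp_space_eq[OF sets(2)])
      ultimately show ?thesis using eq[of 0] by simp
    qed
  qed
qed

lemma nn_integral_distr_density:
  assumes [measurable]: "X \<in> measurable M N" "w \<in> borel_measurable M" "f \<in> borel_measurable N"
  shows "(\<integral>\<^sup>+x. f x \<partial>distr (density M w) N X) = (\<integral>\<^sup>+x. w x * f (X x) \<partial>M)"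
  by (simp add: nn_integral_distr nn_integral_density)

text \<open>The coordinates are treated one at a time. With the exponential of the first
  \<open>n\<close> coordinates absorbed into the weight, \<open>laplace_unique\<close> identifies
  the weighted law of \<open>X n\<close>; the event \<open>X n \<in> B n\<close> then moves into the
  weight. This is why both sides carry weights.\<close>

lemma joint_laplace_unique:
  fixes X :: "nat \<Rightarrow> 'a \<Rightarrow> real" and Y :: "nat \<Rightarrow> 'b \<Rightarrow> real"
  assumes [measurable]: "\<And>i. X i \<in> borel_measurable M" "\<And>i. Y i \<in> borel_measurable N"
    and pos: "\<And>i. AE x in M. 0 \<le> X i x" "\<And>i. AE y in N. 0 \<le> Y i y"
    and B[measurable]: "\<And>i. B i \<in> sets borel"
    and w[measurable]: "w \<in> borel_measurable M" "v \<in> borel_measurable N"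
    and fin: "(\<integral>\<^sup>+x. w x \<partial>M) < \<infinity>" "(\<integral>\<^sup>+y. v y \<partial>N) < \<infinity>"
    and eq: "\<And>l. (\<And>i. 0 \<le> l i) \<Longrightarrow> (\<integral>\<^sup>+x. w x * ennreal (exp (- (\<Sum>i<n. l i * X i x))) \<partial>M) =
         (\<integral>\<^sup>+y. v y * ennreal (exp (- (\<Sum>i<n. l i * Y i y))) \<partial>N)"
  shows "(\<integral>\<^sup>+x. w x * of_bool (\<forall>i<n. X i x \<in> B i) \<partial>M) = (\<integral>\<^sup>+y. v y * of_bool (\<forall>i<n. Y i y \<in> B i) \<partial>N)"
  using w fin eq
proof (induction n arbitrary: w v)
  case 0
  then show ?case using 0(5)[of "\<lambda>_. 0"] by simp
next
  case (Suc n)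
  note [measurable] = Suc.prems(1,2)
  have step: "(\<integral>\<^sup>+x. (w x * indicator (B n) (X n x)) * ennreal (exp (- (\<Sum>i<n. l i * X i x))) \<partial>M) =
         (\<integral>\<^sup>+y. (v y * indicator (B n) (Y n y)) * ennreal (exp (- (\<Sum>i<n. l i * Y i y))) \<partial>N)"
    if l: "\<And>i. 0 \<le> l i" for l
  proof -
    let ?w = "\<lambda>x. w x * ennreal (exp (- (\<Sum>i<n. l i * X i x)))"
    let ?v = "\<lambda>y. v y * ennreal (exp (- (\<Sum>i<n. l i * Y i y)))"
    let ?M = "distr (density M ?w) borel (X n)" and ?N = "distr (density N ?v) borel (Y n)"
    have "?M = ?N"
    proof (rule laplace_unique)
      have "AE x in M. \<forall>i. 0 \<le> X i x" using pos(1) by (simp add: AE_all_countable)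
      then have "(\<integral>\<^sup>+x. ?w x \<partial>M) \<le> (\<integral>\<^sup>+x. w x \<partial>M)"
      proof (intro nn_integral_mono_AE, eventually_elim)
        fix x assume "\<forall>i. 0 \<le> X i x"
        then have "ennreal (exp (- (\<Sum>i<n. l i * X i x))) \<le> 1" by (simp add: sum_nonneg l)
        then show "?w x \<le> w x" using mult_left_mono[of _ 1 "w x"] by simp
      qed
      then have "emeasure ?M (space ?M) < \<infinity>"
        using Suc.prems(3) by (simp add: emeasure_distr emeasure_density cong: nn_integral_cong)
      then show "finite_measure ?M" by (intro finite_measureI) auto
      have "AE x in N. \<forall>i. 0 \<le> Y i x" using pos(2) by (simp add: AE_all_countable)
      then have "(\<integral>\<^sup>+x. ?v x \<partial>N) \<le> (\<integral>\<^sup>+x. v x \<partial>N)"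
      proof (intro nn_integral_mono_AE, eventually_elim)
        fix x assume "\<forall>i. 0 \<le> Y i x"
        then have "ennreal (exp (- (\<Sum>i<n. l i * Y i x))) \<le> 1" by (simp add: sum_nonneg l)
        then show "?v x \<le> v x" using mult_left_mono[of _ 1 "v x"] by simp
      qed
      then have "emeasure ?N (space ?N) < \<infinity>"
        using Suc.prems(4) by (simp add: emeasure_distr emeasure_density cong: nn_integral_cong)
      then show "finite_measure ?N" by (intro finite_measureI) auto
      show "AE x in ?M. 0 \<le> x" using pos(1)[of n] by (subst AE_distr_iff) (auto simp: AE_density elim: eventually_mono)
      show "AE x in ?N. 0 \<le> x" using pos(2)[of n] by (subst AE_distr_iff) (auto simp: AE_density elim: eventually_mono)
      fix k :: nat
      define l' where "l' i = (if i = n then real k else l i)" for i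
      have s: "(\<Sum>i<Suc n. l' i * X i x) = (\<Sum>i<n. l i * X i x) + real k * X n x"
        "(\<Sum>i<Suc n. l' i * Y i y) = (\<Sum>i<n. l i * Y i y) + real k * Y n y" for x y
        by (simp_all add: l'_def)
      have "(\<integral>\<^sup>+x. ennreal (exp (- (real k * x))) \<partial>?M) =
          (\<integral>\<^sup>+x. w x * ennreal (exp (- (\<Sum>i<Suc n. l' i * X i x))) \<partial>M)"
        unfolding s by (subst nn_integral_distr_density, measurable) (simp add: mult.assoc ennreal_mult'[symmetric] mult_exp_exp)
      also have "\<dots> = (\<integral>\<^sup>+y. v y * ennreal (exp (- (\<Sum>i<Suc n. l' i * Y i y))) \<partial>N)"
        by (rule Suc.prems(5)) (simp add: l'_def l)
      also have "\<dots> = (\<integral>\<^sup>+x. ennreal (exp (- (real k * x))) \<partial>?N)"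
        unfolding s by (subst nn_integral_distr_density, measurable) (simp add: mult.assoc ennreal_mult'[symmetric] mult_exp_exp)
      finally show "(\<integral>\<^sup>+x. ennreal (exp (- (real k * x))) \<partial>?M) = (\<integral>\<^sup>+x. ennreal (exp (- (real k * x))) \<partial>?N)" .
    qed auto
    then have "(\<integral>\<^sup>+x. indicator (B n) x \<partial>?M) = (\<integral>\<^sup>+x. indicator (B n) x \<partial>?N)" by simp
    moreover have "(\<integral>\<^sup>+x. indicator (B n) x \<partial>?M) = (\<integral>\<^sup>+x. ?w x * indicator (B n) (X n x) \<partial>M)"
      by (subst nn_integral_distr_density, measurable)
    moreover have "(\<integral>\<^sup>+x. indicator (B n) x \<partial>?N) = (\<integral>\<^sup>+x. ?v x * indicator (B n) (Y n x) \<partial>N)"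
      by (subst nn_integral_distr_density, measurable)
    ultimately show ?thesis by (simp only: mult_ac)
  qed
  have "(\<integral>\<^sup>+x. (w x * indicator (B n) (X n x)) * of_bool (\<forall>i<n. X i x \<in> B i) \<partial>M) =
        (\<integral>\<^sup>+y. (v y * indicator (B n) (Y n y)) * of_bool (\<forall>i<n. Y i y \<in> B i) \<partial>N)"
  proof (rule Suc.IH)
    have "(\<integral>\<^sup>+x. w x * indicator (B n) (X n x) \<partial>M) \<le> (\<integral>\<^sup>+x. w x \<partial>M)"
      by (intro nn_integral_mono) (auto simp: indicator_def)
    then show "(\<integral>\<^sup>+x. w x * indicator (B n) (X n x) \<partial>M) < \<infinity>" using Suc.prems(3) by (rule le_less_trans)
    have "(\<integral>\<^sup>+x. v x * indicator (B n) (Y n x) \<partial>N) \<le> (\<integral>\<^sup>+x. v x \<partial>N)"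
      by (intro nn_integral_mono) (auto simp: indicator_def)
    then show "(\<integral>\<^sup>+x. v x * indicator (B n) (Y n x) \<partial>N) < \<infinity>" using Suc.prems(4) by (rule le_less_trans)
  qed (use step in auto)
  moreover have "w x * indicator (B n) (X n x) * of_bool (\<forall>i<n. X i x \<in> B i) = w x * of_bool (\<forall>i<Suc n. X i x \<in> B i)"
    "v y * indicator (B n) (Y n y) * of_bool (\<forall>i<n. Y i y \<in> B i) = v y * of_bool (\<forall>i<Suc n. Y i y \<in> B i)" for x y
    by (simp_all add: All_less_Suc indicator_def)
  ultimately show ?case by (simp only:)
qed

section \<open>Changes of variables\<close>

text \<open>The compact intervals increase to \<open>U\<close> and their images to \<open>V\<close>,
  so both sides are monotone limits. In this way open and unbounded domains are covered.\<close>

lemma nn_integral_substitution_incr: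
  fixes f :: "real \<Rightarrow> ennreal" and g g' :: "real \<Rightarrow> real"
  assumes [measurable]: "f \<in> borel_measurable borel" "g \<in> borel_measurable borel" "g' \<in> borel_measurable borel"
    and ab: "\<And>n. a n < b n" "decseq a" "incseq b"
    and deriv: "\<And>n x. x \<in> {a n..b n} \<Longrightarrow> (g has_real_derivative g' x) (at x)"
    and cont: "\<And>n. continuous_on {a n..b n} g'"
    and nonneg: "\<And>n x. x \<in> {a n..b n} \<Longrightarrow> 0 \<le> g' x"
    and U: "U = (\<Union>n. {a n..b n})" and V: "V = (\<Union>n. {g (a n)..g (b n)})"
  shows "(\<integral>\<^sup>+y. f y * indicator V y \<partial>lborel) = (\<integral>\<^sup>+x. f (g x) * ennreal (g' x) * indicator U x \<partial>lborel)"
proof -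
  have gmono: "g x \<le> g y" if "x \<in> {a n..b n}" "y \<in> {a n..b n}" "x \<le> y" for n x y
  proof (rule DERIV_nonneg_imp_nondecreasing[OF that(3)])
    fix t assume "x \<le> t" "t \<le> y"
    then have "t \<in> {a n..b n}" using that by auto
    then show "\<exists>y. (g has_real_derivative y) (at t) \<and> 0 \<le> y" using deriv nonneg by blast
  qed
  have inc1: "incseq (\<lambda>n. {a n..b n})"
    using ab by (auto simp: incseq_def decseq_def intro: order_trans)
  have inc2: "incseq (\<lambda>n. {g (a n)..g (b n)})"
  proof (rule incseq_SucI)
    fix n
    have "a (Suc n) \<le> a n" "b n \<le> b (Suc n)" using ab by (auto simp: incseq_SucD decseq_SucD)
    then have "g (a (Suc n)) \<le> g (a n)" "g (b n) \<le> g (b (Suc n))"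
      using ab(1)[of n] by (auto intro!: gmono[of _ "Suc n"])
    then show "{g (a n)..g (b n)} \<subseteq> {g (a (Suc n))..g (b (Suc n))}" by auto
  qed
  have inc: "incseq (\<lambda>n x. h x * indicator (A n) x)" if "incseq A"
    for h :: "real \<Rightarrow> ennreal" and A :: "nat \<Rightarrow> real set"
  proof (intro monoI le_funI)
    fix m n :: nat and x assume "m \<le> n"
    then have "A m \<subseteq> A n" using that by (auto simp: incseq_def)
    then show "h x * indicator (A m) x \<le> h x * indicator (A n) x"
      by (auto simp: indicator_def)
  qed
  have sup: "(SUP n. h x * indicator (A n) x) = h x * indicator (\<Union>n. A n) x"
    for h :: "real \<Rightarrow> ennreal" and A :: "nat \<Rightarrow> real set" and x
  proof (cases "\<exists>n. x \<in> A n")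
    case True
    then obtain n where "x \<in> A n" ..
    then have "(SUP n. h x * indicator (A n) x) = h x"
      by (intro antisym SUP_least SUP_upper2[of n]) (auto simp: indicator_def)
    then show ?thesis using \<open>x \<in> A n\<close> by (auto simp: indicator_def)
  qed simp
  have "(\<integral>\<^sup>+y. f y * indicator V y \<partial>lborel) = (\<integral>\<^sup>+y. (SUP n. f y * indicator {g (a n)..g (b n)} y) \<partial>lborel)"
    unfolding V by (rule nn_integral_cong) (rule sup[symmetric])
  also have "\<dots> = (SUP n. \<integral>\<^sup>+y. f y * indicator {g (a n)..g (b n)} y \<partial>lborel)"
    by (intro nn_integral_monotone_convergence_SUP inc[OF inc2]) measurable
  also have "\<dots> = (SUP n. \<integral>\<^sup>+x. f (g x) * ennreal (g' x) * indicator {a n..b n} x \<partial>lborel)"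
    by (intro SUP_cong refl nn_integral_substitution_aux deriv cont nonneg ab) auto
  also have "\<dots> = (\<integral>\<^sup>+x. (SUP n. f (g x) * ennreal (g' x) * indicator {a n..b n} x) \<partial>lborel)"
    by (intro nn_integral_monotone_convergence_SUP[symmetric] inc[OF inc1]) measurable
  also have "\<dots> = (\<integral>\<^sup>+x. f (g x) * ennreal (g' x) * indicator U x \<partial>lborel)"
    unfolding U by (rule nn_integral_cong) (rule sup)
  finally show ?thesis .
qed

lemma nn_integral_lborel_reflect:
  fixes f :: "real \<Rightarrow> ennreal"
  assumes "f \<in> borel_measurable borel"
  shows "(\<integral>\<^sup>+x. f x \<partial>lborel) = (\<integral>\<^sup>+x. f (- x) \<partial>lborel)"
  using nn_integral_real_affine[OF assms, of "-1" 0] by simp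

lemma nn_integral_lborel_scale:
  fixes f :: "real \<Rightarrow> ennreal"
  assumes "f \<in> borel_measurable borel" "0 < c"
  shows "(\<integral>\<^sup>+x. f x * indicator {0<..} x \<partial>lborel) = ennreal c * (\<integral>\<^sup>+x. f (c * x) * indicator {0<..} x \<partial>lborel)"
proof -
  have "(\<integral>\<^sup>+x. f x * indicator {0<..} x \<partial>lborel) =
      ennreal c * (\<integral>\<^sup>+x. f (0 + c * x) * indicator {0<..} (0 + c * x) \<partial>lborel)"
    using nn_integral_real_affine[of "\<lambda>x. f x * indicator {0<..} x" c 0] assms by simp
  also have "(\<lambda>x. f (0 + c * x) * indicator {0<..} (0 + c * x)) = (\<lambda>x. f (c * x) * indicator {0<..} x)"
    using assms(2) by (auto simp: indicator_def zero_less_mult_iff)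
  finally show ?thesis .
qed

lemma nn_integral_Gamma:
  assumes "0 < z" "0 < v"
  shows "(\<integral>\<^sup>+x. ennreal (x powr (z - 1) * exp (- (v * x))) * indicator {0<..} x \<partial>lborel) = ennreal (Gamma z * v powr (- z))"
proof -
  have "(\<integral>\<^sup>+x. ennreal (x powr (z - 1) * exp (- (v * x))) * indicator {0<..} x \<partial>lborel) =
     ennreal (v powr (1 - z)) * (\<integral>\<^sup>+x. ennreal ((v * x) powr (z - 1) * exp (- (v * x))) * indicator {0<..} x \<partial>lborel)"
  proof -
    have "(\<integral>\<^sup>+x. ennreal (x powr (z - 1) * exp (- (v * x))) * indicator {0<..} x \<partial>lborel) =
      (\<integral>\<^sup>+x. ennreal (v powr (1 - z)) * (ennreal ((v * x) powr (z - 1) * exp (- (v * x))) * indicator {0<..} x) \<partial>lborel)"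
  proof (rule nn_integral_cong)
    fix x :: real
    show "ennreal (x powr (z - 1) * exp (- (v * x))) * indicator {0<..} x =
       ennreal (v powr (1 - z)) * (ennreal ((v * x) powr (z - 1) * exp (- (v * x))) * indicator {0<..} x)"
    proof (cases "0 < x")
      case True
      have "v powr (1 - z) * ((v * x) powr (z - 1) * exp (- (v * x))) = x powr (z - 1) * exp (- (v * x))"
        using assms True by (simp add: powr_mult powr_add[symmetric] mult.assoc[symmetric])
      then show ?thesis using True by (simp add: ennreal_mult'[symmetric])
    qed simp
  qed
    then show ?thesis by (simp add: nn_integral_cmult)
  qed
  also have "\<dots> = ennreal (v powr (- z)) * (ennreal v * (\<integral>\<^sup>+x. ennreal ((v * x) powr (z - 1) * exp (- (v * x))) * indicator {0<..} x \<partial>lborel))"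
    using assms by (simp add: mult.assoc[symmetric] ennreal_mult'[symmetric] powr_diff powr_minus field_simps)
  also have "ennreal v * (\<integral>\<^sup>+x. ennreal ((v * x) powr (z - 1) * exp (- (v * x))) * indicator {0<..} x \<partial>lborel) =
     (\<integral>\<^sup>+x. ennreal (x powr (z - 1) * exp (- x)) * indicator {0<..} x \<partial>lborel)"
    by (rule nn_integral_lborel_scale[symmetric]) (use assms in auto)
  also have "\<dots> = (\<integral>\<^sup>+x. ennreal (x powr (z - 1) / exp x) * indicator {0..} x \<partial>lborel)"
    by (rule nn_integral_cong) (auto simp: indicator_def exp_minus field_simps)
  also have "\<dots> = ennreal (Gamma z)"
    using Gamma_integral_real[OF assms(1)] by (intro nn_integral_has_integral_lebesgue') auto
  finally show ?thesis using assms by (simp add: ennreal_mult'[symmetric] mult.commute)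
qed

text \<open>The hypotheses are an integrated form of \<open>\<psi>' = - K' \<psi>\<close>. Along a partition on which \<open>K\<close> grows by
  equal amounts they give \<open>(1 - K 1 / n) ^ n \<le> \<psi> 1 \<le> (1 + K 1 / n) ^ - n\<close>, so neither function has to be
  differentiable.\<close>
lemma multiplicative_ode:
  fixes \<psi> K :: "real \<Rightarrow> real"
  assumes K0: "K 0 = 0" and cont: "continuous_on {0..1} K"
    and mono: "\<And>a b. 0 \<le> a \<Longrightarrow> a \<le> b \<Longrightarrow> b \<le> 1 \<Longrightarrow> K a \<le> K b"
    and \<psi>: "\<psi> 0 = 1" "\<And>a. 0 \<le> a \<Longrightarrow> a \<le> 1 \<Longrightarrow> 0 \<le> \<psi> a"
    and lower: "\<And>a b. 0 \<le> a \<Longrightarrow> a \<le> b \<Longrightarrow> b \<le> 1 \<Longrightarrow> \<psi> b * (K b - K a) \<le> \<psi> a - \<psi> b"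
    and upper: "\<And>a b. 0 \<le> a \<Longrightarrow> a \<le> b \<Longrightarrow> b \<le> 1 \<Longrightarrow> \<psi> a - \<psi> b \<le> \<psi> a * (K b - K a)"
  shows "\<psi> 1 = exp (- K 1)"
proof -
  define k where "k = K 1"
  have k: "0 \<le> k" using mono[of 0 1] K0 by (simp add: k_def)
  have bounds: "(1 - k / real n) ^ n \<le> \<psi> 1 \<and> \<psi> 1 * (1 + k / real n) ^ n \<le> 1" if n: "k < real n" for n
  proof -
    have n0: "0 < real n" using k n by simp
    \<comment> \<open>The partition points come from the intermediate value theorem and make
      \<open>K\<close> grow by \<open>k / n\<close> per step.\<close>
    have "\<exists>l\<in>{0..1}. K l = real i * k / real n" if "i \<le> n" for i
    proof -
      have "real i * k / real n \<le> k" using that n0 k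
        by (simp add: field_simps mult_left_mono)
      then have "\<exists>x\<ge>0. x \<le> 1 \<and> K x = real i * k / real n"
        using k n0 K0 cont by (intro IVT') (auto simp: k_def)
      then show ?thesis by auto
    qed
    then obtain l where l: "\<And>i. i \<le> n \<Longrightarrow> l i \<in> {0..1}" "\<And>i. i \<le> n \<Longrightarrow> K (l i) = real i * k / real n"
      by metis
    \<comment> \<open>The points supplied for \<open>i = 0\<close> and \<open>i = n\<close> need not
      be the endpoints \<open>0\<close> and \<open>1\<close>, so these are put in by hand.\<close>
    define m where "m i = (if i = 0 then 0 else if i = n then 1 else l i)" for i
    have m: "m i \<in> {0..1}" "K (m i) = real i * k / real n" if "i \<le> n" for i
      using l[OF that] that n0 K0 by (auto simp: m_def k_def)
    have step: "\<psi> (m i) * (1 - k / real n) \<le> \<psi> (m (Suc i)) \<and> \<psi> (m (Suc i)) * (1 + k / real n) \<le> \<psi> (m i)"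
      if i: "Suc i \<le> n" for i
    proof (cases "m i \<le> m (Suc i)")
      case True
      have "K (m (Suc i)) - K (m i) = k / real n"
        using m(2)[of i] m(2)[of "Suc i"] i by (simp add: field_simps)
      then show ?thesis
        using lower[of "m i" "m (Suc i)"] upper[of "m i" "m (Suc i)"] True m(1)[of i] m(1)[of "Suc i"] i
        by (simp add: algebra_simps)
    next
      \<comment> \<open>\<open>K\<close> may be flat, so the points need not be ordered. A wrong
        order forces the increment \<open>k / n\<close> to vanish, and then \<psi> takes the same
        value at both points.\<close>
      case False
      have "K (m (Suc i)) \<le> K (m i)" using False m(1)[of i] m(1)[of "Suc i"] i by (intro mono) auto
      then have k0: "k = 0"
        using m(2)[of i] m(2)[of "Suc i"] i n0 k by (simp add: divide_simps distrib_right) (simp add: mult_le_0_iff)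
      have K: "K (m (Suc i)) = 0" "K (m i) = 0" using m(2)[of i] m(2)[of "Suc i"] i k0 by auto
      have "\<psi> (m i) = \<psi> (m (Suc i))"
        using lower[of "m (Suc i)" "m i"] upper[of "m (Suc i)" "m i"] False m(1)[of i] m(1)[of "Suc i"] i K
        by simp
      then show ?thesis using k0 by simp
    qed
    have "(1 - k / real n) ^ i \<le> \<psi> (m i) \<and> \<psi> (m i) * (1 + k / real n) ^ i \<le> 1" if "i \<le> n" for i
      using that
    proof (induction i)
      case 0 show ?case using \<psi>(1) by (simp add: m_def)
    next
      case (Suc i)
      have kn: "0 \<le> 1 - k / real n" "0 \<le> 1 + k / real n" using n n0 k by (simp_all add: field_simps)
      have "(1 - k / real n) ^ Suc i \<le> \<psi> (m i) * (1 - k / real n)"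
        using Suc mult_right_mono[OF _ kn(1), of "(1 - k / real n) ^ i" "\<psi> (m i)"] by (simp add: mult.commute)
      moreover have "\<psi> (m (Suc i)) * (1 + k / real n) * (1 + k / real n) ^ i \<le> \<psi> (m i) * (1 + k / real n) ^ i"
        using step[OF Suc.prems] kn by (intro mult_right_mono) auto
      ultimately show ?case using step[OF Suc.prems] Suc by (simp add: mult.assoc)
    qed
    from this[of n] show ?thesis using n0 by (simp add: m_def)
  qed
  have ev: "eventually (\<lambda>n. k < real n) sequentially" by real_asymp
  have l1: "(\<lambda>n. (1 - k / real n) ^ n) \<longlonglongrightarrow> exp (- k)"
    using tendsto_exp_limit_sequentially[of "- k"] by simp
  have l2: "(\<lambda>n. \<psi> 1 * (1 + k / real n) ^ n) \<longlonglongrightarrow> \<psi> 1 * exp k"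
    by (intro tendsto_mult tendsto_const tendsto_exp_limit_sequentially)
  have "exp (- k) \<le> \<psi> 1"
    by (rule tendsto_upperbound[OF l1]) (use ev bounds in \<open>auto elim: eventually_mono\<close>)
  moreover have "\<psi> 1 * exp k \<le> 1"
    by (rule tendsto_upperbound[OF l2]) (use ev bounds in \<open>auto elim: eventually_mono\<close>)
  ultimately show ?thesis unfolding k_def[symmetric]
    by (simp add: exp_minus field_simps) 
qed

section \<open>The jumps of the stable subordinator\<close>

text \<open>Inverse of the Levy tail \<open>x powr (- \<alpha>) / Gamma (1 - \<alpha>)\<close>; it
  carries the arrivals of a unit Poisson process to the jumps of the subordinator.\<close>

definition jump :: "real \<Rightarrow> real \<Rightarrow> real" where
  "jump \<alpha> u = (Gamma (1 - \<alpha>) * u) powr (- 1 / \<alpha>)"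

definition levy_density :: "real \<Rightarrow> real \<Rightarrow> real" where
  "levy_density \<alpha> x = \<alpha> * x powr (- \<alpha> - 1) / Gamma (1 - \<alpha>)"

definition levy :: "real \<Rightarrow> real measure" where
  "levy \<alpha> = density lborel (\<lambda>x. ennreal (levy_density \<alpha> x) * indicator {0<..} x)"

lemma stable_jump_eq: "stable_jump \<alpha> E i = jump \<alpha> (arrival E i)"
  by (simp add: stable_jump_def jump_def arrival_def)

lemma measurable_jump [measurable]: "jump \<alpha> \<in> borel_measurable borel"
  unfolding jump_def by measurable

lemma measurable_levy_density [measurable]: "levy_density \<alpha> \<in> borel_measurable borel"
  unfolding levy_density_def by measurable

lemma measurable_stable_jump_component [measurable (raw)]:
  "F \<in> measurable M seqM \<Longrightarrow> (\<lambda>w. stable_jump \<alpha> (F w) i) \<in> borel_measurable M"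
  unfolding stable_jump_eq by measurable

lemma measurable_stable_jump [measurable (raw)]:
  "F \<in> measurable M seqM \<Longrightarrow> (\<lambda>w. stable_jump \<alpha> (F w)) \<in> measurable M seqM"
  by (rule measurable_seqMI) measurable

lemma measurable_stable_T [measurable (raw)]:
  "F \<in> measurable M seqM \<Longrightarrow> (\<lambda>w. stable_T \<alpha> (F w)) \<in> borel_measurable M"
  unfolding stable_T_def by measurable

lemma sets_levy [simp, measurable_cong]: "sets (levy \<alpha>) = sets borel"
  and space_levy [simp]: "space (levy \<alpha>) = UNIV"
  by (simp_all add: levy_def)

lemma sigma_finite_levy: "sigma_finite_measure (levy \<alpha>)"
  unfolding levy_def
  by (subst sigma_finite_measure.sigma_finite_iff_density_finite[OF sigma_finite_lborel]) (auto simp: indicator_def)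

interpretation lev_es: pair_sigma_finite "levy \<alpha>" exp_space for \<alpha>
  by (intro pair_sigma_finite.intro sigma_finite_levy es.sigma_finite_measure_axioms)
interpretation lb_lev: pair_sigma_finite lborel "levy \<alpha>" for \<alpha>
  by (intro pair_sigma_finite.intro sigma_finite_levy lborel.sigma_finite_measure_axioms)

lemma nn_integral_levy:
  assumes [measurable]: "f \<in> borel_measurable borel"
  shows "(\<integral>\<^sup>+x. f x \<partial>levy \<alpha>) = (\<integral>\<^sup>+x. f x * ennreal (levy_density \<alpha> x) * indicator {0<..} x \<partial>lborel)"
  unfolding levy_def by (subst nn_integral_density) (auto simp: mult_ac)

lemma AE_levy_pos: "AE x in levy \<alpha>. 0 < x"
  unfolding levy_def by (subst AE_density) (auto simp: indicator_def)

lemma jump_nonneg [simp]: "0 \<le> jump \<alpha> u" by (simp add: jump_def)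

lemma sums_skip:
  fixes a :: "nat \<Rightarrow> real"
  shows "a sums s \<Longrightarrow> (\<lambda>j. if j < i then a j else a (Suc j)) sums (s - a i)"
proof (induction i arbitrary: a s)
  case 0
  then show ?case using sums_Suc_iff[of a "s - a 0"] by simp
next
  case (Suc i)
  have "(\<lambda>n. a (Suc n)) sums (s - a 0)" using Suc.prems sums_Suc_iff[of a "s - a 0"] by simp
  from Suc.IH[OF this] have "(\<lambda>j. if j < i then a (Suc j) else a (Suc (Suc j))) sums (s - a 0 - a (Suc i))" .
  then show ?case
    using sums_Suc_iff[of "\<lambda>j. if j < Suc i then a j else a (Suc j)" "s - a 0 - a (Suc i)"] by simp
qed

text \<open>Differences of Laplace transforms become integrals over the parameter, so that Fubini's
  theorem replaces differentiation under the integral sign.\<close>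

lemma nn_integral_exp_interval:
  assumes "0 \<le> s" "a \<le> b"
  shows "(\<integral>\<^sup>+l. ennreal (s * exp (- (l * s))) * indicator {a..b} l \<partial>lborel) = ennreal (exp (- (a * s)) - exp (- (b * s)))"
proof -
  have "(\<integral>\<^sup>+l. ennreal (s * exp (- (l * s))) * indicator {a..b} l \<partial>lborel) = ennreal (- exp (- (b * s)) - - exp (- (a * s)))"
    by (rule nn_integral_FTC_Icc) (use assms in \<open>auto intro!: derivative_eq_intros\<close>)
  then show ?thesis by simp
qed

definition good :: "real \<Rightarrow> (nat \<Rightarrow> real) \<Rightarrow> bool" where
  "good \<alpha> E \<longleftrightarrow> (\<forall>i. 0 < E i) \<and> (\<forall>u. \<exists>n. u < arrival E n) \<and> summable (stable_jump \<alpha> E)"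

lemma stable_jump_merge_gap:
  "stable_jump \<alpha> (merge_gap i E) j = (if j < i then stable_jump \<alpha> E j else stable_jump \<alpha> E (Suc j))"
  by (simp add: stable_jump_eq arrival_merge_gap)

locale stable_index =
  fixes \<alpha> :: real
  assumes alpha: "0 < \<alpha>" "\<alpha> < 1"
begin

abbreviation "J \<equiv> stable_jump \<alpha>"
abbreviation "T \<equiv> stable_T \<alpha>"

section \<open>Jump sizes, their Levy measure, and almost sure summability\<close>

lemma Gamma_pos: "0 < Gamma (1 - \<alpha>)" using alpha by (intro Gamma_real_pos) simp

lemma Gamma_nz [simp]: "Gamma (1 - \<alpha>) \<noteq> 0" using Gamma_pos by linarith

lemma jump_pos: "0 < u \<Longrightarrow> 0 < jump \<alpha> u" using Gamma_pos by (simp add: jump_def)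

lemma jump_antimono: "0 < u \<Longrightarrow> u \<le> v \<Longrightarrow> jump \<alpha> v \<le> jump \<alpha> u"
  using Gamma_pos alpha unfolding jump_def by (intro powr_mono2') auto

lemma jump_inverse: "0 < x \<Longrightarrow> jump \<alpha> (x powr (- \<alpha>) / Gamma (1 - \<alpha>)) = x"
  using Gamma_pos alpha by (simp add: jump_def powr_powr)

lemma levy_density_nonneg: "0 \<le> levy_density \<alpha> x"
  using Gamma_pos alpha by (simp add: levy_density_def)

text \<open>Since \<open>jump\<close> inverts the Levy tail, the image of Lebesgue measure under it
  has minus the derivative of the tail as density, and that is \<open>levy_density\<close>.\<close>

lemma nn_integral_jump:
  assumes [measurable]: "f \<in> borel_measurable borel"
  shows "(\<integral>\<^sup>+u. indicator {0..} u * f (jump \<alpha> u) \<partial>lborel) = (\<integral>\<^sup>+x. f x \<partial>levy \<alpha>)"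
proof -
  let ?c = "Gamma (1 - \<alpha>)"
  \<comment> \<open>The tail decreases in the jump size \<open>x\<close>. Parametrising it by
    \<open>y = - x\<close> fits the substitution rule for increasing maps; the sign is undone by a
    reflection at the end.\<close>
  define g where "g y = (- y) powr (- \<alpha>) / ?c" for y :: real
  define g' where "g' y = levy_density \<alpha> (- y)" for y :: real
  have [measurable]: "g \<in> borel_measurable borel" "g' \<in> borel_measurable borel"
    unfolding g_def g'_def by measurable
  let ?a = "\<lambda>n::nat. - (real n + 2)" and ?b = "\<lambda>n::nat. - (1 / (real n + 2))"
  have neg: "x < 0" if "x \<in> {?a n..?b n}" for x n
    using that by (auto intro: le_less_trans)
  have "(\<integral>\<^sup>+u. indicator {0..} u * f (jump \<alpha> u) \<partial>lborel) = (\<integral>\<^sup>+u. f (jump \<alpha> u) * indicator {0<..} u \<partial>lborel)"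
    by (rule nn_integral_cong_AE, rule AE_mp[OF AE_lborel_singleton[of 0]]) (auto simp: indicator_def)
  also have "\<dots> = (\<integral>\<^sup>+y. f (jump \<alpha> (g y)) * ennreal (g' y) * indicator {..<0} y \<partial>lborel)"
  proof (rule nn_integral_substitution_incr[where a = ?a and b = ?b])
    fix n :: nat
    have "1 / (real n + 2) < 1" by (simp add: field_simps)
    then show "?a n < ?b n" by linarith
    show "continuous_on {?a n..?b n} g'"
      unfolding g'_def levy_density_def using Gamma_pos neg[of _ n]
      by (intro continuous_intros) auto
    fix x assume "x \<in> {?a n..?b n}"
    then have x: "x < 0" by (rule neg)
    show "(g has_real_derivative g' x) (at x)"
      unfolding g_def g'_def levy_density_def using x
      by (auto intro!: derivative_eq_intros simp: powr_diff powr_minus field_simps)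
    show "0 \<le> g' x" unfolding g'_def by (rule levy_density_nonneg)
  next
    show "decseq ?a" by (auto simp: decseq_def)
    show "incseq ?b" by (auto simp: incseq_def field_simps)
    show "{..<0} = (\<Union>n. {?a n..?b n})"
    proof
      show "(\<Union>n. {?a n..?b n}) \<subseteq> {..<0}" using neg by auto
      show "{..<0} \<subseteq> (\<Union>n. {?a n..?b n})"
      proof
        fix x :: real assume "x \<in> {..<0}"
        then have x: "x < 0" by simp
        obtain n :: nat where n: "max (- x) (- 1 / x) \<le> real n" using real_arch_simple by blast
        have "- 1 / x \<le> real n + 2" using n by simp
        then have "1 / (real n + 2) \<le> - x" using x by (simp add: field_simps)
        then have "x \<in> {?a n..?b n}" using n by auto
        then show "x \<in> (\<Union>n. {?a n..?b n})" by blast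
      qed
    qed
    show "{0<..} = (\<Union>n. {g (?a n)..g (?b n)})"
    proof
      have "0 < g (?a n)" for n using Gamma_pos by (simp add: g_def)
      then show "(\<Union>n. {g (?a n)..g (?b n)}) \<subseteq> {0<..}" by auto (metis less_le_trans)
      show "{0<..} \<subseteq> (\<Union>n. {g (?a n)..g (?b n)})"
      proof
        fix v :: real assume "v \<in> {0<..}"
        then have v: "0 < ?c * v" using Gamma_pos by simp
        obtain n :: nat where n: "max ((?c * v) powr (1 / \<alpha>)) ((?c * v) powr (- 1 / \<alpha>)) \<le> real n"
          using real_arch_simple by blast
        have n1: "(?c * v) powr (1 / \<alpha>) \<le> real n + 2" and n2: "(?c * v) powr (- 1 / \<alpha>) \<le> real n + 2"
          using n by auto
        have "?c * v = ((?c * v) powr (1 / \<alpha>)) powr \<alpha>" using v alpha by (simp add: powr_powr)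
        also have "\<dots> \<le> (real n + 2) powr \<alpha>" using n1 alpha by (intro powr_mono2) auto
        finally have 1: "v \<le> g (?b n)" using Gamma_pos
          by (simp add: g_def powr_divide powr_minus field_simps)
        have "(real n + 2) powr (- \<alpha>) \<le> ((?c * v) powr (- 1 / \<alpha>)) powr (- \<alpha>)"
          using n2 alpha v by (intro powr_mono2') auto
        also have "\<dots> = ?c * v" using v alpha by (simp add: powr_powr)
        finally have 2: "g (?a n) \<le> v" using Gamma_pos by (simp add: g_def field_simps)
        show "v \<in> (\<Union>n. {g (?a n)..g (?b n)})" using 1 2 by auto
      qed
    qed
  qed measurable
  also have "\<dots> = (\<integral>\<^sup>+x. f (jump \<alpha> (g (- x))) * ennreal (g' (- x)) * indicator {..<0} (- x) \<partial>lborel)"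
    by (rule nn_integral_lborel_reflect) measurable
  also have "\<dots> = (\<integral>\<^sup>+x. f x * ennreal (levy_density \<alpha> x) * indicator {0<..} x \<partial>lborel)"
    by (rule nn_integral_cong) (auto simp: indicator_def g_def g'_def jump_inverse)
  finally show ?thesis by (subst nn_integral_levy) auto
qed

lemma nn_integral_levy_exp:
  assumes "0 < v"
  shows "(\<integral>\<^sup>+x. ennreal (x * exp (- (v * x))) \<partial>levy \<alpha>) = ennreal (\<alpha> * v powr (\<alpha> - 1))"
proof -
  have "(\<integral>\<^sup>+x. ennreal (x * exp (- (v * x))) \<partial>levy \<alpha>) =
     (\<integral>\<^sup>+x. ennreal (\<alpha> / Gamma (1 - \<alpha>)) * (ennreal (x powr ((1 - \<alpha>) - 1) * exp (- (v * x))) * indicator {0<..} x) \<partial>lborel)"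
  proof (subst nn_integral_levy, measurable, rule nn_integral_cong)
    fix x :: real
    show "ennreal (x * exp (- (v * x))) * ennreal (levy_density \<alpha> x) * indicator {0<..} x =
      ennreal (\<alpha> / Gamma (1 - \<alpha>)) * (ennreal (x powr ((1 - \<alpha>) - 1) * exp (- (v * x))) * indicator {0<..} x)"
    proof (cases "0 < x")
      case True
      have "x * exp (- (v * x)) * levy_density \<alpha> x = \<alpha> / Gamma (1 - \<alpha>) * (x powr ((1 - \<alpha>) - 1) * exp (- (v * x)))"
        using True by (simp add: levy_density_def powr_diff powr_minus field_simps)
      then show ?thesis using True alpha Gamma_pos
        by (simp add: ennreal_mult'[symmetric] ennreal_mult''[symmetric] levy_density_nonneg)
    qed simp
  qed
  also have "\<dots> = ennreal (\<alpha> / Gamma (1 - \<alpha>)) * ennreal (Gamma (1 - \<alpha>) * v powr (- (1 - \<alpha>)))"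
    using alpha assms by (subst nn_integral_cmult, measurable) (simp only: nn_integral_Gamma)
  also have "\<dots> = ennreal (\<alpha> * v powr (\<alpha> - 1))"
    using alpha Gamma_pos by (simp add: ennreal_mult'[symmetric])
  finally show ?thesis .
qed

text \<open>\<open>1 - exp (- (w * x))\<close> is the integral of \<open>x * exp (- (l * x))\<close>
  over \<open>l\<close> from \<open>0\<close> to \<open>w\<close>. For fixed \<open>l\<close> a
  Gamma integral cancels the constant in the Levy density and gives
  \<open>\<alpha> * l powr (\<alpha> - 1)\<close>, the derivative of
  \<open>l powr \<alpha>\<close>.\<close>

lemma nn_integral_levy_Laplace_exponent:
  assumes "0 \<le> w"
  shows "(\<integral>\<^sup>+x. ennreal (1 - exp (- (w * x))) \<partial>levy \<alpha>) = ennreal (w powr \<alpha>)"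
proof -
  have "(\<integral>\<^sup>+x. ennreal (1 - exp (- (w * x))) \<partial>levy \<alpha>) =
     (\<integral>\<^sup>+x. (\<integral>\<^sup>+l. ennreal (x * exp (- (l * x))) * indicator {0..w} l \<partial>lborel) \<partial>levy \<alpha>)"
  proof (rule nn_integral_cong_AE, rule AE_mp[OF AE_levy_pos], rule AE_I2, rule impI)
    fix x :: real assume "0 < x"
    then show "ennreal (1 - exp (- (w * x))) = (\<integral>\<^sup>+l. ennreal (x * exp (- (l * x))) * indicator {0..w} l \<partial>lborel)"
      using assms by (subst nn_integral_exp_interval) auto
  qed
  also have "\<dots> = (\<integral>\<^sup>+l. (\<integral>\<^sup>+x. ennreal (x * exp (- (l * x))) * indicator {0..w} l \<partial>levy \<alpha>) \<partial>lborel)"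
    by (rule lb_lev.Fubini') measurable
  also have "\<dots> = (\<integral>\<^sup>+l. ennreal (\<alpha> * l powr (\<alpha> - 1)) * indicator {0..w} l \<partial>lborel)"
  proof (rule nn_integral_cong_AE, rule AE_mp[OF AE_lborel_singleton[of 0]], rule AE_I2, rule impI)
    fix l :: real assume "l \<noteq> 0"
    have "(\<integral>\<^sup>+x. ennreal (x * exp (- (l * x))) * indicator {0..w} l \<partial>levy \<alpha>) =
        (\<integral>\<^sup>+x. ennreal (x * exp (- (l * x))) \<partial>levy \<alpha>) * indicator {0..w} l"
      by (rule nn_integral_multc) measurable
    also have "\<dots> = ennreal (\<alpha> * l powr (\<alpha> - 1)) * indicator {0..w} l"
      using \<open>l \<noteq> 0\<close> by (cases "0 < l") (simp_all add: nn_integral_levy_exp)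
    finally show "(\<integral>\<^sup>+x. ennreal (x * exp (- (l * x))) * indicator {0..w} l \<partial>levy \<alpha>) =
      ennreal (\<alpha> * l powr (\<alpha> - 1)) * indicator {0..w} l" .
  qed
  also have "\<dots> = ennreal (w powr \<alpha>)"
  proof (rule nn_integral_has_integral_lebesgue')
    show "((\<lambda>l. \<alpha> * l powr (\<alpha> - 1)) has_integral w powr \<alpha>) {0..w}"
      using has_integral_mult_right[OF has_integral_powr_from_0[of "\<alpha> - 1" w], of \<alpha>] alpha assms by simp
  qed (use alpha in auto)
  finally show ?thesis .
qed

text \<open>The form in which Mecke's equation is applied below: a jump and what is left without it
  decouple into a point with intensity \<open>levy\<close> and an unchanged independent
  configuration.\<close>

lemma mecke_jump:
  assumes [measurable]: "g \<in> borel_measurable (borel \<Otimes>\<^sub>M seqM)"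
  shows "(\<integral>\<^sup>+E. (\<Sum>i. g (J E i, merge_gap i E)) \<partial>exp_space) = (\<integral>\<^sup>+x. (\<integral>\<^sup>+E. g (x, E) \<partial>exp_space) \<partial>levy \<alpha>)"
proof -
  have "(\<integral>\<^sup>+E. (\<Sum>i. g (J E i, merge_gap i E)) \<partial>exp_space) =
      (\<integral>\<^sup>+u. indicator {0..} u * (\<integral>\<^sup>+E. g (jump \<alpha> u, E) \<partial>exp_space) \<partial>lborel)"
    unfolding stable_jump_eq by (rule mecke[of "\<lambda>u E. g (jump \<alpha> u, E)"]) measurable
  also have "\<dots> = (\<integral>\<^sup>+x. (\<integral>\<^sup>+E. g (x, E) \<partial>exp_space) \<partial>levy \<alpha>)"
    by (rule nn_integral_jump) measurable
  finally show ?thesis .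
qed

lemma arrival_strict_mono: "(\<And>i. 0 < E i) \<Longrightarrow> strict_mono (arrival E)"
  by (rule strict_monoI_Suc) (simp add: arrival_Suc)

lemma arrival_pos: "(\<And>i. 0 < E i) \<Longrightarrow> 0 < arrival E i"
  unfolding arrival_def by (intro sum_pos) auto

lemma jump_tendsto_0:
  assumes pos: "\<And>i. 0 < E i" and unb: "\<And>u. \<exists>n. u < arrival E n"
  shows "J E \<longlonglongrightarrow> 0"
proof (rule order_tendstoI)
  fix a :: real assume "a < 0"
  then have "a < J E n" for n by (simp add: stable_jump_eq less_le_trans[OF _ jump_nonneg])
  then show "eventually (\<lambda>n. a < J E n) sequentially" by simp
next
  fix a :: real assume a: "0 < a"
  obtain n where n: "(a / 2) powr (- \<alpha>) / Gamma (1 - \<alpha>) < arrival E n" using unb by blast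
  have "J E m < a" if "n \<le> m" for m
  proof -
    have "arrival E n \<le> arrival E m"
      using strict_mono_less_eq[OF arrival_strict_mono[of E]] pos that by blast
    then have "J E m \<le> jump \<alpha> ((a / 2) powr (- \<alpha>) / Gamma (1 - \<alpha>))"
      unfolding stable_jump_eq using n a Gamma_pos by (intro jump_antimono) auto
    also have "\<dots> < a" using a by (simp add: jump_inverse)
    finally show ?thesis .
  qed
  then show "eventually (\<lambda>n. J E n < a) sequentially" by (auto simp: eventually_sequentially)
qed

lemma AE_good: "AE E in exp_space. good \<alpha> E"
proof -
  have "(\<integral>\<^sup>+E. (\<Sum>i. ennreal (J E i * exp (- J E i))) \<partial>exp_space) = (\<integral>\<^sup>+x. ennreal (x * exp (- (1 * x))) \<partial>levy \<alpha>)"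
    using mecke_jump[of "\<lambda>p. ennreal (fst p * exp (- fst p))"] by (simp add: es.emeasure_space_1[simplified])
  also have "\<dots> \<noteq> \<infinity>" by (subst nn_integral_levy_exp) auto
  finally have "AE E in exp_space. (\<Sum>i. ennreal (J E i * exp (- J E i))) \<noteq> \<infinity>"
    by (intro nn_integral_PInf_AE) measurable
  with AE_arrival_exceeds AE_exp_space_pos show ?thesis
  proof eventually_elim
    case (elim E)
    have nn: "0 \<le> J E i" for i by (simp add: stable_jump_eq)
    have lim: "J E \<longlonglongrightarrow> 0" using elim by (intro jump_tendsto_0) auto
    have s: "summable (\<lambda>i. J E i * exp (- J E i))"
      by (rule summable_suminf_not_top) (use elim nn in auto)
    have ev: "eventually (\<lambda>i. J E i < 1) sequentially" using lim by (intro order_tendstoD) auto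
    have "summable (J E)"
    proof (rule summable_comparison_test_ev)
      show "summable (\<lambda>i. exp 1 * (J E i * exp (- J E i)))" by (intro summable_mult s)
      show "eventually (\<lambda>i. norm (J E i) \<le> exp 1 * (J E i * exp (- J E i))) sequentially"
        using ev
      proof eventually_elim
        case (elim i)
        have "1 \<le> exp (1 - J E i)" using elim by simp
        then have "J E i * 1 \<le> J E i * exp (1 - J E i)" using nn by (intro mult_left_mono) auto
        then show ?case using nn by (simp add: exp_diff exp_minus field_simps)
      qed
    qed
    then show ?case using elim by (auto simp: good_def)
  qed
qed

lemma
  assumes "good \<alpha> E"
  shows good_jump_pos: "0 < J E i" and good_summable: "summable (J E)" and good_decseq: "decseq (J E)"
    and good_T_pos: "0 < T E"
proof -
  have pos: "\<And>i. 0 < E i" using assms by (simp add: good_def)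
  show J: "0 < J E i" for i unfolding stable_jump_eq by (intro jump_pos arrival_pos pos)
  show s: "summable (J E)" using assms by (simp add: good_def)
  show "decseq (J E)"
    unfolding stable_jump_eq decseq_def
    using strict_mono_less_eq[OF arrival_strict_mono[of E]] pos arrival_pos[of E] by (auto intro!: jump_antimono)
  show "0 < T E" unfolding stable_T_def by (rule suminf_pos[OF s J])
qed

lemma good_merge_gap:
  assumes "good \<alpha> E" shows "T E = J E i + T (merge_gap i E)" "summable (J (merge_gap i E))"
proof -
  have "J E sums T E" unfolding stable_T_def using good_summable[OF assms] by (rule summable_sums)
  from sums_skip[OF this, of i] have "J (merge_gap i E) sums (T E - J E i)"
    by (simp add: stable_jump_merge_gap[abs_def])
  then show "T E = J E i + T (merge_gap i E)" "summable (J (merge_gap i E))"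
    by (auto simp: stable_T_def sums_iff)
qed

section \<open>The Laplace functional of the jumps\<close>

text \<open>Interpolate by \<open>l\<close> in \<open>[0, 1]\<close>. Mecke's equation says in
  integrated form that the Laplace transform \<psi> of the sum satisfies \<psi>' = - K' \<psi>,
  where \<open>K\<close> is the proposed exponent; \<open>multiplicative_ode\<close> solves this.
  The linear bound on \<open>f\<close> makes the sum converge and dominates the integrand of
  \<open>K\<close> by \<open>1 - exp (- (C * x))\<close>.\<close>

lemma laplace_functional:
  assumes [measurable]: "f \<in> borel_measurable borel"
    and f: "\<And>x. 0 < x \<Longrightarrow> 0 \<le> f x" "\<And>x. 0 < x \<Longrightarrow> f x \<le> C * x"
  shows "(LINT E|exp_space. exp (- (\<Sum>i. f (J E i)))) = exp (- (LINT x|levy \<alpha>. 1 - exp (- f x)))"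
    and "integrable (levy \<alpha>) (\<lambda>x. 1 - exp (- f x))"
proof -
  have C: "0 \<le> C" using f[of 1] by simp
  define S where "S E = (\<Sum>i. f (J E i))" for E
  have [measurable]: "S \<in> borel_measurable seqM" unfolding S_def by measurable
  have summ: "summable (\<lambda>i. f (J E i))" if "good \<alpha> E" for E
    by (rule summable_comparison_test'[where g = "\<lambda>i. C * J E i" and N = 0])
      (use f good_jump_pos[OF that] good_summable[OF that] in \<open>auto intro: summable_mult\<close>)
  have S_nonneg: "0 \<le> S E" if "good \<alpha> E" for E
    unfolding S_def using f good_jump_pos[OF that] by (intro suminf_nonneg summ that) auto
  have S_AE: "AE E in exp_space. 0 \<le> S E" using AE_good by eventually_elim (rule S_nonneg)
  define \<psi> where "\<psi> l = (LINT E|exp_space. exp (- (l * S E)))" for l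
  have int_psi: "integrable exp_space (\<lambda>E. exp (- (l * S E)))" if "0 \<le> l" for l
    using S_AE that by (intro es.integrable_const_bound[where B = 1]) (auto elim!: eventually_mono)
  have nn_psi: "(\<integral>\<^sup>+E. ennreal (exp (- (l * S E))) \<partial>exp_space) = ennreal (\<psi> l)" if "0 \<le> l" for l
    unfolding \<psi>_def by (intro nn_integral_eq_integral int_psi that) simp
  define K where "K l = (LINT x|levy \<alpha>. 1 - exp (- (l * f x)))" for l
  have fin: "integrable (levy \<alpha>) (\<lambda>x. 1 - exp (- (C * x)))"
  proof (rule integrableI_nonneg)
    show "AE x in levy \<alpha>. 0 \<le> 1 - exp (- (C * x))" using AE_levy_pos[of \<alpha>] by eventually_elim (use C in simp)
  qed (auto simp: nn_integral_levy_Laplace_exponent C)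
  have bnd: "AE x in levy \<alpha>. 0 \<le> 1 - exp (- (l * f x)) \<and> 1 - exp (- (l * f x)) \<le> 1 - exp (- (C * x))"
    if "0 \<le> l" "l \<le> 1" for l
    using AE_levy_pos[of \<alpha>]
  proof eventually_elim
    case (elim x)
    have "l * f x \<le> 1 * f x" using that f(1)[OF elim] by (intro mult_right_mono) auto
    then show ?case using f[OF elim] that by simp
  qed
  have int_K: "integrable (levy \<alpha>) (\<lambda>x. 1 - exp (- (l * f x)))" if "0 \<le> l" "l \<le> 1" for l
    by (rule Bochner_Integration.integrable_bound[OF fin]) (measurable, use bnd[OF that] in eventually_elim, metis abs_of_nonneg order_trans real_norm_def)
  have cont: "continuous_on {0..1} K"
    unfolding continuous_on_sequentially
  proof safe
    fix x :: "nat \<Rightarrow> real" and a assume x: "\<forall>n. x n \<in> {0..1}" "a \<in> {0..1}" "x \<longlonglongrightarrow> a"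
    have x01: "0 \<le> x n" "x n \<le> 1" for n using x(1) by auto
    show "(K \<circ> x) \<longlonglongrightarrow> K a"
      unfolding K_def o_def
    proof (rule integral_dominated_convergence[OF _ _ fin])
      show "AE y in levy \<alpha>. (\<lambda>n. 1 - exp (- (x n * f y))) \<longlonglongrightarrow> 1 - exp (- (a * f y))"
        using x(3) by (intro AE_I2 tendsto_intros)
      fix n
      show "AE y in levy \<alpha>. norm (1 - exp (- (x n * f y))) \<le> 1 - exp (- (C * y))"
        using bnd[OF x01(1)[of n] x01(2)] by (eventually_elim) (metis abs_of_nonneg real_norm_def)
    qed measurable
  qed
  \<comment> \<open>The formal derivative of \<open>K\<close>. It can be infinite at
    \<open>l = 0\<close>, for instance for \<open>f x = x\<close>, so it is used only under an
    integral over \<open>l\<close>.\<close>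
  define k where "k l = (\<integral>\<^sup>+x. ennreal (f x * exp (- (l * f x))) \<partial>levy \<alpha>)" for l
  have [measurable]: "k \<in> borel_measurable borel" unfolding k_def by measurable
  \<comment> \<open>Writing \<open>S E\<close> as the jump's own term plus
    \<open>S (merge_gap i E)\<close> splits the exponential into a factor for the chosen jump and
    one for the rest.\<close>
  have mecke_S: "(\<integral>\<^sup>+E. ennreal (S E * exp (- (l * S E))) \<partial>exp_space) = k l * ennreal (\<psi> l)" if l: "0 \<le> l" for l
  proof -
    have "(\<integral>\<^sup>+E. ennreal (S E * exp (- (l * S E))) \<partial>exp_space) =
      (\<integral>\<^sup>+E. (\<Sum>i. ennreal (f (J E i) * exp (- (l * f (J E i)))) * ennreal (exp (- (l * S (merge_gap i E))))) \<partial>exp_space)"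
    proof (rule nn_integral_cong_AE)
      show "AE E in exp_space. ennreal (S E * exp (- (l * S E))) =
         (\<Sum>i. ennreal (f (J E i) * exp (- (l * f (J E i)))) * ennreal (exp (- (l * S (merge_gap i E)))))"
        using AE_good
      proof eventually_elim
        case (elim E)
        note pos = good_jump_pos[OF elim]
        have Si: "S E = f (J E i) + S (merge_gap i E)" for i
        proof -
          have "(\<lambda>i. f (J E i)) sums S E" unfolding S_def by (rule summable_sums[OF summ[OF elim]])
          from sums_skip[OF this, of i] have "(\<lambda>j. f (J (merge_gap i E) j)) sums (S E - f (J E i))"
            by (simp add: stable_jump_merge_gap if_distrib cong: if_cong)
          then show ?thesis by (simp add: S_def sums_iff)
        qed
        have "ennreal (f (J E i) * exp (- (l * f (J E i)))) * ennreal (exp (- (l * S (merge_gap i E)))) =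
            ennreal (f (J E i) * exp (- (l * S E)))" for i
          by (subst ennreal_mult''[symmetric], simp) (simp add: Si[of i] mult.assoc mult_exp_exp algebra_simps)
        then have "(\<Sum>i. ennreal (f (J E i) * exp (- (l * f (J E i)))) * ennreal (exp (- (l * S (merge_gap i E))))) =
            (\<Sum>i. ennreal (f (J E i) * exp (- (l * S E))))" by simp
        also have "\<dots> = ennreal (\<Sum>i. f (J E i) * exp (- (l * S E)))"
          by (intro suminf_ennreal2 summable_mult2 summ elim) (use f pos in auto)
        also have "\<dots> = ennreal (S E * exp (- (l * S E)))"
          unfolding S_def by (subst suminf_mult2[OF summ[OF elim], symmetric]) simp
        finally show ?case by simp
      qed
    qed
    also have "\<dots> = (\<integral>\<^sup>+x. (\<integral>\<^sup>+E. ennreal (f x * exp (- (l * f x))) * ennreal (exp (- (l * S E))) \<partial>exp_space) \<partial>levy \<alpha>)"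
      using mecke_jump[of "\<lambda>p. ennreal (f (fst p) * exp (- (l * f (fst p)))) * ennreal (exp (- (l * S (snd p))))"] by simp
    also have "\<dots> = k l * ennreal (\<psi> l)"
      unfolding k_def by (simp add: nn_integral_cmult nn_integral_multc nn_psi l)
    finally show ?thesis .
  qed
  have diff_psi: "ennreal (\<psi> a - \<psi> b) = (\<integral>\<^sup>+l. k l * ennreal (\<psi> l) * indicator {a..b} l \<partial>lborel)"
    if ab: "0 \<le> a" "a \<le> b" for a b
  proof -
    have "ennreal (\<psi> a - \<psi> b) = ennreal (LINT E|exp_space. exp (- (a * S E)) - exp (- (b * S E)))"
      unfolding \<psi>_def using ab by (subst Bochner_Integration.integral_diff) (auto intro: int_psi)
    also have "\<dots> = (\<integral>\<^sup>+E. ennreal (exp (- (a * S E)) - exp (- (b * S E))) \<partial>exp_space)"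
      using S_AE ab
      by (intro nn_integral_eq_integral[symmetric] Bochner_Integration.integrable_diff int_psi)
        (auto elim!: eventually_mono intro: mult_right_mono)
    also have "\<dots> = (\<integral>\<^sup>+E. (\<integral>\<^sup>+l. ennreal (S E * exp (- (l * S E))) * indicator {a..b} l \<partial>lborel) \<partial>exp_space)"
      using S_AE by (intro nn_integral_cong_AE) (auto elim!: eventually_mono simp: nn_integral_exp_interval ab)
    also have "\<dots> = (\<integral>\<^sup>+l. (\<integral>\<^sup>+E. ennreal (S E * exp (- (l * S E))) * indicator {a..b} l \<partial>exp_space) \<partial>lborel)"
      by (rule lb_es.Fubini') measurable
    also have "\<dots> = (\<integral>\<^sup>+l. k l * ennreal (\<psi> l) * indicator {a..b} l \<partial>lborel)"
    proof (rule nn_integral_cong)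
      fix l :: real
      show "(\<integral>\<^sup>+E. ennreal (S E * exp (- (l * S E))) * indicator {a..b} l \<partial>exp_space) = k l * ennreal (\<psi> l) * indicator {a..b} l"
        using ab by (subst nn_integral_multc) (auto simp: indicator_def mecke_S)
    qed
    finally show ?thesis .
  qed
  have diff_K: "ennreal (K b - K a) = (\<integral>\<^sup>+l. k l * indicator {a..b} l \<partial>lborel)"
    if ab: "0 \<le> a" "a \<le> b" "b \<le> 1" for a b
  proof -
    have "ennreal (K b - K a) = ennreal (LINT x|levy \<alpha>. (1 - exp (- (b * f x))) - (1 - exp (- (a * f x))))"
      unfolding K_def using ab by (subst Bochner_Integration.integral_diff) (auto intro: int_K)
    also have "\<dots> = (\<integral>\<^sup>+x. ennreal ((1 - exp (- (b * f x))) - (1 - exp (- (a * f x)))) \<partial>levy \<alpha>)"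
    proof (rule nn_integral_eq_integral[symmetric])
      show "integrable (levy \<alpha>) (\<lambda>x. (1 - exp (- (b * f x))) - (1 - exp (- (a * f x))))"
        by (rule Bochner_Integration.integrable_diff) (use ab in \<open>auto intro!: int_K\<close>)
      show "AE x in levy \<alpha>. 0 \<le> (1 - exp (- (b * f x))) - (1 - exp (- (a * f x)))"
        using AE_levy_pos[of \<alpha>] by eventually_elim (use ab f in \<open>auto intro!: mult_right_mono\<close>)
    qed
    also have "\<dots> = (\<integral>\<^sup>+x. (\<integral>\<^sup>+l. ennreal (f x * exp (- (l * f x))) * indicator {a..b} l \<partial>lborel) \<partial>levy \<alpha>)"
      using AE_levy_pos[of \<alpha>] f by (intro nn_integral_cong_AE) (auto elim!: eventually_mono simp: nn_integral_exp_interval ab)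
    also have "\<dots> = (\<integral>\<^sup>+l. (\<integral>\<^sup>+x. ennreal (f x * exp (- (l * f x))) * indicator {a..b} l \<partial>levy \<alpha>) \<partial>lborel)"
      by (rule lb_lev.Fubini') measurable
    also have "\<dots> = (\<integral>\<^sup>+l. k l * indicator {a..b} l \<partial>lborel)"
      unfolding k_def by (intro nn_integral_cong nn_integral_multc) measurable
    finally show ?thesis .
  qed
  have psi_mono: "\<psi> b \<le> \<psi> a" if ab: "0 \<le> a" "a \<le> b" for a b
    unfolding \<psi>_def using S_AE ab
    by (intro integral_mono_AE int_psi) (auto elim!: eventually_mono intro: mult_right_mono)
  have psi_nonneg: "0 \<le> \<psi> a" for a unfolding \<psi>_def by (intro integral_nonneg_AE) auto
  have K_mono: "K a \<le> K b" if "0 \<le> a" "a \<le> b" "b \<le> 1" for a b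
    unfolding K_def using AE_levy_pos[of \<alpha>] that f
    by (intro integral_mono_AE int_K) (auto elim!: eventually_mono intro: mult_right_mono)
  have "\<psi> 1 = exp (- K 1)"
  proof (rule multiplicative_ode[OF _ cont K_mono _ psi_nonneg])
    show "K 0 = 0" by (simp add: K_def)
    show "\<psi> 0 = 1" by (simp add: \<psi>_def es.prob_space[simplified])
    fix a b :: real assume ab: "0 \<le> a" "a \<le> b" "b \<le> 1"
    \<comment> \<open>\<psi> is decreasing, so on \<open>{a..b}\<close> it lies between \<psi> at
      \<open>b\<close> and \<psi> at \<open>a\<close>; these two values give the lower and the upper
      inequality.\<close>
    have "ennreal (\<psi> b * (K b - K a)) = ennreal (\<psi> b) * (\<integral>\<^sup>+l. k l * indicator {a..b} l \<partial>lborel)"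
      using ab psi_nonneg by (simp add: ennreal_mult' diff_K)
    also have "\<dots> = (\<integral>\<^sup>+l. ennreal (\<psi> b) * (k l * indicator {a..b} l) \<partial>lborel)"
      by (rule nn_integral_cmult[symmetric]) measurable
    also have "\<dots> \<le> (\<integral>\<^sup>+l. k l * ennreal (\<psi> l) * indicator {a..b} l \<partial>lborel)"
    proof (rule nn_integral_mono)
      fix l :: real
      have "ennreal (\<psi> b) \<le> ennreal (\<psi> l)" if "l \<in> {a..b}" using that ab by (intro ennreal_leI psi_mono) auto
      then show "ennreal (\<psi> b) * (k l * indicator {a..b} l) \<le> k l * ennreal (\<psi> l) * indicator {a..b} l"
        by (auto simp: indicator_def mult.commute intro: mult_left_mono)
    qed
    also have "\<dots> = ennreal (\<psi> a - \<psi> b)" using ab by (simp add: diff_psi)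
    finally show "\<psi> b * (K b - K a) \<le> \<psi> a - \<psi> b" using psi_mono[of a b] ab by (simp add: ennreal_le_iff)
    have "ennreal (\<psi> a - \<psi> b) = (\<integral>\<^sup>+l. k l * ennreal (\<psi> l) * indicator {a..b} l \<partial>lborel)"
      using ab by (simp add: diff_psi)
    also have "\<dots> \<le> (\<integral>\<^sup>+l. ennreal (\<psi> a) * (k l * indicator {a..b} l) \<partial>lborel)"
    proof (rule nn_integral_mono)
      fix l :: real
      have "ennreal (\<psi> l) \<le> ennreal (\<psi> a)" if "l \<in> {a..b}" using that ab by (intro ennreal_leI psi_mono) auto
      then show "k l * ennreal (\<psi> l) * indicator {a..b} l \<le> ennreal (\<psi> a) * (k l * indicator {a..b} l)"
        by (auto simp: indicator_def mult.commute[of "ennreal (\<psi> a)"] intro: mult_left_mono)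
    qed
    also have "\<dots> = ennreal (\<psi> a) * (\<integral>\<^sup>+l. k l * indicator {a..b} l \<partial>lborel)"
      by (rule nn_integral_cmult) measurable
    also have "\<dots> = ennreal (\<psi> a * (K b - K a))"
      using ab psi_nonneg by (simp add: ennreal_mult' diff_K)
    finally show "\<psi> a - \<psi> b \<le> \<psi> a * (K b - K a)"
      using psi_nonneg[of a] K_mono[OF ab] by (simp add: ennreal_le_iff)
  qed auto
  then show "(LINT E|exp_space. exp (- (\<Sum>i. f (J E i)))) = exp (- (LINT x|levy \<alpha>. 1 - exp (- f x)))"
    by (simp add: \<psi>_def K_def S_def)
  show "integrable (levy \<alpha>) (\<lambda>x. 1 - exp (- f x))" using int_K[of 1] by simp
qed

lemma laplace_T:
  assumes "0 \<le> w"
  shows "(\<integral>\<^sup>+E. ennreal (exp (- (w * T E))) \<partial>exp_space) = ennreal (exp (- (w powr \<alpha>)))"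
proof -
  have "(LINT x|levy \<alpha>. 1 - exp (- (w * x))) = w powr \<alpha>"
  proof -
    have "(LINT x|levy \<alpha>. 1 - exp (- (w * x))) = enn2real (\<integral>\<^sup>+x. ennreal (1 - exp (- (w * x))) \<partial>levy \<alpha>)"
    proof (rule integral_eq_nn_integral)
      show "AE x in levy \<alpha>. 0 \<le> 1 - exp (- (w * x))" using AE_levy_pos[of \<alpha>] by eventually_elim (use assms in simp)
    qed measurable
    then show ?thesis using assms by (simp add: nn_integral_levy_Laplace_exponent)
  qed
  then have "(LINT E|exp_space. exp (- (\<Sum>i. w * J E i))) = exp (- (w powr \<alpha>))"
    using laplace_functional(1)[of "\<lambda>x. w * x" w] assms by simp
  moreover have "(LINT E|exp_space. exp (- (\<Sum>i. w * J E i))) = (LINT E|exp_space. exp (- (w * T E)))"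
    using AE_good by (intro integral_cong_AE)
      (auto elim!: eventually_mono simp: stable_T_def suminf_mult[OF good_summable])
  moreover have "(\<integral>\<^sup>+E. ennreal (exp (- (w * T E))) \<partial>exp_space) = ennreal (LINT E|exp_space. exp (- (w * T E)))"
    using AE_good assms good_T_pos
    by (intro nn_integral_eq_integral es.integrable_const_bound[where B = 1]) (auto elim!: eventually_mono simp: less_imp_le)
  ultimately show ?thesis by simp
qed

end

section \<open>The mixing law as an exponential tilting\<close>

text \<open>For \<open>s < 0\<close> the kernel in \<open>eta_star\<close> is a rescaling of an unspecified measure, possibly on a
  different \<open>\<sigma>\<close>-algebra. It still depends measurably on \<open>s\<close>, because pushing forward by a
  bijective scaling commutes with \<open>distr\<close> even for non-measurable maps.\<close>

lemma measure_space_vimage_borel: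
  fixes \<nu> :: "real set \<Rightarrow> ennreal" and h :: "real \<Rightarrow> real"
  assumes ms: "measure_space UNIV (sets borel) \<nu>" and h: "h \<in> borel_measurable borel"
  shows "measure_space UNIV (sets borel) (\<lambda>A. \<nu> (h -` A))"
proof -
  have vim: "h -` A \<in> sets borel" if "A \<in> sets borel" for A
    using measurable_sets[OF h that] by simp
  have ca: "countably_additive (sets borel) \<nu>" and pos: "positive (sets borel) \<nu>"
    and sa: "sigma_algebra UNIV (sets (borel :: real measure))"
    using ms by (auto simp: measure_space_def)
  show ?thesis
    unfolding measure_space_def
  proof (intro conjI sa)
    show "positive (sets borel) (\<lambda>A. \<nu> (h -` A))" using pos by (simp add: positive_def)
    show "countably_additive (sets borel) (\<lambda>A. \<nu> (h -` A))"
    proof (rule countably_additiveI)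
      fix A :: "nat \<Rightarrow> real set"
      assume A: "range A \<subseteq> sets borel" "disjoint_family A" "(\<Union>i. A i) \<in> sets borel"
      have "(\<Sum>i. \<nu> (h -` A i)) = \<nu> (\<Union>i. h -` A i)"
        by (rule ca[unfolded countably_additive_def, rule_format])
          (use A vim in \<open>auto simp: disjoint_family_on_def\<close>)
      then show "(\<Sum>i. \<nu> (h -` A i)) = \<nu> (h -` (\<Union>i. A i))" by (simp add: vimage_UN)
    qed
  qed
qed

lemma distr_distr_scale:
  fixes c :: real
  assumes c: "c \<noteq> 0"
  shows "distr N borel (\<lambda>x. x / c) = distr (distr N borel (\<lambda>x. x)) borel (\<lambda>x :: real. x / c)"
proof (rule measure_eqI)
  fix A assume "A \<in> sets (distr N borel (\<lambda>x. x / c))"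
  then have A: "A \<in> sets borel" by simp
  let ?h = "\<lambda>x :: real. x / c" and ?h' = "\<lambda>x :: real. x * c"
  let ?\<nu> = "\<lambda>A. emeasure N ((\<lambda>x. x) -` A \<inter> space N)" and ?\<nu>h = "\<lambda>A. emeasure N (?h -` A \<inter> space N)"
  have ss: "sigma_sets UNIV (sets (borel :: real measure)) = sets borel"
    using sets.sigma_sets_eq[of "borel :: real measure"] by simp
  \<comment> \<open>\<open>distr\<close> is the zero measure when the pulled-back set function is
    not a measure, and this cannot be excluded for an arbitrary \<open>N\<close>. The equivalence
    \<open>iff\<close> shows that both sides fall into the same case.\<close>
  have e: "emeasure (distr N borel f) B = (if measure_space UNIV (sets borel) (\<lambda>A. emeasure N (f -` A \<inter> space N))
      then emeasure N (f -` B \<inter> space N) else 0)" if "B \<in> sets borel" for f :: "real \<Rightarrow> real" and B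
    unfolding distr_def emeasure_measure_of_conv using that by (simp add: ss)
  have hh: "?h -` (?h' -` B) = B" "?h' -` (?h -` B) = B" for B using c by auto
  have eq1: "(\<lambda>A. ?\<nu> (?h -` A)) = ?\<nu>h" by simp
  have eq2: "(\<lambda>A. ?\<nu>h (?h' -` A)) = ?\<nu>" using c by (simp only: hh(1) vimage_ident)
  have iff: "measure_space UNIV (sets borel) ?\<nu> \<longleftrightarrow> measure_space UNIV (sets borel) ?\<nu>h"
  proof
    assume "measure_space UNIV (sets borel) ?\<nu>"
    from measure_space_vimage_borel[OF this, of ?h] show "measure_space UNIV (sets borel) ?\<nu>h"
      unfolding eq1 by simp
  next
    assume "measure_space UNIV (sets borel) ?\<nu>h"
    from measure_space_vimage_borel[OF this, of ?h'] show "measure_space UNIV (sets borel) ?\<nu>"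
      unfolding eq2 by simp
  qed
  have hA: "?h -` A \<in> sets borel" using measurable_sets[of ?h borel borel A] A by simp
  have "emeasure (distr (distr N borel (\<lambda>x. x)) borel ?h) A = emeasure (distr N borel (\<lambda>x. x)) (?h -` A)"
    using A by (subst emeasure_distr) auto
  also have "\<dots> = emeasure (distr N borel ?h) A"
    using iff by (simp only: e[OF hA] e[OF A] vimage_ident)
  finally show "emeasure (distr N borel ?h) A = emeasure (distr (distr N borel (\<lambda>x. x)) borel ?h) A" ..
qed simp

text \<open>\<open>distr\<close> depends on the map only through these preimage masses, whether or
  not the map is measurable.\<close>

lemma distr_cong_preimage:
  assumes "\<And>A. A \<in> sets N \<Longrightarrow> emeasure M (f -` A \<inter> space M) = emeasure M (g -` A \<inter> space M)"
  shows "distr M N f = distr M N g"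
  unfolding distr_def by (rule measure_of_eq[OF sets.space_closed]) (use assms sets.sigma_sets_eq in auto)

definition tilt :: "real \<Rightarrow> real measure \<Rightarrow> real \<Rightarrow> ennreal" where
  "tilt \<alpha> \<mu> t = (\<integral>\<^sup>+s. ennreal (exp (s - s powr (1 / \<alpha>) * t)) \<partial>\<mu>)"

context stable_index
begin

lemma sets_stable_law [simp, measurable_cong]: "sets (stable_law \<alpha>) = sets borel"
  and space_stable_law [simp]: "space (stable_law \<alpha>) = UNIV"
  by (simp_all add: stable_law_def)

lemma prob_space_stable_law: "prob_space (stable_law \<alpha>)"
  unfolding stable_law_def by (rule es.prob_space_distr) measurable

lemma nn_integral_stable_law:
  assumes [measurable]: "f \<in> borel_measurable borel"
  shows "(\<integral>\<^sup>+t. f t \<partial>stable_law \<alpha>) = (\<integral>\<^sup>+E. f (T E) \<partial>exp_space)"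
  unfolding stable_law_def by (rule nn_integral_distr) measurable

lemma AE_stable_law_pos: "AE t in stable_law \<alpha>. 0 < t"
  unfolding stable_law_def by (subst AE_distr_iff) (use AE_good good_T_pos in \<open>auto elim!: eventually_mono\<close>)

text \<open>The generalized gamma law at time \<open>s\<close> is the stable law at time
  \<open>s\<close>, that is the law of \<open>s powr (1 / \<alpha>) * T\<close>, reweighted by
  \<open>exp (s - x)\<close>. Dividing by \<open>s powr (1 / \<alpha>)\<close> gives this density
  with respect to the law of \<open>T\<close>.\<close>

definition kernel :: "real \<Rightarrow> real measure" where
  "kernel s = density (stable_law \<alpha>) (\<lambda>t. ennreal (exp (s - s powr (1 / \<alpha>) * t)))"

lemma sets_kernel [simp, measurable_cong]: "sets (kernel s) = sets borel"
  and space_kernel [simp]: "space (kernel s) = UNIV"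
  by (simp_all add: kernel_def)

lemma nn_integral_kernel:
  assumes [measurable]: "f \<in> borel_measurable borel"
  shows "(\<integral>\<^sup>+t. f t \<partial>kernel s) = (\<integral>\<^sup>+E. ennreal (exp (s - s powr (1 / \<alpha>) * T E)) * f (T E) \<partial>exp_space)"
  unfolding kernel_def
  by (subst nn_integral_density, (measurable)[2], subst nn_integral_stable_law) auto

lemma laplace_kernel:
  assumes "0 \<le> s" "0 \<le> w"
  shows "(\<integral>\<^sup>+t. ennreal (exp (- (w * (s powr (1 / \<alpha>) * t)))) \<partial>kernel s) = ennreal (exp (- s * ((1 + w) powr \<alpha> - 1)))"
proof -
  have "(\<integral>\<^sup>+t. ennreal (exp (- (w * (s powr (1 / \<alpha>) * t)))) \<partial>kernel s) =
     (\<integral>\<^sup>+E. ennreal (exp s) * ennreal (exp (- ((1 + w) * s powr (1 / \<alpha>) * T E))) \<partial>exp_space)"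
    by (subst nn_integral_kernel, measurable)
      (simp add: ennreal_mult'[symmetric] mult_exp_exp algebra_simps)
  also have "\<dots> = ennreal (exp s) * ennreal (exp (- (((1 + w) * s powr (1 / \<alpha>)) powr \<alpha>)))"
    using assms by (subst nn_integral_cmult, measurable) (simp add: laplace_T)
  also have "((1 + w) * s powr (1 / \<alpha>)) powr \<alpha> = (1 + w) powr \<alpha> * s"
    using assms alpha by (simp add: powr_mult powr_powr)
  finally show ?thesis by (simp add: ennreal_mult'[symmetric] mult_exp_exp algebra_simps)
qed

lemma prob_space_kernel: "0 \<le> s \<Longrightarrow> prob_space (kernel s)"
  using laplace_kernel[of s 0] by (intro prob_spaceI) simp

text \<open>The stretched kernel has the prescribed Laplace transform, which settles existence; by
  \<open>laplace_unique\<close> there is no other candidate, so the description operator selects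
  it.\<close>

lemma gengamma_law_eq:
  assumes s: "0 < s"
  shows "gengamma_law \<alpha> s = distr (kernel s) borel (\<lambda>t. s powr (1 / \<alpha>) * t)" (is "_ = ?N")
proof -
  interpret k: prob_space "kernel s" using s by (intro prob_space_kernel) simp
  have N: "prob_space ?N" by (rule k.prob_space_distr) measurable
  have "AE t in kernel s. 0 < t" unfolding kernel_def
    by (subst AE_density) (use AE_stable_law_pos in \<open>auto elim!: eventually_mono\<close>)
  then have N0: "AE x in ?N. 0 \<le> x" by (subst AE_distr_iff) (auto elim!: eventually_mono)
  have nn: "(\<integral>\<^sup>+x. ennreal (exp (- (w * x))) \<partial>?N) = ennreal (exp (- s * ((1 + w) powr \<alpha> - 1)))" if "0 \<le> w" for w
    using laplace_kernel[of s w] s that by (subst nn_integral_distr) auto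
  have conv: "(\<integral>\<^sup>+x. ennreal (exp (- (w * x))) \<partial>N) = ennreal (LINT x|N. exp (- w * x))"
    if "prob_space N" "sets N = sets borel" "AE x in N. 0 \<le> x" "0 \<le> w" for N :: "real measure" and w :: real
  proof -
    interpret prob_space N by fact
    have [measurable_cong]: "sets N = sets borel" by fact
    have "integrable N (\<lambda>x. exp (- (w * x)))"
      using that(3,4) by (intro integrable_const_bound[where B = 1]) (auto elim!: eventually_mono)
    then show ?thesis by (subst nn_integral_eq_integral) auto
  qed
  show ?thesis
    unfolding gengamma_law_def
  proof (rule the_equality)
    show "prob_space ?N \<and> sets ?N = sets borel \<and> (AE x in ?N. 0 \<le> x) \<and>
      (\<forall>\<omega>\<ge>0. (LINT x|?N. exp (- \<omega> * x)) = exp (- s * ((1 + \<omega>) powr \<alpha> - 1)))"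
    proof (intro conjI allI impI N N0)
      fix w :: real assume w: "0 \<le> w"
      have "ennreal (LINT x|?N. exp (- w * x)) = ennreal (exp (- s * ((1 + w) powr \<alpha> - 1)))"
        using conv[OF N _ N0 w] nn[OF w] by simp
      then show "(LINT x|?N. exp (- w * x)) = exp (- s * ((1 + w) powr \<alpha> - 1))"
        by (subst (asm) ennreal_inj) (auto intro!: integral_nonneg_AE)
    qed simp
  next
    fix N assume "prob_space N \<and> sets N = sets borel \<and> (AE x in N. 0 \<le> x) \<and>
      (\<forall>\<omega>\<ge>0. (LINT x|N. exp (- \<omega> * x)) = exp (- s * ((1 + \<omega>) powr \<alpha> - 1)))"
    then have N': "prob_space N" "sets N = sets borel" "AE x in N. 0 \<le> x"
      "\<And>w. 0 \<le> w \<Longrightarrow> (LINT x|N. exp (- w * x)) = exp (- s * ((1 + w) powr \<alpha> - 1))" by auto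
    show "N = ?N"
    proof (rule laplace_unique)
      fix k :: nat
      show "(\<integral>\<^sup>+x. ennreal (exp (- (real k * x))) \<partial>N) = (\<integral>\<^sup>+x. ennreal (exp (- (real k * x))) \<partial>?N)"
        using conv[OF N'(1-3), of "real k"] N'(4)[of "real k"] nn[of "real k"] by simp
    qed (use N N' N0 in \<open>auto intro: prob_space.finite_measure\<close>)
  qed
qed

lemma kernel_0: "kernel 0 = stable_law \<alpha>"
  unfolding kernel_def by (simp add: density_1)

lemma eta_star_kernel:
  assumes "0 \<le> s"
  shows "(if s = 0 then stable_law \<alpha> else distr (gengamma_law \<alpha> s) borel (\<lambda>x. x / s powr (1 / \<alpha>))) = kernel s"
proof (cases "s = 0")
  case False
  then have s: "0 < s" using assms by simp
  have "distr (gengamma_law \<alpha> s) borel (\<lambda>x. x / s powr (1 / \<alpha>)) = distr (kernel s) borel (\<lambda>t. t)"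
    unfolding gengamma_law_eq[OF s] by (subst distr_distr) (use s in \<open>auto simp: o_def\<close>)
  also have "\<dots> = kernel s" by (rule distr_id2) simp
  finally show ?thesis using False by simp
qed (simp add: kernel_0)

text \<open>For \<open>s < 0\<close> the prescribed transform exceeds 1 at \<omega> = 1, impossible
  for a probability law on the non-negative axis. All negative \<open>s\<close> thus share one
  unspecified measure, and the kernel depends on \<open>s\<close> only through the
  rescaling.\<close>

lemma gengamma_law_neg:
  assumes "s < 0"
  shows "gengamma_law \<alpha> s = (THE N. False)"
proof -
  have "\<not> (prob_space N \<and> sets N = sets borel \<and> (AE x in N. 0 \<le> x) \<and>
      (\<forall>\<omega>\<ge>0. (LINT x|N. exp (- \<omega> * x)) = exp (- s * ((1 + \<omega>) powr \<alpha> - 1))))" for N :: "real measure"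
  proof
    assume A: "prob_space N \<and> sets N = sets borel \<and> (AE x in N. 0 \<le> x) \<and>
      (\<forall>\<omega>\<ge>0. (LINT x|N. exp (- \<omega> * x)) = exp (- s * ((1 + \<omega>) powr \<alpha> - 1)))"
    then interpret prob_space N by simp
    have [measurable_cong]: "sets N = sets borel" using A by simp
    have int: "integrable N (\<lambda>x. exp (- 1 * x))"
      using A by (intro integrable_const_bound[where B = 1]) (auto elim!: eventually_mono)
    have "(LINT x|N. exp (- 1 * x)) \<le> (LINT x|N. 1)"
      using A by (intro integral_mono_AE int) (auto elim!: eventually_mono)
    moreover have "(LINT x|N. exp (- 1 * x)) = exp (- s * ((1 + 1) powr \<alpha> - 1))"
      using A by (metis zero_le_one)
    moreover have "1 < exp (- s * ((1 + 1) powr \<alpha> - 1))"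
      using assms alpha gr_one_powr[of 2 \<alpha>] by (simp add: mult_neg_pos)
    ultimately show False by (simp add: prob_space)
  qed
  then have F: "(prob_space N \<and> sets N = sets borel \<and> (AE x in N. 0 \<le> x) \<and>
      (\<forall>\<omega>\<ge>0. (LINT x|N. exp (- \<omega> * x)) = exp (- s * ((1 + \<omega>) powr \<alpha> - 1)))) \<longleftrightarrow> False" for N :: "real measure"
    by blast
  show ?thesis unfolding gengamma_law_def F ..
qed

lemma kernel_measurable:
  "(\<lambda>s. if 0 \<le> s then kernel s else stable_law \<alpha>) \<in> measurable borel (subprob_algebra borel)"
proof (rule measurable_subprob_algebra)
  fix A :: "real set" assume [measurable]: "A \<in> sets borel"
  have "emeasure (kernel s) A = (\<integral>\<^sup>+E. ennreal (exp (s - s powr (1 / \<alpha>) * T E)) * indicator A (T E) \<partial>exp_space)" for s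
    using nn_integral_kernel[of "indicator A" s] by simp
  then have [measurable]: "(\<lambda>s. emeasure (kernel s) A) \<in> borel_measurable borel"
    by (simp only:) measurable
  show "(\<lambda>s. emeasure (if 0 \<le> s then kernel s else stable_law \<alpha>) A) \<in> borel_measurable borel"
    by (simp add: if_distrib[of "\<lambda>M. emeasure M A"])
next
  fix s :: real
  show "subprob_space (if 0 \<le> s then kernel s else stable_law \<alpha>)"
    using prob_space_kernel prob_space_stable_law by (auto intro: prob_space_imp_subprob_space)
qed auto

lemma eta_star_eq_bind:
  assumes \<mu>: "prob_space \<mu>" "sets \<mu> = sets borel" "AE s in \<mu>. 0 \<le> s"
  shows "eta_star \<alpha> \<mu> = \<mu> \<bind> (\<lambda>s. if 0 \<le> s then kernel s else stable_law \<alpha>)"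
proof -
  define k where "k s = (if s = 0 then stable_law \<alpha> else distr (gengamma_law \<alpha> s) borel (\<lambda>x. x / s powr (1 / \<alpha>)))" for s
  define k' where "k' s = (if 0 \<le> s then kernel s else stable_law \<alpha>)" for s
  have k'_meas: "k' \<in> measurable borel (subprob_algebra borel)"
    using kernel_measurable by (simp add: k'_def[abs_def])
  have [measurable_cong]: "sets \<mu> = sets borel" by fact
  have sp: "space \<mu> = UNIV" using \<mu>(2) sets_eq_imp_space_eq by fastforce
  have k: "k s = k' s" if "0 \<le> s" for s using eta_star_kernel[OF that] that by (simp add: k_def k'_def)
  \<comment> \<open>The unspecified measure moved to the Borel sets; by
    \<open>distr_distr_scale\<close> every kernel with negative \<open>s\<close> is a rescaling of
    it.\<close>
  define N where "N = distr (THE N :: real measure. False) borel (\<lambda>x. x)"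
  have kneg: "k s = distr N borel (\<lambda>x. x / s powr (1 / \<alpha>))" if "s < 0" for s
    unfolding N_def using that by (subst distr_distr_scale[symmetric]) (auto simp: gengamma_law_neg k_def)
  have N: "sets N = sets borel" "space N = UNIV" by (auto simp: N_def)
  \<comment> \<open>If \<open>N\<close> is a subprobability, its rescalings depend measurably on
    \<open>s\<close>. Otherwise none of them lies in the space of
    \<open>subprob_algebra borel\<close>, and the preimage is empty.\<close>
  have neg_meas: "k -` A \<inter> {..<0} \<in> sets borel" if A: "A \<in> sets (subprob_algebra borel)" for A
  proof (cases "subprob_space N")
    case True
    then have "N \<in> space (subprob_algebra borel)" by (simp add: space_subprob_algebra N)
    then have "(\<lambda>s. distr N borel (\<lambda>x. x / s powr (1 / \<alpha>))) \<in> measurable borel (subprob_algebra borel)"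
      by (intro measurable_distr2[where M = borel]) measurable
    from measurable_sets[OF this A]
    have "(\<lambda>s. distr N borel (\<lambda>x. x / s powr (1 / \<alpha>))) -` A \<inter> {..<0} \<in> sets borel" by (intro sets.Int) auto
    also have "(\<lambda>s. distr N borel (\<lambda>x. x / s powr (1 / \<alpha>))) -` A \<inter> {..<0} = k -` A \<inter> {..<0}"
      using kneg by auto
    finally show ?thesis .
  next
    case False
    have "k s \<notin> A" if "s < 0" for s
    proof
      assume "k s \<in> A"
      then have "subprob_space (distr N borel (\<lambda>x. x / s powr (1 / \<alpha>)))"
        using sets.sets_into_space[OF A] kneg[OF that] by (auto simp: space_subprob_algebra)
      then have "emeasure (distr N borel (\<lambda>x. x / s powr (1 / \<alpha>))) UNIV \<le> 1"
        using subprob_space.emeasure_space_le_1 by fastforce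
      then have "emeasure N (space N) \<le> 1"
        by (subst (asm) emeasure_distr) (auto simp: N measurable_cong_sets[OF N(1) refl])
      then have "subprob_space N" by (intro subprob_spaceI) (auto simp: N)
      with False show False by simp
    qed
    then have "k -` A \<inter> {..<0} = {}" by auto
    then show ?thesis by simp
  qed
  have "distr \<mu> (subprob_algebra borel) k = distr \<mu> (subprob_algebra borel) k'"
  proof (rule distr_cong_preimage)
    fix A :: "real measure set" assume A: "A \<in> sets (subprob_algebra borel)"
    have m': "k' -` A \<in> sets borel" using measurable_sets[OF k'_meas A] by simp
    have "k -` A = (k' -` A \<inter> {0..}) \<union> (k -` A \<inter> {..<0})"
    proof (rule set_eqI)
      fix s show "s \<in> k -` A \<longleftrightarrow> s \<in> (k' -` A \<inter> {0..}) \<union> (k -` A \<inter> {..<0})"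
        using k[of s] by (cases "0 \<le> s") auto
    qed
    moreover have "(k' -` A \<inter> {0..}) \<union> (k -` A \<inter> {..<0}) \<in> sets borel"
      by (intro sets.Un sets.Int m' neg_meas A) auto
    ultimately have m: "k -` A \<in> sets borel" by (simp only:)
    show "emeasure \<mu> (k -` A \<inter> space \<mu>) = emeasure \<mu> (k' -` A \<inter> space \<mu>)"
    proof (rule emeasure_eq_AE)
      show "AE s in \<mu>. s \<in> k -` A \<inter> space \<mu> \<longleftrightarrow> s \<in> k' -` A \<inter> space \<mu>"
        using \<mu>(3) by eventually_elim (simp add: k)
    qed (use m m' in \<open>simp_all add: sp \<mu>(2)\<close>)
  qed
  \<comment> \<open>\<open>bind\<close> takes its target from the value of the kernel at an
    arbitrary point; since all values live on the Borel sets, the choice does not matter.\<close>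
  moreover have "\<mu> \<bind> f = join (distr \<mu> (subprob_algebra borel) f)"
    if "\<And>s. sets (f s) = sets borel" for f :: "real \<Rightarrow> real measure"
    using that by (simp add: bind_def sp subprob_algebra_cong[of "f _" borel])
  ultimately have "\<mu> \<bind> k = \<mu> \<bind> k'" by (simp add: k_def k'_def)
  then show ?thesis by (simp add: eta_star_def k_def[abs_def] k'_def[abs_def])
qed

section \<open>The mixing law and the Poisson-Kingman law through their density\<close>

lemma measurable_tilt [measurable]:
  assumes "prob_space \<mu>" and [measurable_cong]: "sets \<mu> = sets borel"
  shows "tilt \<alpha> \<mu> \<in> borel_measurable borel"
proof -
  interpret prob_space \<mu> by fact
  show ?thesis unfolding tilt_def by measurable
qed

lemma eta_star_eq_density:
  assumes \<mu>: "prob_space \<mu>" "sets \<mu> = sets borel" "AE s in \<mu>. 0 \<le> s"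
  shows "eta_star \<alpha> \<mu> = density (stable_law \<alpha>) (tilt \<alpha> \<mu>)"
proof (rule measure_eqI)
  let ?k' = "\<lambda>s. if 0 \<le> s then kernel s else stable_law \<alpha>"
  interpret \<mu>: prob_space \<mu> by fact
  interpret sl: prob_space "stable_law \<alpha>" by (rule prob_space_stable_law)
  interpret pair_sigma_finite "stable_law \<alpha>" \<mu> ..
  have [measurable_cong]: "sets \<mu> = sets borel" by fact
  have sp: "space \<mu> = UNIV" using \<mu>(2) sets_eq_imp_space_eq by fastforce
  have [measurable]: "tilt \<alpha> \<mu> \<in> borel_measurable borel" using \<mu> by measurable
  have k': "?k' \<in> measurable \<mu> (subprob_algebra borel)"
    using kernel_measurable measurable_cong_sets[OF \<mu>(2) refl] by blast
  show "sets (eta_star \<alpha> \<mu>) = sets (density (stable_law \<alpha>) (tilt \<alpha> \<mu>))"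
    unfolding eta_star_eq_bind[OF \<mu>] by (subst sets_bind[where N = borel]) (auto simp: sp)
  fix A assume "A \<in> sets (eta_star \<alpha> \<mu>)"
  then have A[measurable]: "A \<in> sets borel"
    unfolding eta_star_eq_bind[OF \<mu>] by (subst (asm) sets_bind[where N = borel]) (auto simp: sp)
  have "emeasure (eta_star \<alpha> \<mu>) A = (\<integral>\<^sup>+s. emeasure (?k' s) A \<partial>\<mu>)"
    unfolding eta_star_eq_bind[OF \<mu>] by (rule emeasure_bind[OF _ k' A]) (simp add: sp)
  also have "\<dots> = (\<integral>\<^sup>+s. emeasure (kernel s) A \<partial>\<mu>)"
    using \<mu>(3) by (intro nn_integral_cong_AE) (auto elim!: eventually_mono)
  also have "\<dots> = (\<integral>\<^sup>+s. (\<integral>\<^sup>+t. ennreal (exp (s - s powr (1 / \<alpha>) * t)) * indicator A t \<partial>stable_law \<alpha>) \<partial>\<mu>)"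
    unfolding kernel_def by (subst emeasure_density) auto
  also have "\<dots> = (\<integral>\<^sup>+t. (\<integral>\<^sup>+s. ennreal (exp (s - s powr (1 / \<alpha>) * t)) * indicator A t \<partial>\<mu>) \<partial>stable_law \<alpha>)"
    by (rule Fubini') measurable
  also have "\<dots> = (\<integral>\<^sup>+t. tilt \<alpha> \<mu> t * indicator A t \<partial>stable_law \<alpha>)"
    unfolding tilt_def by (intro nn_integral_cong nn_integral_multc) measurable
  also have "\<dots> = emeasure (density (stable_law \<alpha>) (tilt \<alpha> \<mu>)) A"
    by (rule emeasure_density[symmetric]) measurable
  finally show "emeasure (eta_star \<alpha> \<mu>) A = emeasure (density (stable_law \<alpha>) (tilt \<alpha> \<mu>)) A" .
qed

lemma nn_integral_tilt:
  assumes \<mu>: "prob_space \<mu>" "sets \<mu> = sets borel" "AE s in \<mu>. 0 \<le> s"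
  shows "(\<integral>\<^sup>+E. tilt \<alpha> \<mu> (T E) \<partial>exp_space) = 1"
proof -
  interpret \<mu>: prob_space \<mu> by fact
  interpret pair_sigma_finite exp_space \<mu> ..
  have [measurable_cong]: "sets \<mu> = sets borel" by fact
  have "(\<integral>\<^sup>+E. tilt \<alpha> \<mu> (T E) \<partial>exp_space) = (\<integral>\<^sup>+s. (\<integral>\<^sup>+E. ennreal (exp (s - s powr (1 / \<alpha>) * T E)) \<partial>exp_space) \<partial>\<mu>)"
    unfolding tilt_def by (rule Fubini'[symmetric]) measurable
  also have "\<dots> = (\<integral>\<^sup>+s. 1 \<partial>\<mu>)"
  proof (rule nn_integral_cong_AE)
    show "AE s in \<mu>. (\<integral>\<^sup>+E. ennreal (exp (s - s powr (1 / \<alpha>) * T E)) \<partial>exp_space) = 1"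
      using \<mu>(3)
    proof eventually_elim
      case (elim s)
      then show ?case using laplace_kernel[of s 0] nn_integral_kernel[of "\<lambda>_. 1" s] by simp
    qed
  qed
  finally show ?thesis by (simp add: \<mu>.emeasure_space_1)
qed

text \<open>\<open>RN_deriv\<close> is determined only up to null sets of the stable law, and these
  pull back under \<open>T\<close> to null sets of \<open>exp_space\<close>; so it may be replaced
  by \<open>tilt\<close>.\<close>

lemma Palpha_eq:
  assumes \<mu>: "prob_space \<mu>" "sets \<mu> = sets borel" "AE s in \<mu>. 0 \<le> s"
  shows "Palpha \<alpha> \<mu> = distr (density exp_space (\<lambda>E. tilt \<alpha> \<mu> (T E))) seqM (\<lambda>E i. J E i / T E)"
proof -
  interpret sl: prob_space "stable_law \<alpha>" by (rule prob_space_stable_law)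
  have [measurable]: "tilt \<alpha> \<mu> \<in> borel_measurable borel" using \<mu> by measurable
  have "AE t in stable_law \<alpha>. tilt \<alpha> \<mu> t = RN_deriv (stable_law \<alpha>) (eta_star \<alpha> \<mu>) t"
    by (rule sl.RN_deriv_unique) (auto simp: eta_star_eq_density[OF \<mu>])
  then have "AE E in exp_space. tilt \<alpha> \<mu> (T E) = RN_deriv (stable_law \<alpha>) (eta_star \<alpha> \<mu>) (T E)"
    unfolding stable_law_def by (rule AE_distrD[rotated]) measurable
  then have "density exp_space (\<lambda>E. RN_deriv (stable_law \<alpha>) (eta_star \<alpha> \<mu>) (T E)) =
      density exp_space (\<lambda>E. tilt \<alpha> \<mu> (T E))"
    by (intro density_cong) (auto elim!: eventually_mono)
  then show ?thesis unfolding Palpha_def PK_def by simp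
qed

end

section \<open>Superposition of two independent families of jumps\<close>

text \<open>Self-similarity of the Levy measure. It produces the scale of a superposition and the
  power of T' that cancels in the fragmentation.\<close>

lemma nn_integral_levy_scale:
  fixes f :: "real \<Rightarrow> ennreal"
  assumes [measurable]: "f \<in> borel_measurable borel" and y: "0 < y"
  shows "(\<integral>\<^sup>+x. f (y * x) \<partial>levy \<alpha>) = ennreal (y powr \<alpha>) * (\<integral>\<^sup>+x. f x \<partial>levy \<alpha>)"
proof -
  have "(\<integral>\<^sup>+x. f (y * x) \<partial>levy \<alpha>) =
      (\<integral>\<^sup>+x. (ennreal (y powr \<alpha>) * ennreal y) * (f (y * x) * ennreal (levy_density \<alpha> (y * x)) * indicator {0<..} x) \<partial>lborel)"
  proof (subst nn_integral_levy, measurable, rule nn_integral_cong)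
    fix x :: real
    show "f (y * x) * ennreal (levy_density \<alpha> x) * indicator {0<..} x =
      (ennreal (y powr \<alpha>) * ennreal y) * (f (y * x) * ennreal (levy_density \<alpha> (y * x)) * indicator {0<..} x)"
    proof (cases "0 < x")
      case True
      have "levy_density \<alpha> x = (y powr \<alpha> * y) * levy_density \<alpha> (y * x)"
        using True y by (simp add: levy_density_def powr_mult powr_diff powr_minus field_simps)
      then have "ennreal (levy_density \<alpha> x) = (ennreal (y powr \<alpha>) * ennreal y) * ennreal (levy_density \<alpha> (y * x))"
        using y by (simp add: ennreal_mult')
      then show ?thesis using True by (simp add: mult_ac)
    qed simp
  qed
  also have "\<dots> = ennreal (y powr \<alpha>) * (ennreal y * (\<integral>\<^sup>+x. f (y * x) * ennreal (levy_density \<alpha> (y * x)) * indicator {0<..} x \<partial>lborel))"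
    by (subst nn_integral_cmult) (auto simp: mult.assoc)
  also have "ennreal y * (\<integral>\<^sup>+x. f (y * x) * ennreal (levy_density \<alpha> (y * x)) * indicator {0<..} x \<partial>lborel) =
      (\<integral>\<^sup>+x. f x * ennreal (levy_density \<alpha> x) * indicator {0<..} x \<partial>lborel)"
    by (rule nn_integral_lborel_scale[symmetric]) (use y in auto)
  also have "\<dots> = (\<integral>\<^sup>+x. f x \<partial>levy \<alpha>)" by (rule nn_integral_levy[symmetric]) measurable
  finally show ?thesis .
qed

lemma emeasure_distr_of_bool:
  assumes X: "X \<in> measurable M N" and A: "A \<in> sets N"
  shows "emeasure (distr M N X) A = (\<integral>\<^sup>+x. of_bool (X x \<in> A) \<partial>M)"
proof -
  have "emeasure (distr M N X) A = (\<integral>\<^sup>+u. indicator A u \<partial>distr M N X)" using A by simp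
  also have "\<dots> = (\<integral>\<^sup>+x. indicator A (X x) \<partial>M)" using A by (intro nn_integral_distr X) simp
  finally show ?thesis by (simp add: indicator_def)
qed

lemma sums_card_superlevel:
  fixes a :: "nat \<Rightarrow> real"
  assumes "finite {j. q \<le> a j}"
  shows "(\<lambda>j. of_bool (q \<le> a j) :: real) sums real (card {j. q \<le> a j})"
proof -
  have "(\<lambda>j. of_bool (q \<le> a j) :: real) sums (\<Sum>j\<in>{j. q \<le> a j}. of_bool (q \<le> a j))"
    by (rule sums_finite[OF assms]) simp
  then show ?thesis by simp
qed

text \<open>A linear combination of the total and of finitely many counts is a sum over the entries
  of one fixed function. Hence \<open>laplace_functional\<close> yields joint Laplace transforms of
  totals and counts.\<close>

lemma suminf_linear_counts:
  fixes a :: "nat \<Rightarrow> real"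
  assumes a: "summable a" and q: "\<And>i. 0 < q i"
  shows "(\<lambda>j. l 0 * a j + (\<Sum>i<n. l (Suc i) * of_bool (q i \<le> a j))) sums
      (l 0 * (\<Sum>j. a j) + (\<Sum>i<n. l (Suc i) * real (card {j. q i \<le> a j})))"
  by (intro sums_add sums_sum sums_mult summable_sums a sums_card_superlevel finite_superlevel_summable q)

lemma measurable_real_card [measurable (raw)]:
  fixes A :: "'a \<Rightarrow> nat \<Rightarrow> real"
  assumes [measurable]: "\<And>j. (\<lambda>w. A w j) \<in> borel_measurable M"
  shows "(\<lambda>w. real (card {j. q \<le> A w j})) \<in> borel_measurable M"
proof -
  have "(\<lambda>w. card {j. q \<le> A w j}) \<in> measurable M (count_space UNIV)"
    by (rule measurable_card) measurable
  then show ?thesis by measurable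
qed

context stable_index
begin

lemma nn_laplace_functional:
  assumes [measurable]: "f \<in> borel_measurable borel"
    and f: "\<And>x. 0 < x \<Longrightarrow> 0 \<le> f x" "\<And>x. 0 < x \<Longrightarrow> f x \<le> C * x" and y: "0 < y"
  shows "(\<integral>\<^sup>+E. ennreal (exp (- (\<Sum>i. f (y * J E i)))) \<partial>exp_space) =
    ennreal (exp (- (y powr \<alpha> * (LINT x|levy \<alpha>. 1 - exp (- f x)))))"
proof -
  let ?f = "\<lambda>x. f (y * x)"
  have f': "0 \<le> ?f x" "?f x \<le> (C * y) * x" if "0 < x" for x
    using f[of "y * x"] y that by (auto simp: mult.assoc)
  have "AE x in levy \<alpha>. 0 \<le> 1 - exp (- f x)" using AE_levy_pos[of \<alpha>] by eventually_elim (use f in simp)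
  then have 1: "(LINT x|levy \<alpha>. 1 - exp (- f x)) = enn2real (\<integral>\<^sup>+x. ennreal (1 - exp (- f x)) \<partial>levy \<alpha>)"
    by (intro integral_eq_nn_integral) auto
  have "AE x in levy \<alpha>. 0 \<le> 1 - exp (- ?f x)" using AE_levy_pos[of \<alpha>] by eventually_elim (use f' in simp)
  then have "(LINT x|levy \<alpha>. 1 - exp (- ?f x)) = enn2real (\<integral>\<^sup>+x. ennreal (1 - exp (- ?f x)) \<partial>levy \<alpha>)"
    by (intro integral_eq_nn_integral) auto
  also have "\<dots> = y powr \<alpha> * (LINT x|levy \<alpha>. 1 - exp (- f x))"
    unfolding 1 by (subst nn_integral_levy_scale[of "\<lambda>x. ennreal (1 - exp (- f x))"])
      (use y in \<open>auto simp: enn2real_mult\<close>)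
  finally have 2: "(LINT E|exp_space. exp (- (\<Sum>i. ?f (J E i)))) = exp (- (y powr \<alpha> * (LINT x|levy \<alpha>. 1 - exp (- f x))))"
    using laplace_functional(1)[of ?f "C * y"] f' by simp
  have nn: "AE E in exp_space. 0 \<le> (\<Sum>i. ?f (J E i))"
    using AE_good
  proof eventually_elim
    case (elim E)
    have "summable (\<lambda>i. ?f (J E i))"
      by (rule summable_comparison_test'[where g = "\<lambda>i. C * y * J E i" and N = 0])
        (use f' good_jump_pos[OF elim] good_summable[OF elim] in \<open>auto intro: summable_mult\<close>)
    then show ?case using f' good_jump_pos[OF elim] by (intro suminf_nonneg) auto
  qed
  then have "integrable exp_space (\<lambda>E. exp (- (\<Sum>i. ?f (J E i))))"
    by (intro es.integrable_const_bound[where B = 1]) (auto elim!: eventually_mono)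
  then have "(\<integral>\<^sup>+E. ennreal (exp (- (\<Sum>i. ?f (J E i)))) \<partial>exp_space) = ennreal (LINT E|exp_space. exp (- (\<Sum>i. ?f (J E i))))"
    by (intro nn_integral_eq_integral) auto
  then show ?thesis unfolding 2 .
qed

definition superposition_scale :: "real \<Rightarrow> real" where
  "superposition_scale y = (1 + y powr \<alpha>) powr (1 / \<alpha>)"

lemma superposition_scale_pos: "0 < superposition_scale y"
  unfolding superposition_scale_def by (simp add: add_pos_nonneg less_imp_neq[symmetric])

lemma superposition_scale_powr: "superposition_scale y powr \<alpha> = 1 + y powr \<alpha>"
  unfolding superposition_scale_def using powr_ge_zero[of y \<alpha>] alpha by (simp add: powr_powr)

lemma AE_good_pair: "AE p in exp_space \<Otimes>\<^sub>M exp_space. good \<alpha> (fst p) \<and> good \<alpha> (snd p)"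
proof -
  \<comment> \<open>A measurable null set covering the exceptional configurations is used, because
    the passage to the product space needs measurability and \<open>good\<close> itself has not been
    shown to be measurable.\<close>
  obtain N where N: "{E \<in> space exp_space. \<not> good \<alpha> E} \<subseteq> N" "N \<in> null_sets exp_space"
    using AE_good[unfolded eventually_ae_filter] by blast
  have [measurable]: "N \<in> sets seqM" using N(2) by auto
  have "AE E in exp_space. E \<notin> N" by (rule AE_not_in[OF N(2)])
  then have "AE p in exp_space \<Otimes>\<^sub>M exp_space. fst p \<notin> N \<and> snd p \<notin> N"
  proof (intro es_pair.AE_pair_measure)
    show "{x \<in> space (exp_space \<Otimes>\<^sub>M exp_space). fst x \<notin> N \<and> snd x \<notin> N} \<in> sets (exp_space \<Otimes>\<^sub>M exp_space)"
      by measurable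
  qed (auto elim!: eventually_mono)
  then show ?thesis by eventually_elim (use N(1) in auto)
qed

text \<open>By independence the Laplace exponents of the two families add up to
  \<open>(1 + y powr \<alpha>) * K\<close>, and \<open>b\<close> is the scale whose \<alpha>-th
  power is this factor. Equal joint Laplace transforms give equal joint laws.\<close>

lemma superposition_counts:
  fixes q :: "nat \<Rightarrow> real"
  assumes y: "0 < y" and q: "\<And>i. 0 < q i" and B: "\<And>i. B i \<in> sets borel"
  defines "b \<equiv> superposition_scale y"
  defines "X \<equiv> \<lambda>i p. case i of 0 \<Rightarrow> y * T (snd p) + T (fst p)
      | Suc i \<Rightarrow> real (card {j. q i \<le> y * J (snd p) j} + card {j. q i \<le> J (fst p) j})"
  defines "Y \<equiv> \<lambda>i E. case i of 0 \<Rightarrow> b * T E | Suc i \<Rightarrow> real (card {j. q i \<le> b * J E j})"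
  shows "(\<integral>\<^sup>+p. of_bool (\<forall>i<Suc n. X i p \<in> B i) \<partial>(exp_space \<Otimes>\<^sub>M exp_space)) =
    (\<integral>\<^sup>+E. of_bool (\<forall>i<Suc n. Y i E \<in> B i) \<partial>exp_space)"
proof -
  have b: "0 < b" unfolding b_def by (rule superposition_scale_pos)
  interpret pp: prob_space "exp_space \<Otimes>\<^sub>M exp_space"
    by (intro prob_space_pair prob_space_exp_space)
  have X: "X i \<in> borel_measurable (exp_space \<Otimes>\<^sub>M exp_space)" for i
    unfolding X_def by (cases i) simp_all
  have Y: "Y i \<in> borel_measurable exp_space" for i
    unfolding Y_def by (cases i) simp_all
  have AE1: "AE p in exp_space \<Otimes>\<^sub>M exp_space. good \<alpha> (fst p) \<and> good \<alpha> (snd p)"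
    by (rule AE_good_pair)
  have Xpos: "AE p in exp_space \<Otimes>\<^sub>M exp_space. 0 \<le> X i p" for i
    using AE1 by eventually_elim
      (use y in \<open>auto simp: X_def split: nat.split intro!: add_nonneg_nonneg mult_nonneg_nonneg intro: less_imp_le dest: good_T_pos\<close>)
  have Ypos: "AE E in exp_space. 0 \<le> Y i E" for i
    using AE_good by eventually_elim (use b good_T_pos in \<open>auto simp: Y_def split: nat.split intro!: less_imp_le\<close>)
  have "(\<integral>\<^sup>+p. 1 * of_bool (\<forall>i<Suc n. X i p \<in> B i) \<partial>(exp_space \<Otimes>\<^sub>M exp_space)) =
    (\<integral>\<^sup>+E. 1 * of_bool (\<forall>i<Suc n. Y i E \<in> B i) \<partial>exp_space)"
  proof (rule joint_laplace_unique[OF X Y Xpos Ypos B])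
    fix l :: "nat \<Rightarrow> real" assume l: "\<And>i. 0 \<le> l i"
    define f where "f x = l 0 * x + (\<Sum>i<n. l (Suc i) * of_bool (q i \<le> x))" for x
    have [measurable]: "f \<in> borel_measurable borel" unfolding f_def by measurable
    \<comment> \<open>Since \<open>q i > 0\<close>, the indicator of \<open>q i \<le> x\<close> is
      at most \<open>x / q i\<close>; so counts obey the linear bound that
      \<open>laplace_functional\<close> demands.\<close>
    define C where "C = l 0 + (\<Sum>i<n. l (Suc i) / q i)"
    have f0: "0 \<le> f x" if "0 < x" for x unfolding f_def using l that by (auto intro!: add_nonneg_nonneg sum_nonneg)
    have fC: "f x \<le> C * x" if "0 < x" for x
    proof -
      have "l (Suc i) * of_bool (q i \<le> x) \<le> l (Suc i) / q i * x" for i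
        using l[of "Suc i"] q[of i] that by (auto simp: field_simps intro: mult_right_mono mult_left_mono)
      then have "(\<Sum>i<n. l (Suc i) * of_bool (q i \<le> x)) \<le> (\<Sum>i<n. l (Suc i) / q i * x)" by (rule sum_mono)
      then show ?thesis by (simp add: f_def C_def distrib_right sum_distrib_right)
    qed
    define K where "K = (LINT x|levy \<alpha>. 1 - exp (- f x))"
    have fsum: "(\<Sum>j. f (c * J E j)) = l 0 * (c * T E) + (\<Sum>i<n. l (Suc i) * real (card {j. q i \<le> c * J E j}))"
      if "good \<alpha> E" for c E
      unfolding f_def using suminf_linear_counts[OF summable_mult[OF good_summable[OF that], of c], of q l n] q
      by (simp add: sums_iff suminf_mult[OF good_summable[OF that]] stable_T_def)
    have "(\<integral>\<^sup>+p. 1 * ennreal (exp (- (\<Sum>i<Suc n. l i * X i p))) \<partial>(exp_space \<Otimes>\<^sub>M exp_space)) =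
      (\<integral>\<^sup>+p. ennreal (exp (- (\<Sum>j. f (1 * J (fst p) j)))) * ennreal (exp (- (\<Sum>j. f (y * J (snd p) j)))) \<partial>(exp_space \<Otimes>\<^sub>M exp_space))"
    proof (rule nn_integral_cong_AE)
      show "AE p in exp_space \<Otimes>\<^sub>M exp_space. 1 * ennreal (exp (- (\<Sum>i<Suc n. l i * X i p))) =
        ennreal (exp (- (\<Sum>j. f (1 * J (fst p) j)))) * ennreal (exp (- (\<Sum>j. f (y * J (snd p) j))))"
        using AE1
      proof eventually_elim
        case (elim p)
        have "(\<Sum>i<Suc n. l i * X i p) = (\<Sum>j. f (1 * J (fst p) j)) + (\<Sum>j. f (y * J (snd p) j))"
          using elim by (subst (1 2) fsum) (auto simp: sum.lessThan_Suc_shift X_def algebra_simps sum.distrib simp del: sum.lessThan_Suc)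
        then show ?case by (simp add: ennreal_mult'[symmetric] mult_exp_exp)
      qed
    qed
    also have "\<dots> = (\<integral>\<^sup>+E. (\<integral>\<^sup>+E'. ennreal (exp (- (\<Sum>j. f (1 * J E j)))) * ennreal (exp (- (\<Sum>j. f (y * J E' j)))) \<partial>exp_space) \<partial>exp_space)"
      by (subst es.nn_integral_fst[symmetric]) auto
    also have "\<dots> = ennreal (exp (- (1 powr \<alpha> * K))) * ennreal (exp (- (y powr \<alpha> * K)))"
      unfolding K_def
      by (subst nn_integral_cmult, measurable, subst nn_integral_multc, measurable)
        (use nn_laplace_functional[OF _ f0 fC zero_less_one] nn_laplace_functional[OF _ f0 fC y] in simp)
    also have "\<dots> = ennreal (exp (- (b powr \<alpha> * K)))"
      unfolding b_def superposition_scale_powr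
      by (subst ennreal_mult'[symmetric]) (simp_all add: mult_exp_exp algebra_simps)
    also have "\<dots> = (\<integral>\<^sup>+E. ennreal (exp (- (\<Sum>j. f (b * J E j)))) \<partial>exp_space)"
      unfolding K_def by (rule nn_laplace_functional[OF _ f0 fC b, symmetric]) auto
    also have "\<dots> = (\<integral>\<^sup>+E. 1 * ennreal (exp (- (\<Sum>i<Suc n. l i * Y i E))) \<partial>exp_space)"
    proof (rule nn_integral_cong_AE)
      show "AE E in exp_space. ennreal (exp (- (\<Sum>j. f (b * J E j)))) = 1 * ennreal (exp (- (\<Sum>i<Suc n. l i * Y i E)))"
        using AE_good
      proof eventually_elim
        case (elim E)
        have "(\<Sum>i<Suc n. l i * Y i E) = (\<Sum>j. f (b * J E j))"
          using elim by (subst fsum) (auto simp: sum.lessThan_Suc_shift Y_def simp del: sum.lessThan_Suc)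
        then show ?case by simp
      qed
    qed
    finally show "(\<integral>\<^sup>+p. 1 * ennreal (exp (- (\<Sum>i<Suc n. l i * X i p))) \<partial>(exp_space \<Otimes>\<^sub>M exp_space)) =
      (\<integral>\<^sup>+E. 1 * ennreal (exp (- (\<Sum>i<Suc n. l i * Y i E))) \<partial>exp_space)" .
  qed (auto simp: pp.emeasure_space_1[simplified] es.emeasure_space_1[simplified])
  then show ?thesis by simp
qed

lemma finite_superlevel_scaled_jumps:
  "good \<alpha> E \<Longrightarrow> 0 < x \<Longrightarrow> finite {j. x \<le> c * J E j}"
  by (rule finite_superlevel_summable[OF summable_mult[OF good_summable]])

lemma rank_scaled_jumps:
  assumes "good \<alpha> E" "0 \<le> c" shows "rank (\<lambda>i. c * J E i) = (\<lambda>i. c * J E i)"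
proof (rule rank_decseq)
  show "decseq (\<lambda>i. c * J E i)"
    using good_decseq[OF assms(1)] assms(2) by (auto simp: decseq_def intro: mult_left_mono)
qed (use assms finite_superlevel_scaled_jumps good_jump_pos[OF assms(1)] in \<open>auto simp: less_imp_le\<close>)

text \<open>The total occupies coordinate \<open>0\<close> in front of the ranking, because the
  densities applied later depend on it: the joint law is needed. On generating events ranks become
  counts, and \<open>superposition_counts\<close> applies.\<close>

lemma superposition_law:
  assumes y: "0 < y"
  defines "b \<equiv> superposition_scale y"
  shows "distr (exp_space \<Otimes>\<^sub>M exp_space) seqM
      (\<lambda>p. case_nat (y * T (snd p) + T (fst p)) (rank (case_sum (\<lambda>i. y * J (snd p) i) (J (fst p))))) =
    distr exp_space seqM (\<lambda>E. case_nat (b * T E) (\<lambda>i. b * J E i))" (is "distr ?P _ ?U = distr _ _ ?V")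
proof (rule measure_eqI_seqM)
  have b: "0 < b" unfolding b_def by (rule superposition_scale_pos)
  interpret pp: prob_space ?P by (intro prob_space_pair prob_space_exp_space)
  have s[measurable]: "(\<lambda>w i. c * J (F w) i) \<in> measurable M seqM" if [measurable]: "F \<in> measurable M seqM" for c F and M :: "'z measure"
    by (rule measurable_seqMI) measurable
  have U[measurable]: "?U \<in> measurable ?P seqM"
    by (intro measurable_case_nat_seqM measurable_rank_case_sum s) measurable
  have V[measurable]: "?V \<in> measurable exp_space seqM"
    by (intro measurable_case_nat_seqM s) measurable
  show "finite_measure (distr ?P seqM ?U)" by (intro prob_space.finite_measure pp.prob_space_distr U)
  fix L :: "(nat \<times> real) list"
  let ?A = "{s. \<forall>(k, q)\<in>set L. q \<le> s k} :: (nat \<Rightarrow> real) set"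
  have A: "?A \<in> sets seqM"
  proof -
    have "{s \<in> space seqM. \<forall>p\<in>set L. snd p \<le> s (fst p)} \<in> sets seqM" by measurable
    then show ?thesis by (simp add: case_prod_beta)
  qed
  \<comment> \<open>A non-positive threshold is met by every rank and imposes nothing, so it is
    replaced by the dummy \<open>1\<close>; the matching \<open>B\<close> is then
    \<open>UNIV\<close>.\<close>
  define q where "q i = (if i < length L \<and> 0 < snd (L ! i) then snd (L ! i) else 1)" for i
  have q: "0 < q i" for i by (simp add: q_def)
  \<comment> \<open>Coordinate \<open>Suc j\<close> is rank \<open>j\<close>, and a rank
    \<open>j\<close> of at least \<open>q\<close> means a count above \<open>j\<close>; this is the
    \<open>fst (L ! i) - 1\<close>. All constraints on the total are collected in
    \<open>B 0\<close>.\<close>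
  define B where "B i = (case i of 0 \<Rightarrow> {x. \<forall>(k, q)\<in>set L. k = 0 \<longrightarrow> q \<le> x}
    | Suc i \<Rightarrow> if fst (L ! i) = 0 \<or> snd (L ! i) \<le> 0 then UNIV else {real (fst (L ! i) - 1) <..})" for i
  have B: "B i \<in> sets borel" for i
  proof (cases i)
    case 0
    have "{x \<in> space borel. \<forall>p\<in>set L. fst p = 0 \<longrightarrow> snd p \<le> x} \<in> sets (borel :: real measure)" by measurable
    then show ?thesis using 0 by (simp add: B_def case_prod_beta)
  qed (simp add: B_def)
  have key: "case_nat t r \<in> ?A \<longleftrightarrow> (\<forall>i<Suc (length L). (case i of 0 \<Rightarrow> t | Suc i \<Rightarrow> real (c i)) \<in> B i)"
    if r: "\<And>n. 0 \<le> r n" and c: "\<And>i n. q i \<le> r n \<longleftrightarrow> n < c i" for t :: real and r c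
  proof -
    have "(\<forall>i<Suc (length L). (case i of 0 \<Rightarrow> t | Suc i \<Rightarrow> real (c i)) \<in> B i) \<longleftrightarrow>
       t \<in> B 0 \<and> (\<forall>i<length L. real (c i) \<in> B (Suc i))"
      by (subst All_less_Suc2) simp
    also have "t \<in> B 0 \<longleftrightarrow> (\<forall>i<length L. fst (L ! i) = 0 \<longrightarrow> snd (L ! i) \<le> t)"
      by (auto simp: B_def all_set_conv_all_nth case_prod_beta)
    also have "(\<forall>i<length L. fst (L ! i) = 0 \<longrightarrow> snd (L ! i) \<le> t) \<and> (\<forall>i<length L. real (c i) \<in> B (Suc i)) \<longleftrightarrow>
       (\<forall>i<length L. (fst (L ! i) = 0 \<longrightarrow> snd (L ! i) \<le> t) \<and> real (c i) \<in> B (Suc i))" by blast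
    also have "\<dots> \<longleftrightarrow> (\<forall>i<length L. snd (L ! i) \<le> case_nat t r (fst (L ! i)))"
    proof (intro all_cong)
      fix i assume i: "i < length L"
      show "((fst (L ! i) = 0 \<longrightarrow> snd (L ! i) \<le> t) \<and> real (c i) \<in> B (Suc i)) \<longleftrightarrow> snd (L ! i) \<le> case_nat t r (fst (L ! i))"
      proof (cases "fst (L ! i)")
        case (Suc k)
        show ?thesis
        proof (cases "0 < snd (L ! i)")
          case True
          then have "q i = snd (L ! i)" using i by (simp add: q_def)
          then show ?thesis using Suc True c[of i k] by (simp add: B_def)
        next
          case False
          then show ?thesis using Suc r[of k] by (simp add: B_def)
        qed
      qed (simp add: B_def)
    qed
    also have "\<dots> \<longleftrightarrow> case_nat t r \<in> ?A" by (auto simp: all_set_conv_all_nth case_prod_beta)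
    finally show ?thesis by simp
  qed
  have AE1: "AE p in ?P. good \<alpha> (fst p) \<and> good \<alpha> (snd p)"
    by (rule AE_good_pair)
  have "emeasure (distr ?P seqM ?U) ?A = (\<integral>\<^sup>+p. of_bool (?U p \<in> ?A) \<partial>?P)"
    by (rule emeasure_distr_of_bool[OF U A])
  also have "\<dots> = (\<integral>\<^sup>+p. of_bool (\<forall>i<Suc (length L). (case i of 0 \<Rightarrow> y * T (snd p) + T (fst p)
      | Suc i \<Rightarrow> real (card {j. q i \<le> y * J (snd p) j} + card {j. q i \<le> J (fst p) j})) \<in> B i) \<partial>?P)"
  proof (rule nn_integral_cong_AE)
    show "AE p in ?P. of_bool (?U p \<in> ?A) = (of_bool (\<forall>i<Suc (length L). (case i of 0 \<Rightarrow> y * T (snd p) + T (fst p)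
      | Suc i \<Rightarrow> real (card {j. q i \<le> y * J (snd p) j} + card {j. q i \<le> J (fst p) j})) \<in> B i) :: ennreal)"
      using AE1
    proof eventually_elim
      case (elim p)
      let ?F = "case_sum (\<lambda>i. y * J (snd p) i) (J (fst p))"
      have fin1: "finite {j. x \<le> y * J (snd p) j}" "finite {j. x \<le> J (fst p) j}" if "0 < x" for x
        using finite_superlevel_scaled_jumps[of "snd p" x y] finite_superlevel_scaled_jumps[of "fst p" x 1] elim that by auto
      have fin: "finite {j. x \<le> ?F j}" if "0 < x" for x
        unfolding superlevel_case_sum using fin1[OF that] by simp
      have "?U p \<in> ?A \<longleftrightarrow> (\<forall>i<Suc (length L). (case i of 0 \<Rightarrow> y * T (snd p) + T (fst p)
         | Suc i \<Rightarrow> real (card {j. q i \<le> y * J (snd p) j} + card {j. q i \<le> J (fst p) j})) \<in> B i)"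
        by (rule key) (auto simp: rank_nonneg le_rank_iff[OF fin q] card_superlevel_case_sum[OF fin1[OF q]])
      then show ?case by (simp only:)
    qed
  qed
  also have "\<dots> = (\<integral>\<^sup>+E. of_bool (\<forall>i<Suc (length L). (case i of 0 \<Rightarrow> b * T E
      | Suc i \<Rightarrow> real (card {j. q i \<le> b * J E j})) \<in> B i) \<partial>exp_space)"
    unfolding b_def by (rule superposition_counts[OF y q B])
  also have "\<dots> = (\<integral>\<^sup>+E. of_bool (?V E \<in> ?A) \<partial>exp_space)"
  proof (rule nn_integral_cong_AE)
    show "AE E in exp_space. of_bool (\<forall>i<Suc (length L). (case i of 0 \<Rightarrow> b * T E
      | Suc i \<Rightarrow> real (card {j. q i \<le> b * J E j})) \<in> B i) = (of_bool (?V E \<in> ?A) :: ennreal)"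
      using AE_good
    proof eventually_elim
      case (elim E)
      have r: "rank (\<lambda>i. b * J E i) = (\<lambda>i. b * J E i)" using rank_scaled_jumps[OF elim] b by simp
      have "?V E \<in> ?A \<longleftrightarrow> (\<forall>i<Suc (length L). (case i of 0 \<Rightarrow> b * T E
         | Suc i \<Rightarrow> real (card {j. q i \<le> b * J E j})) \<in> B i)"
      proof (rule key)
        fix i n
        have "q i \<le> rank (\<lambda>i. b * J E i) n \<longleftrightarrow> n < card {j. q i \<le> b * J E j}"
          by (rule le_rank_iff[OF finite_superlevel_scaled_jumps[OF elim] q])
        then show "q i \<le> b * J E n \<longleftrightarrow> n < card {j. q i \<le> b * J E j}" unfolding r .
      qed (use b good_jump_pos[OF elim] in \<open>auto simp: less_imp_le\<close>)
      then show ?case by simp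
    qed
  qed
  also have "\<dots> = emeasure (distr exp_space seqM ?V) ?A"
    by (rule emeasure_distr_of_bool[OF V A, symmetric])
  finally show "emeasure (distr ?P seqM ?U) ?A = emeasure (distr exp_space seqM ?V) ?A" .
qed auto

lemma nn_integral_superposition:
  assumes y: "0 < y" and [measurable]: "F \<in> borel_measurable (borel \<Otimes>\<^sub>M seqM)"
  defines "b \<equiv> superposition_scale y"
  shows "(\<integral>\<^sup>+E. (\<integral>\<^sup>+E'. F (y * T E' + T E, rank (case_sum (\<lambda>i. y * J E' i) (J E))) \<partial>exp_space) \<partial>exp_space) =
    (\<integral>\<^sup>+E. F (b * T E, \<lambda>i. b * J E i) \<partial>exp_space)"
proof -
  have s[measurable]: "(\<lambda>w i. c * J (F w) i) \<in> measurable M seqM" if [measurable]: "F \<in> measurable M seqM" for c F and M :: "'z measure"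
    by (rule measurable_seqMI) measurable
  have sh[measurable]: "(\<lambda>u i. u (Suc i)) \<in> measurable seqM seqM" by (rule measurable_seqMI) measurable
  have [measurable]: "(\<lambda>p. rank (case_sum (\<lambda>i. y * J (snd p) i) (J (fst p)))) \<in> measurable (exp_space \<Otimes>\<^sub>M exp_space) seqM"
    by (intro measurable_rank_case_sum s) measurable
  have [measurable]: "(\<lambda>E i. b * J E i) \<in> measurable exp_space seqM" by (rule s) measurable
  let ?G = "\<lambda>u. F (u 0, \<lambda>i. u (Suc i))"
  have "(\<integral>\<^sup>+E. (\<integral>\<^sup>+E'. F (y * T E' + T E, rank (case_sum (\<lambda>i. y * J E' i) (J E))) \<partial>exp_space) \<partial>exp_space) =
     (\<integral>\<^sup>+p. F (y * T (snd p) + T (fst p), rank (case_sum (\<lambda>i. y * J (snd p) i) (J (fst p)))) \<partial>(exp_space \<Otimes>\<^sub>M exp_space))"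
    by (subst es.nn_integral_fst[symmetric]) auto
  also have "\<dots> = (\<integral>\<^sup>+u. ?G u \<partial>distr (exp_space \<Otimes>\<^sub>M exp_space) seqM
      (\<lambda>p. case_nat (y * T (snd p) + T (fst p)) (rank (case_sum (\<lambda>i. y * J (snd p) i) (J (fst p))))))"
    by (subst nn_integral_distr) auto
  also have "\<dots> = (\<integral>\<^sup>+u. ?G u \<partial>distr exp_space seqM (\<lambda>E. case_nat (b * T E) (\<lambda>i. b * J E i)))"
    unfolding superposition_law[OF y] b_def ..
  also have "\<dots> = (\<integral>\<^sup>+E. F (b * T E, \<lambda>i. b * J E i) \<partial>exp_space)"
    by (subst nn_integral_distr) auto
  finally show ?thesis .
qed

end

section \<open>Stick breaking\<close>

lemma measurable_seqM_scale [measurable (raw)]: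
  assumes [measurable]: "c \<in> borel_measurable M" "F \<in> measurable M seqM"
  shows "(\<lambda>w j. c w * F w j) \<in> measurable M seqM"
  by (rule measurable_seqMI) measurable

lemma measurable_seqM_divide [measurable (raw)]:
  assumes [measurable]: "c \<in> borel_measurable M" "F \<in> measurable M seqM"
  shows "(\<lambda>w j. F w j / c w) \<in> measurable M seqM"
  by (rule measurable_seqMI) measurable

lemma measurable_beta_density [measurable]: "beta_density a b \<in> borel_measurable borel"
  unfolding beta_density_def by measurable

lemma sets_beta_law [simp, measurable_cong]: "sets (beta_law a b) = sets borel"
  and space_beta_law [simp]: "space (beta_law a b) = UNIV"
  by (simp_all add: beta_law_def)

lemma nn_integral_beta_law:
  assumes [measurable]: "f \<in> borel_measurable borel"
  shows "(\<integral>\<^sup>+w. f w \<partial>beta_law a b) = (\<integral>\<^sup>+w. ennreal (beta_density a b w) * f w \<partial>lborel)"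
  unfolding beta_law_def by (subst nn_integral_density) auto

lemma AE_beta_law: "AE w in beta_law a b. 0 < w \<and> w < 1"
  unfolding beta_law_def by (subst AE_density) (auto simp: beta_density_def)

lemma nn_integral_beta_density:
  assumes "0 < a" "0 < b"
  shows "(\<integral>\<^sup>+w. ennreal (beta_density a b w) \<partial>lborel) = 1"
proof -
  have G: "0 < Gamma a" "0 < Gamma b" "0 < Gamma (a + b)" using assms by (auto intro: Gamma_real_pos)
  have nz: "Gamma a \<noteq> 0" "Gamma b \<noteq> 0" "Gamma (a + b) \<noteq> 0" using G by linarith+
  have "(\<integral>\<^sup>+w. ennreal (beta_density a b w) \<partial>lborel) =
      (\<integral>\<^sup>+w. ennreal (Gamma (a + b) / (Gamma a * Gamma b)) * (ennreal (w powr (a - 1) * (1 - w) powr (b - 1)) * indicator {0..1} w) \<partial>lborel)"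
  proof (rule nn_integral_cong_AE, rule AE_mp[OF AE_lborel_singleton[of 0]], rule AE_mp[OF AE_lborel_singleton[of 1]], intro AE_I2 impI)
    fix w :: real assume "w \<noteq> 1" "w \<noteq> 0"
    then show "ennreal (beta_density a b w) = ennreal (Gamma (a + b) / (Gamma a * Gamma b)) *
      (ennreal (w powr (a - 1) * (1 - w) powr (b - 1)) * indicator {0..1} w)"
      using G by (auto simp: beta_density_def indicator_def ennreal_mult'[symmetric] mult_ac)
  qed
  also have "\<dots> = ennreal (Gamma (a + b) / (Gamma a * Gamma b)) * ennreal (Beta a b)"
    by (subst nn_integral_cmult, measurable,
        subst nn_integral_has_integral_lebesgue'[OF _ has_integral_Beta_real[OF assms]]) auto
  also have "\<dots> = 1" using G assms by (simp add: Beta_def ennreal_mult'[symmetric] nz)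
  finally show ?thesis .
qed

lemma prob_space_beta_law: "0 < a \<Longrightarrow> 0 < b \<Longrightarrow> prob_space (beta_law a b)"
  using nn_integral_beta_density[of a b] nn_integral_beta_law[of "\<lambda>_. 1" a b] by (intro prob_spaceI) simp

text \<open>The factor \<open>1 - w\<close> raises the second Beta parameter by one; the mean is the
  ratio of the normalising constants.\<close>

lemma nn_integral_beta_law_complement:
  assumes "0 < a" "0 < b"
  shows "(\<integral>\<^sup>+w. ennreal (1 - w) \<partial>beta_law a b) = ennreal (b / (a + b))"
proof -
  have "(\<integral>\<^sup>+w. ennreal (1 - w) \<partial>beta_law a b) =
      (\<integral>\<^sup>+w. ennreal (b / (a + b)) * ennreal (beta_density a (b + 1) w) \<partial>lborel)"
  proof (subst nn_integral_beta_law, measurable, rule nn_integral_cong)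
    fix w :: real
    show "ennreal (beta_density a b w) * ennreal (1 - w) = ennreal (b / (a + b)) * ennreal (beta_density a (b + 1) w)"
    proof (cases "0 < w \<and> w < 1")
      case True
      have g: "Gamma (b + 1) = b * Gamma b" "Gamma (a + (b + 1)) = (a + b) * Gamma (a + b)"
        using assms Gamma_plus1[of b] Gamma_plus1[of "a + b"] by (auto simp: add.assoc nonpos_Ints_def)
      have p: "(1 - w) powr (b + 1 - 1) = (1 - w) powr (b - 1) * (1 - w)"
        using True by (simp add: powr_diff)
      have nz: "Gamma a \<noteq> 0" "Gamma b \<noteq> 0" "a + b \<noteq> 0"
        using Gamma_real_pos[OF assms(1)] Gamma_real_pos[OF assms(2)] assms by linarith+
      have "b / (a + b) * (X * ((a + b) * G) / (Gamma a * (b * Gamma b))) = X * G / (Gamma a * Gamma b)" for X G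
        using nz assms by (simp add: divide_simps)
      then have "beta_density a b w * (1 - w) = b / (a + b) * beta_density a (b + 1) w"
        using True unfolding beta_density_def g p by (simp add: mult_ac)
      then show ?thesis using True assms by (simp add: ennreal_mult'[symmetric] ennreal_mult''[symmetric])
    qed (auto simp: beta_density_def)
  qed
  also have "\<dots> = ennreal (b / (a + b))"
    using nn_integral_beta_density[of a "b + 1"] assms by (subst nn_integral_cmult) auto
  finally show ?thesis .
qed

section \<open>GEM sequences and partial stick breaking\<close>

lemma sets_GEM_space [simp, measurable_cong]: "sets (GEM_space \<alpha> \<theta>) = sets seqM"
  unfolding GEM_space_def seqM_def by (intro sets_PiM_cong) auto

lemma space_GEM_space [simp]: "space (GEM_space \<alpha> \<theta>) = UNIV"
  using sets_eq_imp_space_eq[OF sets_GEM_space] by simp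

lemma measurable_stick [measurable (raw)]:
  assumes [measurable]: "F \<in> measurable M seqM"
  shows "(\<lambda>w. stick (F w)) \<in> measurable M seqM"
  unfolding stick_def by (rule measurable_seqMI) (intro borel_measurable_times borel_measurable_prod borel_measurable_diff; measurable)

definition rem :: "(nat \<Rightarrow> real) \<Rightarrow> nat \<Rightarrow> real" where
  "rem W n = (\<Prod>j<n. 1 - W j)"

lemma measurable_rem [measurable (raw)]:
  assumes [measurable]: "F \<in> measurable M seqM"
  shows "(\<lambda>w. rem (F w) n) \<in> borel_measurable M"
  unfolding rem_def by (intro borel_measurable_prod borel_measurable_diff; measurable)

lemma rem_case_nat: "rem (case_nat w W) (Suc n) = (1 - w) * rem W n"
  unfolding rem_def by (subst prod.lessThan_Suc_shift) simp

lemma stick_eq_rem: "stick W i = W i * rem W i"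
  by (simp add: stick_def rem_def)

text \<open>After \<open>n\<close> breaks the residual mass is divided according to
  \<open>s\<close>. This interpolates between \<open>s\<close> itself at \<open>n = 0\<close> and
  full stick breaking as \<open>n\<close> grows.\<close>

definition partial_stick :: "nat \<Rightarrow> (nat \<Rightarrow> real) \<Rightarrow> (nat \<Rightarrow> real) \<Rightarrow> nat \<Rightarrow> real" where
  "partial_stick n W s i = (if i < n then stick W i else rem W n * s (i - n))"

lemma partial_stick_0: "partial_stick 0 W s = s"
  by (rule ext) (simp add: partial_stick_def rem_def)

lemma partial_stick_Suc: "partial_stick (Suc n) (case_nat w W) s = case_nat w (\<lambda>i. (1 - w) * partial_stick n W s i)"
proof
  fix i
  show "partial_stick (Suc n) (case_nat w W) s i = case_nat w (\<lambda>i. (1 - w) * partial_stick n W s i) i"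
  proof (cases i)
    case 0
    then show ?thesis by (simp add: partial_stick_def stick_def)
  next
    case (Suc k)
    then show ?thesis by (simp add: partial_stick_def stick_eq_rem rem_case_nat)
  qed
qed

lemma measurable_partial_stick [measurable (raw)]:
  assumes [measurable]: "F \<in> measurable M seqM" "G \<in> measurable M seqM"
  shows "(\<lambda>w. partial_stick n (F w) (G w)) \<in> measurable M seqM"
proof (rule measurable_seqMI)
  fix i
  have [measurable]: "(\<lambda>w. stick (F w) i) \<in> borel_measurable M"
    by (rule measurable_seqM_component) measurable
  show "(\<lambda>w. partial_stick n (F w) (G w) i) \<in> borel_measurable M"
    by (cases "i < n") (simp_all add: partial_stick_def)
qed

lemma superlevel_case_nat: "{i. x \<le> case_nat w g i} = (if x \<le> w then {0} else {}) \<union> Suc ` {i. x \<le> g i}"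
proof (rule set_eqI)
  fix i show "i \<in> {i. x \<le> case_nat w g i} \<longleftrightarrow> i \<in> (if x \<le> w then {0} else {}) \<union> Suc ` {i. x \<le> g i}"
    by (cases i) auto
qed

lemma card_superlevel_case_nat:
  "finite {i. x \<le> g i} \<Longrightarrow> card {i. x \<le> case_nat w g i} = of_bool (x \<le> w) + card {i. x \<le> g i}"
  unfolding superlevel_case_nat by (subst card_Un_disjoint) (auto simp: card_image)

text \<open>Ranking the remainder first does not alter the counts, so the nested rankings that arise
  in \<open>tilted_iterate\<close> collapse into a single one.\<close>

lemma rank_case_nat_rank:
  fixes a :: "nat \<Rightarrow> real"
  assumes fin: "\<And>x. 0 < x \<Longrightarrow> finite {i. x \<le> a i}" and w: "w < 1"
  shows "rank (case_nat w (\<lambda>i. (1 - w) * rank a i)) = rank (case_nat w (\<lambda>i. (1 - w) * a i))"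
proof (rule rank_eqI)
  fix x :: real assume x: "0 < x"
  then have xw: "0 < x / (1 - w)" using w by simp
  have eq: "{i. x \<le> (1 - w) * f i} = {i. x / (1 - w) \<le> f i}" for f :: "nat \<Rightarrow> real"
    using w by (auto simp: field_simps)
  have lt: "{i. x / (1 - w) \<le> rank a i} = {..<card {i. x / (1 - w) \<le> a i}}"
    using le_rank_iff[OF fin xw] by auto
  have "finite {i. x \<le> (1 - w) * rank a i}" "finite {i. x \<le> (1 - w) * a i}"
    unfolding eq lt using fin[OF xw] by auto
  then show "card {i. x \<le> case_nat w (\<lambda>i. (1 - w) * rank a i) i} = card {i. x \<le> case_nat w (\<lambda>i. (1 - w) * a i) i}"
    by (simp only: card_superlevel_case_nat) (simp add: eq lt)
qed

lemma finite_superlevel_partial_stick: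
  assumes fin: "\<And>x. 0 < x \<Longrightarrow> finite {i. x \<le> s i}" and s: "\<And>i. 0 \<le> s i" and x: "0 < x"
  shows "finite {i. x \<le> partial_stick n W s i}"
proof -
  have "{i. x \<le> partial_stick n W s i} \<subseteq> {..<n} \<union> (\<lambda>i. i + n) ` {i. x \<le> rem W n * s i}"
  proof
    fix i assume "i \<in> {i. x \<le> partial_stick n W s i}"
    then show "i \<in> {..<n} \<union> (\<lambda>i. i + n) ` {i. x \<le> rem W n * s i}"
      by (cases "i < n") (auto simp: partial_stick_def image_iff intro!: exI[of _ "i - n"])
  qed
  moreover have "finite {i. x \<le> rem W n * s i}"
  proof (cases "0 < rem W n")
    case True
    then have "{i. x \<le> rem W n * s i} = {i. x / rem W n \<le> s i}" by (auto simp: field_simps)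
    then show ?thesis using fin[of "x / rem W n"] x True by simp
  next
    case False
    then have "rem W n * s i \<le> 0" for i using s[of i] by (simp add: mult_nonpos_nonneg)
    then have "{i. x \<le> rem W n * s i} = {}" using x by (auto simp: not_le intro: le_less_trans)
    then show ?thesis by simp
  qed
  ultimately show ?thesis by (meson finite_UnI finite_imageI finite_lessThan finite_subset)
qed

text \<open>When the residual mass is below \<open>q\<close>, no piece of it reaches
  \<open>q\<close>, however it is divided; only the first \<open>n\<close> sticks count.\<close>

lemma superlevel_partial_stick:
  assumes W: "\<And>i. 0 < W i \<and> W i < 1" and r: "\<And>m. n \<le> m \<Longrightarrow> rem W m < q" and s: "\<And>i. 0 \<le> s i \<and> s i \<le> 1"
  shows "{i. q \<le> partial_stick n W s i} = {i. q \<le> stick W i}"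
proof -
  have rp: "0 < rem W m" for m unfolding rem_def using W by (intro prod_pos) auto
  have "q \<le> partial_stick n W s i \<longleftrightarrow> q \<le> stick W i" for i
  proof (cases "i < n")
    case False
    have "rem W n * s (i - n) \<le> rem W n * 1" using rp[of n] s[of "i - n"] by (intro mult_left_mono) auto
    then have 1: "rem W n * s (i - n) < q" using r[of n] by simp
    have "W i * rem W i \<le> 1 * rem W i" using rp[of i] W[of i] by (intro mult_right_mono) auto
    then have "stick W i < q" using r[of i] False by (simp add: stick_eq_rem)
    then show ?thesis using 1 False by (simp add: partial_stick_def)
  qed (simp add: partial_stick_def)
  then show ?thesis by simp
qed

lemma bij_insert_skip: "bij (case_nat i (\<lambda>j. if j < i then j else Suc j))" (is "bij ?h")
proof (rule bijI)
  show "inj ?h"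
  proof (rule injI)
    fix x y show "?h x = ?h y \<Longrightarrow> x = y" by (cases x; cases y) (auto split: if_splits)
  qed
  show "surj ?h"
  proof (rule surjI)
    fix y :: nat
    show "?h (if y = i then 0 else if y < i then Suc y else y) = y" by (cases y) auto
  qed
qed

lemma rank_case_nat_skip:
  fixes a :: "nat \<Rightarrow> real"
  shows "rank (case_nat (a i) (\<lambda>j. if j < i then a j else a (Suc j))) = rank a"
proof -
  have "case_nat (a i) (\<lambda>j. if j < i then a j else a (Suc j)) = (\<lambda>n. a (case_nat i (\<lambda>j. if j < i then j else Suc j) n))"
    by (rule ext) (auto split: nat.split)
  then show ?thesis using rank_reindex[OF bij_insert_skip, of a] by simp
qed

text \<open>\<open>w = x / (x + t)\<close> is the share of a new jump \<open>x\<close> in the total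
  that it creates together with \<open>t\<close>.\<close>

lemma nn_integral_ratio_substitution:
  fixes f :: "real \<Rightarrow> ennreal"
  assumes [measurable]: "f \<in> borel_measurable borel" and t: "0 < t"
  shows "(\<integral>\<^sup>+x. f x * indicator {0<..} x \<partial>lborel) =
    (\<integral>\<^sup>+w. f (t * w / (1 - w)) * ennreal (t / (1 - w)\<^sup>2) * indicator {0<..<1} w \<partial>lborel)"
proof (rule nn_integral_substitution_incr[where a = "\<lambda>n. 1 / (real n + 3)" and b = "\<lambda>n. 1 - 1 / (real n + 3)"])
  fix n :: nat
  have n3: "1 / (real n + 3) \<le> 1 / 3" by (simp add: field_simps)
  then show "1 / (real n + 3) < 1 - 1 / (real n + 3)" by linarith
  have *: "w < 1" if "w \<in> {1 / (real n + 3)..1 - 1 / (real n + 3)}" for w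
    using that by (auto intro: le_less_trans)
  show "continuous_on {1 / (real n + 3)..1 - 1 / (real n + 3)} (\<lambda>w. t / (1 - w)\<^sup>2)"
    using * by (intro continuous_intros) auto
  fix w assume w: "w \<in> {1 / (real n + 3)..1 - 1 / (real n + 3)}"
  show "((\<lambda>w. t * w / (1 - w)) has_real_derivative t / (1 - w)\<^sup>2) (at w)"
    using *[OF w] by (auto intro!: derivative_eq_intros simp: power2_eq_square field_simps)
  show "0 \<le> t / (1 - w)\<^sup>2" using t by simp
next
  show "decseq (\<lambda>n. 1 / (real n + 3))" by (auto simp: decseq_def field_simps)
  show "incseq (\<lambda>n. 1 - 1 / (real n + 3))" by (auto simp: incseq_def field_simps)
  show "{0<..<1} = (\<Union>n. {1 / (real n + 3)..1 - 1 / (real n + 3)})"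
  proof safe
    fix w :: real assume w: "w \<in> {0<..<1}"
    obtain n :: nat where n: "max (1 / w) (1 / (1 - w)) \<le> real n" using real_arch_simple by blast
    have "1 / w \<le> real n + 3" "1 / (1 - w) \<le> real n + 3" using n by auto
    then have "1 / (real n + 3) \<le> w" "1 / (real n + 3) \<le> 1 - w" using w by (auto simp: field_simps)
    then show "w \<in> (\<Union>n. {1 / (real n + 3)..1 - 1 / (real n + 3)})" by auto
  next
    fix w :: real and n :: nat assume w: "w \<in> {1 / (real n + 3)..1 - 1 / (real n + 3)}"
    have p: "0 < 1 / (real n + 3)" by simp
    from w have "1 / (real n + 3) \<le> w" "w \<le> 1 - 1 / (real n + 3)" by auto
    with p have "0 < w" "w < 1" by linarith+
    then show "w \<in> {0<..<1}" by simp
  qed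
  have h: "1 - 1 / (real n + 3) = (real n + 2) / (real n + 3)" for n by (simp add: field_simps)
  have ga: "t * (1 / (real n + 3)) / (1 - 1 / (real n + 3)) = t / (real n + 2)" for n unfolding h by simp
  have gb: "t * (1 - 1 / (real n + 3)) / (1 - (1 - 1 / (real n + 3))) = t * (real n + 2)" for n
    by (subst diff_diff_eq2) (simp add: h)
  show "{0<..} = (\<Union>n. {t * (1 / (real n + 3)) / (1 - 1 / (real n + 3))..
      t * (1 - 1 / (real n + 3)) / (1 - (1 - 1 / (real n + 3)))})"
    unfolding ga gb
  proof (rule set_eqI, rule iffI)
    fix v :: real assume v: "v \<in> {0<..}"
    obtain n :: nat where n: "max (t / v) (v / t) \<le> real n" using real_arch_simple by blast
    have "t / v \<le> real n + 2" "v / t \<le> real n + 2" using n by auto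
    then have "t / (real n + 2) \<le> v" "v \<le> t * (real n + 2)" using v t by (auto simp: field_simps)
    then show "v \<in> (\<Union>n. {t / (real n + 2)..t * (real n + 2)})" by auto
  next
    fix v :: real assume "v \<in> (\<Union>n. {t / (real n + 2)..t * (real n + 2)})"
    then obtain n :: nat where "t / (real n + 2) \<le> v" by auto
    moreover have "0 < t / (real n + 2)" using t by simp
    ultimately show "v \<in> {0<..}" unfolding greaterThan_iff by (rule less_le_trans[rotated])
  qed
qed measurable

context stable_index
begin

lemma prob_space_GEM_space:
  assumes "0 < \<theta>" shows "prob_space (GEM_space \<alpha> \<theta>)"
  unfolding GEM_space_def using alpha assms
  by (intro prob_space_PiM prob_space_beta_law add_pos_nonneg) auto

lemma nn_integral_GEM_space:
  assumes \<theta>: "0 < \<theta>" and [measurable]: "g \<in> borel_measurable seqM"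
  shows "(\<integral>\<^sup>+W. g W \<partial>GEM_space \<alpha> \<theta>) =
    (\<integral>\<^sup>+w. \<integral>\<^sup>+W. g (case_nat w W) \<partial>GEM_space \<alpha> (\<theta> + \<alpha>) \<partial>beta_law (1 - \<alpha>) (\<theta> + \<alpha>))"
proof -
  let ?B = "beta_law (1 - \<alpha>) (\<theta> + \<alpha>)" and ?G = "GEM_space \<alpha> (\<theta> + \<alpha>)"
  interpret G: prob_space ?G using \<theta> alpha by (intro prob_space_GEM_space) simp
  have "prob_space (beta_law (1 - \<alpha>) (\<theta> + real (Suc i) * \<alpha>))" for i
    using alpha \<theta> by (intro prob_space_beta_law add_pos_nonneg) auto
  from distr_case_nat_PiM[of "\<lambda>i. beta_law (1 - \<alpha>) (\<theta> + real (Suc i) * \<alpha>)", OF this]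
  have eq: "GEM_space \<alpha> \<theta> = distr (?B \<Otimes>\<^sub>M ?G) (GEM_space \<alpha> \<theta>) (\<lambda>(s, w). case_nat s w)"
    by (simp add: GEM_space_def algebra_simps)
  have "(\<integral>\<^sup>+W. g W \<partial>GEM_space \<alpha> \<theta>) = (\<integral>\<^sup>+p. g (case p of (s, w) \<Rightarrow> case_nat s w) \<partial>(?B \<Otimes>\<^sub>M ?G))"
    by (subst eq, rule nn_integral_distr) measurable
  also have "\<dots> = (\<integral>\<^sup>+w. \<integral>\<^sup>+W. g (case_nat w W) \<partial>?G \<partial>?B)"
    by (subst G.nn_integral_fst[symmetric]) (simp_all add: case_prod_beta)
  finally show ?thesis .
qed

lemma AE_GEM_space:
  assumes "0 < \<theta>" shows "AE W in GEM_space \<alpha> \<theta>. \<forall>i. 0 < W i \<and> W i < 1"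
proof -
  interpret product_prob_space "\<lambda>i. beta_law (1 - \<alpha>) (\<theta> + real (Suc i) * \<alpha>)" "UNIV :: nat set"
    using alpha assms by (intro product_prob_spaceI prob_space_beta_law add_pos_nonneg) auto
  show ?thesis unfolding GEM_space_def AE_all_countable
    by (intro allI AE_component AE_beta_law) auto
qed

section \<open>The residual mass of stick breaking vanishes\<close>

lemma nn_integral_rem:
  "0 < \<theta> \<Longrightarrow> (\<integral>\<^sup>+W. ennreal (rem W n) \<partial>GEM_space \<alpha> \<theta>) = ennreal (\<Prod>j<n. 1 - (1 - \<alpha>) / (\<theta> + real j * \<alpha> + 1))"
proof (induction n arbitrary: \<theta>)
  case 0
  then show ?case by (simp add: rem_def prob_space.emeasure_space_1[OF prob_space_GEM_space, simplified])
next
  case (Suc n)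
  have \<theta>: "0 < \<theta> + \<alpha>" using Suc alpha by simp
  have "(\<integral>\<^sup>+W. ennreal (rem W (Suc n)) \<partial>GEM_space \<alpha> \<theta>) =
      (\<integral>\<^sup>+w. (\<integral>\<^sup>+W. ennreal ((1 - w) * rem W n) \<partial>GEM_space \<alpha> (\<theta> + \<alpha>)) \<partial>beta_law (1 - \<alpha>) (\<theta> + \<alpha>))"
    by (subst nn_integral_GEM_space[OF Suc.prems], measurable) (simp add: rem_case_nat)
  also have "\<dots> = (\<integral>\<^sup>+w. ennreal (1 - w) * (\<integral>\<^sup>+W. ennreal (rem W n) \<partial>GEM_space \<alpha> (\<theta> + \<alpha>)) \<partial>beta_law (1 - \<alpha>) (\<theta> + \<alpha>))"
  proof (rule nn_integral_cong_AE)
    show "AE w in beta_law (1 - \<alpha>) (\<theta> + \<alpha>). (\<integral>\<^sup>+W. ennreal ((1 - w) * rem W n) \<partial>GEM_space \<alpha> (\<theta> + \<alpha>)) =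
      ennreal (1 - w) * (\<integral>\<^sup>+W. ennreal (rem W n) \<partial>GEM_space \<alpha> (\<theta> + \<alpha>))"
      using AE_beta_law
      by eventually_elim (subst nn_integral_cmult[symmetric], measurable, simp add: ennreal_mult')
  qed
  also have "\<dots> = ennreal ((\<theta> + \<alpha>) / (1 - \<alpha> + (\<theta> + \<alpha>))) *
      ennreal (\<Prod>j<n. 1 - (1 - \<alpha>) / ((\<theta> + \<alpha>) + real j * \<alpha> + 1))"
    unfolding Suc.IH[OF \<theta>] using alpha \<theta>
    by (subst nn_integral_multc, measurable) (simp add: nn_integral_beta_law_complement)
  also have "\<dots> = ennreal (\<Prod>j<Suc n. 1 - (1 - \<alpha>) / (\<theta> + real j * \<alpha> + 1))"
  proof -
    have "(\<theta> + \<alpha>) / (1 - \<alpha> + (\<theta> + \<alpha>)) = 1 - (1 - \<alpha>) / (\<theta> + 1)" using Suc.prems by (simp add: field_simps)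
    moreover have "(\<Prod>j<n. 1 - (1 - \<alpha>) / ((\<theta> + \<alpha>) + real j * \<alpha> + 1)) = (\<Prod>j<n. 1 - (1 - \<alpha>) / (\<theta> + real (Suc j) * \<alpha> + 1))"
      by (simp add: algebra_simps)
    moreover have "0 \<le> 1 - (1 - \<alpha>) / (\<theta> + 1)" using Suc.prems alpha by (simp add: field_simps)
    ultimately show ?thesis
      by (subst prod.lessThan_Suc_shift) (simp add: ennreal_mult')
  qed
  finally show ?case .
qed

text \<open>The factors fall short of 1 by amounts of order 1/j, which are not summable; the product
  is compared with the exponential of a negative multiple of the harmonic numbers.\<close>

lemma rem_mean_tendsto_0:
  assumes "0 < \<theta>"
  shows "(\<lambda>n. \<Prod>j<n. 1 - (1 - \<alpha>) / (\<theta> + real j * \<alpha> + 1)) \<longlonglongrightarrow> 0"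
proof (rule tendsto_sandwich[OF _ _ tendsto_const])
  \<comment> \<open>This constant works because \<open>\<theta> + real j * \<alpha> + 1 \<le>
    (\<theta> + 1) * real (Suc j)\<close>.\<close>
  let ?d = "(1 - \<alpha>) / (\<theta> + 1)"
  have d: "0 < ?d" using alpha assms by simp
  have nn: "0 \<le> 1 - (1 - \<alpha>) / (\<theta> + real j * \<alpha> + 1)" for j
  proof -
    have "0 \<le> real j * \<alpha>" using alpha by simp
    then have "1 - \<alpha> \<le> \<theta> + real j * \<alpha> + 1" "0 < \<theta> + real j * \<alpha> + 1" using alpha assms by linarith+
    then show ?thesis by (simp add: divide_le_eq_1_pos)
  qed
  show "eventually (\<lambda>n. 0 \<le> (\<Prod>j<n. 1 - (1 - \<alpha>) / (\<theta> + real j * \<alpha> + 1))) sequentially"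
    using nn by (intro always_eventually allI prod_nonneg) auto
  have "(\<Prod>j<n. 1 - (1 - \<alpha>) / (\<theta> + real j * \<alpha> + 1)) \<le> exp (- (?d * harm n))" for n
  proof -
    have "(\<Prod>j<n. 1 - (1 - \<alpha>) / (\<theta> + real j * \<alpha> + 1)) \<le> (\<Prod>j<n. exp (- (?d * inverse (real (Suc j)))))"
    proof (rule prod_mono, intro conjI nn)
      fix j
      have a: "real j * \<alpha> \<le> real j" using alpha by (simp add: mult_left_le)
      have "\<theta> + real j * \<alpha> + 1 \<le> (\<theta> + 1) * real (Suc j)"
      proof -
        have "0 \<le> \<theta> * real j" using assms by simp
        moreover have "(\<theta> + 1) * real (Suc j) = \<theta> * real j + \<theta> + real j + 1" by (simp add: algebra_simps)
        ultimately show ?thesis using a by linarith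
      qed
      then have "?d * inverse (real (Suc j)) \<le> (1 - \<alpha>) / (\<theta> + real j * \<alpha> + 1)"
        using alpha assms by (simp add: divide_inverse[symmetric] divide_divide_eq_left)
          (intro divide_left_mono mult_pos_pos add_pos_nonneg; simp)
      then have "1 - (1 - \<alpha>) / (\<theta> + real j * \<alpha> + 1) \<le> 1 + (- (?d * inverse (real (Suc j))))" by simp
      also have "\<dots> \<le> exp (- (?d * inverse (real (Suc j))))" by (rule exp_ge_add_one_self)
      finally show "1 - (1 - \<alpha>) / (\<theta> + real j * \<alpha> + 1) \<le> exp (- (?d * inverse (real (Suc j))))" .
    qed
    also have "\<dots> = exp (- (?d * harm n))"
    proof -
      have "(\<Sum>j<n. inverse (real (Suc j))) = (\<Sum>k=1..n. inverse (real k))"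
        by (rule sum.reindex_bij_witness[of _ "\<lambda>k. k - 1" Suc]) auto
      then show ?thesis
        by (simp only: exp_sum[symmetric, OF finite_lessThan] sum_negf sum_distrib_left[symmetric] harm_def)
    qed
    finally show ?thesis .
  qed
  then show "eventually (\<lambda>n. (\<Prod>j<n. 1 - (1 - \<alpha>) / (\<theta> + real j * \<alpha> + 1)) \<le> exp (- (?d * harm n))) sequentially"
    by (intro always_eventually allI)
  show "(\<lambda>n. exp (- (?d * harm n))) \<longlonglongrightarrow> 0"
    by (rule filterlim_compose[OF exp_at_bot]) (rule filterlim_compose[OF filterlim_uminus_at_bot_at_top],
      rule filterlim_tendsto_pos_mult_at_top[OF tendsto_const d harm_at_top])
qed

text \<open>The infimum over \<open>n\<close> has mean zero by \<open>rem_mean_tendsto_0\<close>, so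
  it vanishes almost surely; as \<open>rem\<close> decreases along almost every path, it tends to
  \<open>0\<close>.\<close>

lemma AE_rem_tendsto_0:
  assumes \<theta>: "0 < \<theta>"
  shows "AE W in GEM_space \<alpha> \<theta>. \<forall>q>0. \<exists>n. \<forall>m\<ge>n. rem W m < q"
proof -
  have "(\<integral>\<^sup>+W. (INF n. ennreal (rem W n)) \<partial>GEM_space \<alpha> \<theta>) \<le> ennreal (\<Prod>j<n. 1 - (1 - \<alpha>) / (\<theta> + real j * \<alpha> + 1))" for n
    unfolding nn_integral_rem[OF \<theta>, symmetric] by (intro nn_integral_mono INF_lower) simp
  then have "(\<integral>\<^sup>+W. (INF n. ennreal (rem W n)) \<partial>GEM_space \<alpha> \<theta>) \<le> ennreal 0"
    by (intro LIMSEQ_le_const[OF tendsto_ennrealI[OF rem_mean_tendsto_0[OF \<theta>]]]) auto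
  then have "(\<integral>\<^sup>+W. (INF n. ennreal (rem W n)) \<partial>GEM_space \<alpha> \<theta>) = 0" by simp
  then have "AE W in GEM_space \<alpha> \<theta>. (INF n. ennreal (rem W n)) = 0"
    by (subst (asm) nn_integral_0_iff_AE) auto
  then show ?thesis using AE_GEM_space[OF \<theta>]
  proof eventually_elim
    case (elim W)
    have dec: "rem W m \<le> rem W n" if "n \<le> m" for n m
      using that
    proof (induction rule: dec_induct)
      case (step k)
      have "0 \<le> rem W k" unfolding rem_def using elim(2) by (intro prod_nonneg) (auto simp: less_imp_le)
      then have "rem W (Suc k) \<le> rem W k" using elim(2)[rule_format, of k] by (simp add: rem_def mult_left_le)
      then show ?case using step by simp
    qed simp
    show ?case
    proof (intro allI impI)
      fix q :: real assume q: "0 < q"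
      then have "(INF n. ennreal (rem W n)) < ennreal q" using elim(1) by simp
      then obtain n where "ennreal (rem W n) < ennreal q" by (auto simp: INF_less_iff)
      then have "rem W n < q" using ennreal_leI[of q "rem W n"] by (meson not_le)
      then show "\<exists>n. \<forall>m\<ge>n. rem W m < q" using dec by (meson le_less_trans)
    qed
  qed
qed

section \<open>The Poisson--Dirichlet law as a tilted law of normalised jumps\<close>

text \<open>\<open>T\<close> is at least the largest jump, and a negative power of that jump is a
  positive power of the exponential variable \<open>E 0\<close>, which has all moments.\<close>

lemma moment_finite:
  assumes "0 < \<theta>"
  shows "(\<integral>\<^sup>+E. ennreal (T E powr (- \<theta>)) \<partial>exp_space) < \<infinity>" "0 < (\<integral>\<^sup>+E. ennreal (T E powr (- \<theta>)) \<partial>exp_space)"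
proof -
  let ?c = "Gamma (1 - \<alpha>)" and ?p = "\<theta> / \<alpha>"
  have p: "0 < ?p" using assms alpha by simp
  have "(\<integral>\<^sup>+E. ennreal (T E powr (- \<theta>)) \<partial>exp_space) \<le> (\<integral>\<^sup>+E. ennreal ((?c * E 0) powr ?p) \<partial>exp_space)"
  proof (rule nn_integral_mono_AE)
    show "AE E in exp_space. ennreal (T E powr (- \<theta>)) \<le> ennreal ((?c * E 0) powr ?p)"
      using AE_good
    proof eventually_elim
      case (elim E)
      have E0: "0 < E 0" using elim by (simp add: good_def)
      have "sum (J E) {0} \<le> T E"
        unfolding stable_T_def by (intro sum_le_suminf good_summable elim) (auto simp: stable_jump_eq)
      then have le: "J E 0 \<le> T E" by simp
      have "T E powr (- \<theta>) \<le> J E 0 powr (- \<theta>)"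
        using le good_jump_pos[OF elim] assms by (intro powr_mono2') auto
      also have "\<dots> = (?c * E 0) powr ?p"
        by (simp add: stable_jump_eq jump_def powr_powr)
      finally show ?case by (rule ennreal_leI)
    qed
  qed
  also have "\<dots> = (\<integral>\<^sup>+x. ennreal (?c powr ?p) * (ennreal (x powr ((?p + 1) - 1) * exp (- (1 * x))) * indicator {0<..} x) \<partial>lborel)"
  proof -
    have "(\<integral>\<^sup>+E. ennreal ((?c * E 0) powr ?p) \<partial>exp_space) = (\<integral>\<^sup>+e. ennreal ((?c * e) powr ?p) \<partial>expo)"
      by (subst nn_integral_exp_space, measurable) (simp add: es.emeasure_space_1[simplified])
    also have "\<dots> = (\<integral>\<^sup>+x. ennreal (exp (- x)) * ennreal ((?c * x) powr ?p) * indicator {0..} x \<partial>lborel)"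
      by (rule nn_integral_expo) measurable
    also have "\<dots> = (\<integral>\<^sup>+x. ennreal (?c powr ?p) * (ennreal (x powr ((?p + 1) - 1) * exp (- (1 * x))) * indicator {0<..} x) \<partial>lborel)"
    proof (rule nn_integral_cong)
      fix x :: real
      show "ennreal (exp (- x)) * ennreal ((?c * x) powr ?p) * indicator {0..} x =
        ennreal (?c powr ?p) * (ennreal (x powr ((?p + 1) - 1) * exp (- (1 * x))) * indicator {0<..} x)"
        using Gamma_pos p by (cases "0 < x") (auto simp: indicator_def powr_mult ennreal_mult'[symmetric] mult_ac)
    qed
    finally show ?thesis .
  qed
  also have "\<dots> = ennreal (?c powr ?p) * ennreal (Gamma (?p + 1) * 1 powr (- (?p + 1)))"
    using p by (subst nn_integral_cmult, measurable) (subst nn_integral_Gamma, auto)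
  also have "\<dots> < \<infinity>" by (simp add: ennreal_mult_less_top)
  finally show "(\<integral>\<^sup>+E. ennreal (T E powr (- \<theta>)) \<partial>exp_space) < \<infinity>" .
  show "0 < (\<integral>\<^sup>+E. ennreal (T E powr (- \<theta>)) \<partial>exp_space)"
  proof (rule ccontr)
    assume "\<not> 0 < (\<integral>\<^sup>+E. ennreal (T E powr (- \<theta>)) \<partial>exp_space)"
    then have "AE E in exp_space. ennreal (T E powr (- \<theta>)) = 0"
      by (subst (asm) not_gr_zero, subst (asm) nn_integral_0_iff_AE) auto
    with AE_good have "AE E in exp_space. False"
      by eventually_elim (auto dest: good_T_pos)
    then show False by simp
  qed
qed

definition moment :: "real \<Rightarrow> real" where
  "moment \<theta> = enn2real (\<integral>\<^sup>+E. ennreal (T E powr (- \<theta>)) \<partial>exp_space)"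

lemma moment: "0 < \<theta> \<Longrightarrow> (\<integral>\<^sup>+E. ennreal (T E powr (- \<theta>)) \<partial>exp_space) = ennreal (moment \<theta>)"
  unfolding moment_def using moment_finite(1)[of \<theta>] by simp

lemma moment_pos: "0 < \<theta> \<Longrightarrow> 0 < moment \<theta>"
  unfolding moment_def using moment_finite[of \<theta>] by (simp add: enn2real_positive_iff)

definition tilted :: "real \<Rightarrow> (nat \<Rightarrow> real) measure" where
  "tilted \<theta> = density exp_space (\<lambda>E. ennreal (T E powr (- \<theta>) / moment \<theta>))"

lemma sets_tilted [simp, measurable_cong]: "sets (tilted \<theta>) = sets seqM"
  and space_tilted [simp]: "space (tilted \<theta>) = UNIV"
  by (simp_all add: tilted_def)

lemma nn_integral_tilted:
  assumes \<theta>: "0 < \<theta>" and [measurable]: "F \<in> borel_measurable seqM"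
  shows "ennreal (moment \<theta>) * (\<integral>\<^sup>+E. F E \<partial>tilted \<theta>) = (\<integral>\<^sup>+E. ennreal (T E powr (- \<theta>)) * F E \<partial>exp_space)"
proof -
  have "ennreal (moment \<theta>) * ennreal (T E powr (- \<theta>) / moment \<theta>) = ennreal (T E powr (- \<theta>))" for E
    using moment_pos[OF \<theta>] by (simp add: ennreal_mult'[symmetric])
  then show ?thesis unfolding tilted_def
    by (subst nn_integral_density, (measurable)[2], subst nn_integral_cmult[symmetric], measurable)
      (simp add: mult.assoc[symmetric])
qed

lemma prob_space_tilted:
  assumes "0 < \<theta>" shows "prob_space (tilted \<theta>)"
proof (rule prob_spaceI)
  have "ennreal (moment \<theta>) * emeasure (tilted \<theta>) UNIV = ennreal (moment \<theta>) * 1"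
    using nn_integral_tilted[OF assms, of "\<lambda>_. 1"] moment[OF assms] by simp
  then show "emeasure (tilted \<theta>) (space (tilted \<theta>)) = 1"
    using moment_pos[OF assms] by (subst (asm) ennreal_mult_cancel_left) auto
qed

lemma AE_tilted_good: "AE E in tilted \<theta>. good \<alpha> E"
  unfolding tilted_def by (subst AE_density) (use AE_good in \<open>auto elim: eventually_mono\<close>)

lemma normalised_jumps:
  assumes "good \<alpha> E"
  shows "0 < x \<Longrightarrow> finite {i. x \<le> J E i / T E}" "0 \<le> J E i / T E" "J E i / T E \<le> 1"
    "rank (\<lambda>i. J E i / T E) = (\<lambda>i. J E i / T E)"
proof -
  note T = good_T_pos[OF assms] and Jp = good_jump_pos[OF assms]
  show "0 < x \<Longrightarrow> finite {i. x \<le> J E i / T E}"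
    using finite_superlevel_scaled_jumps[OF assms, of x "1 / T E"] by simp
  show "0 \<le> J E i / T E" using T Jp[of i] by simp
  have "sum (J E) {i} \<le> T E"
    unfolding stable_T_def by (intro sum_le_suminf good_summable assms) (use Jp in \<open>auto simp: less_imp_le\<close>)
  then show "J E i / T E \<le> 1" using T by simp
  show "rank (\<lambda>i. J E i / T E) = (\<lambda>i. J E i / T E)"
    using rank_scaled_jumps[OF assms, of "1 / T E"] T by simp
qed

text \<open>Mecke's equation and the substitution \<open>w = x / (x + T E)\<close>: a size-biased fraction is Beta
  distributed, and the rest is the same sequence with the tilting exponent raised by \<open>\<alpha>\<close>.\<close>
lemma tilted_mecke:
  assumes \<theta>: "0 < \<theta>" and [measurable]: "F \<in> borel_measurable seqM"
  defines "\<kappa> \<equiv> \<alpha> * Gamma (\<theta> + \<alpha>) / Gamma (1 + \<theta>)"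
  shows "(\<integral>\<^sup>+E. ennreal (T E powr (- \<theta>)) * F (\<lambda>i. J E i / T E) \<partial>exp_space) =
    ennreal \<kappa> * (\<integral>\<^sup>+w. (\<integral>\<^sup>+E. ennreal (T E powr (- (\<theta> + \<alpha>))) * F (rank (case_nat w (\<lambda>i. (1 - w) * (J E i / T E)))) \<partial>exp_space) \<partial>beta_law (1 - \<alpha>) (\<theta> + \<alpha>))"
proof -
  let ?B = "beta_law (1 - \<alpha>) (\<theta> + \<alpha>)"
  interpret B: prob_space ?B using \<theta> alpha by (intro prob_space_beta_law) auto
  interpret BE: pair_sigma_finite ?B exp_space ..
  have G: "0 < Gamma (\<theta> + \<alpha>)" "0 < Gamma (1 + \<theta>)" using \<theta> alpha by (auto intro: Gamma_real_pos)
  \<comment> \<open>With total \<open>x + T E\<close>, the weight is the share of the chosen jump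
    times the total to the power \<open>- \<theta>\<close>. Summed over all jumps the shares give 1,
    so the left side is recovered.\<close>
  define g where "g p = ennreal (fst p * (fst p + T (snd p)) powr (- \<theta> - 1)) *
    F (rank (case_nat (fst p / (fst p + T (snd p))) (\<lambda>j. J (snd p) j / (fst p + T (snd p)))))" for p
  have [measurable]: "g \<in> borel_measurable (borel \<Otimes>\<^sub>M seqM)" unfolding g_def by measurable
  have "(\<integral>\<^sup>+E. ennreal (T E powr (- \<theta>)) * F (\<lambda>i. J E i / T E) \<partial>exp_space) =
     (\<integral>\<^sup>+E. (\<Sum>i. g (J E i, merge_gap i E)) \<partial>exp_space)"
  proof (rule nn_integral_cong_AE)
    show "AE E in exp_space. ennreal (T E powr (- \<theta>)) * F (\<lambda>i. J E i / T E) = (\<Sum>i. g (J E i, merge_gap i E))"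
      using AE_good
    proof eventually_elim
      case (elim E)
      note T = good_T_pos[OF elim] and Jp = good_jump_pos[OF elim]
      have "g (J E i, merge_gap i E) = ennreal (J E i * T E powr (- \<theta> - 1)) * F (\<lambda>i. J E i / T E)" for i
      proof -
        have "(\<lambda>j. J (merge_gap i E) j / T E) = (\<lambda>j. if j < i then J E j / T E else J E (Suc j) / T E)"
          by (auto simp: stable_jump_merge_gap)
        then show ?thesis
          unfolding g_def
          using rank_case_nat_skip[of "\<lambda>j. J E j / T E" i] normalised_jumps(4)[OF elim]
          by (simp add: good_merge_gap(1)[OF elim, of i, symmetric])
      qed
      then have "(\<Sum>i. g (J E i, merge_gap i E)) = (\<Sum>i. ennreal (J E i * T E powr (- \<theta> - 1))) * F (\<lambda>i. J E i / T E)"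
        by simp
      also have "(\<Sum>i. ennreal (J E i * T E powr (- \<theta> - 1))) = ennreal (\<Sum>i. J E i * T E powr (- \<theta> - 1))"
        by (intro suminf_ennreal2 summable_mult2 good_summable elim) (use Jp in \<open>auto simp: less_imp_le\<close>)
      also have "(\<Sum>i. J E i * T E powr (- \<theta> - 1)) = T E * T E powr (- \<theta> - 1)"
        unfolding stable_T_def by (rule suminf_mult2[OF good_summable[OF elim], symmetric])
      also have "\<dots> = T E powr (- \<theta>)" using T by (simp add: powr_diff)
      finally show ?case by simp
    qed
  qed
  also have "\<dots> = (\<integral>\<^sup>+x. (\<integral>\<^sup>+E. g (x, E) \<partial>exp_space) \<partial>levy \<alpha>)" by (rule mecke_jump) measurable
  also have "\<dots> = (\<integral>\<^sup>+E. (\<integral>\<^sup>+x. g (x, E) \<partial>levy \<alpha>) \<partial>exp_space)"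
    by (rule lev_es.Fubini'[symmetric]) measurable
  also have "\<dots> = (\<integral>\<^sup>+E. (\<integral>\<^sup>+w. ennreal \<kappa> * (ennreal (T E powr (- (\<theta> + \<alpha>))) * F (rank (case_nat w (\<lambda>i. (1 - w) * (J E i / T E))))) \<partial>?B) \<partial>exp_space)"
  proof (rule nn_integral_cong_AE)
    show "AE E in exp_space. (\<integral>\<^sup>+x. g (x, E) \<partial>levy \<alpha>) =
      (\<integral>\<^sup>+w. ennreal \<kappa> * (ennreal (T E powr (- (\<theta> + \<alpha>))) * F (rank (case_nat w (\<lambda>i. (1 - w) * (J E i / T E))))) \<partial>?B)"
      using AE_good
    proof eventually_elim
      case (elim E)
      define t where "t = T E"
      have t: "0 < t" using good_T_pos[OF elim] by (simp add: t_def)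
      have gE[measurable]: "(\<lambda>x. g (x, E)) \<in> borel_measurable borel" by measurable
      have "(\<integral>\<^sup>+x. g (x, E) \<partial>levy \<alpha>) = (\<integral>\<^sup>+x. (g (x, E) * ennreal (levy_density \<alpha> x)) * indicator {0<..} x \<partial>lborel)"
        by (rule nn_integral_levy) measurable
      also have "\<dots> = (\<integral>\<^sup>+w. (g (t * w / (1 - w), E) * ennreal (levy_density \<alpha> (t * w / (1 - w)))) *
          ennreal (t / (1 - w)\<^sup>2) * indicator {0<..<1} w \<partial>lborel)"
        by (rule nn_integral_ratio_substitution) (use t in measurable)
      also have "\<dots> = (\<integral>\<^sup>+w. ennreal (beta_density (1 - \<alpha>) (\<theta> + \<alpha>) w) *
          (ennreal \<kappa> * (ennreal (t powr (- (\<theta> + \<alpha>))) * F (rank (case_nat w (\<lambda>i. (1 - w) * (J E i / t)))))) \<partial>lborel)"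
      proof (rule nn_integral_cong)
        fix w :: real
        show "(g (t * w / (1 - w), E) * ennreal (levy_density \<alpha> (t * w / (1 - w)))) * ennreal (t / (1 - w)\<^sup>2) * indicator {0<..<1} w =
          ennreal (beta_density (1 - \<alpha>) (\<theta> + \<alpha>) w) *
          (ennreal \<kappa> * (ennreal (t powr (- (\<theta> + \<alpha>))) * F (rank (case_nat w (\<lambda>i. (1 - w) * (J E i / t))))))"
        proof (cases "0 < w \<and> w < 1")
          case True
          define x where "x = t * w / (1 - w)"
          have x: "0 < x" using True t by (simp add: x_def)
          have xt: "x + t = t / (1 - w)" using True by (simp add: x_def field_simps)
          have r1: "x / (x + t) = w" unfolding xt using True t by (simp add: x_def)
          have r2: "J E j / (x + t) = (1 - w) * (J E j / t)" for j unfolding xt by simp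
          have gx: "g (x, E) = ennreal (x * (x + t) powr (- \<theta> - 1)) * F (rank (case_nat w (\<lambda>i. (1 - w) * (J E i / t))))"
            by (simp add: g_def t_def r1[unfolded t_def] r2[unfolded t_def])
          have "x * (x + t) powr (- \<theta> - 1) * levy_density \<alpha> x * (t / (1 - w)\<^sup>2) =
              beta_density (1 - \<alpha>) (\<theta> + \<alpha>) w * \<kappa> * t powr (- (\<theta> + \<alpha>))"
          proof -
            have e1: "x powr (- \<alpha>) = t powr (- \<alpha>) * w powr (- \<alpha>) * (1 - w) powr \<alpha>"
              unfolding x_def using True t by (simp add: powr_mult powr_divide powr_minus field_simps)
            have e2: "(x + t) powr (- \<theta> - 1) = t powr (- \<theta> - 1) * (1 - w) powr (\<theta> + 1)"
            proof -
              have "(x + t) powr (- \<theta> - 1) = t powr (- \<theta> - 1) / (1 - w) powr (- (\<theta> + 1))"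
                unfolding xt using True t by (simp add: powr_divide)
              then show ?thesis by (simp only: powr_minus[of "1 - w"] divide_inverse inverse_inverse_eq)
            qed
            have e3: "t / (1 - w)\<^sup>2 = t powr 1 * (1 - w) powr (- 2)"
              using True t by (simp add: powr_minus powr_numeral field_simps)
            have "x * (x + t) powr (- \<theta> - 1) * levy_density \<alpha> x * (t / (1 - w)\<^sup>2) =
                \<alpha> / Gamma (1 - \<alpha>) * (x powr (- \<alpha>) * (x + t) powr (- \<theta> - 1) * (t / (1 - w)\<^sup>2))"
              using x by (simp add: levy_density_def powr_diff[of x "- \<alpha>" 1])
            also have "\<dots> = \<alpha> / Gamma (1 - \<alpha>) * (w powr (- \<alpha>) * ((1 - w) powr \<alpha> * (1 - w) powr (\<theta> + 1) * (1 - w) powr (- 2)) * (t powr (- \<alpha>) * t powr (- \<theta> - 1) * t powr 1))"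
              unfolding e1 e2 e3 by (simp only: mult_ac)
            also have "\<dots> = \<alpha> / Gamma (1 - \<alpha>) * (w powr (- \<alpha>) * (1 - w) powr (\<theta> + \<alpha> - 1) * t powr (- (\<theta> + \<alpha>)))"
              by (simp only: powr_add[symmetric]) (simp add: algebra_simps)
            \<comment> \<open>\<kappa> is \<open>\<alpha> / Gamma (1 - \<alpha>)\<close> times the
              Beta function at \<open>1 - \<alpha>\<close> and \<open>\<theta> + \<alpha>\<close>,
              the normaliser of the Beta density.\<close>
            also have "\<dots> = beta_density (1 - \<alpha>) (\<theta> + \<alpha>) w * \<kappa> * t powr (- (\<theta> + \<alpha>))"
              using True G unfolding \<kappa>_def by (simp add: beta_density_def field_simps)
            finally show ?thesis .
          qed
          then have ae: "ennreal (x * (x + t) powr (- \<theta> - 1)) * ennreal (levy_density \<alpha> x) * ennreal (t / (1 - w)\<^sup>2) =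
              ennreal (beta_density (1 - \<alpha>) (\<theta> + \<alpha>) w) * ennreal \<kappa> * ennreal (t powr (- (\<theta> + \<alpha>)))"
            using x t G alpha levy_density_nonneg[of x]
            by (simp add: ennreal_mult'[symmetric] ennreal_mult''[symmetric] \<kappa>_def)
          let ?F = "F (rank (case_nat w (\<lambda>i. (1 - w) * (J E i / t))))"
          have "g (x, E) * ennreal (levy_density \<alpha> x) * ennreal (t / (1 - w)\<^sup>2) =
              (ennreal (x * (x + t) powr (- \<theta> - 1)) * ennreal (levy_density \<alpha> x) * ennreal (t / (1 - w)\<^sup>2)) * ?F"
            unfolding gx by (simp only: mult_ac)
          also have "\<dots> = ennreal (beta_density (1 - \<alpha>) (\<theta> + \<alpha>) w) * (ennreal \<kappa> * (ennreal (t powr (- (\<theta> + \<alpha>))) * ?F))"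
            unfolding ae by (simp only: mult.assoc)
          finally have "g (x, E) * ennreal (levy_density \<alpha> x) * ennreal (t / (1 - w)\<^sup>2) =
              ennreal (beta_density (1 - \<alpha>) (\<theta> + \<alpha>) w) * (ennreal \<kappa> * (ennreal (t powr (- (\<theta> + \<alpha>))) * ?F))" .
          moreover have "indicator {0<..<1} w = (1 :: ennreal)" using True by simp
          ultimately show ?thesis unfolding x_def[symmetric] by (simp only: mult_1_right)
        qed (auto simp: beta_density_def)
      qed
      also have "\<dots> = (\<integral>\<^sup>+w. ennreal \<kappa> * (ennreal (t powr (- (\<theta> + \<alpha>))) * F (rank (case_nat w (\<lambda>i. (1 - w) * (J E i / t))))) \<partial>?B)"
        by (rule nn_integral_beta_law[symmetric]) measurable
      finally show ?case unfolding t_def .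
    qed
  qed
  also have "\<dots> = (\<integral>\<^sup>+w. (\<integral>\<^sup>+E. ennreal \<kappa> * (ennreal (T E powr (- (\<theta> + \<alpha>))) * F (rank (case_nat w (\<lambda>i. (1 - w) * (J E i / T E))))) \<partial>exp_space) \<partial>?B)"
    by (rule BE.Fubini') measurable
  also have "\<dots> = ennreal \<kappa> * (\<integral>\<^sup>+w. (\<integral>\<^sup>+E. ennreal (T E powr (- (\<theta> + \<alpha>))) * F (rank (case_nat w (\<lambda>i. (1 - w) * (J E i / T E)))) \<partial>exp_space) \<partial>?B)"
    by (subst nn_integral_cmult[symmetric], measurable, rule nn_integral_cong, rule nn_integral_cmult) measurable
  finally show ?thesis .
qed

text \<open>The case of constant \<open>F\<close> in \<open>tilted_mecke\<close> reads
  \<open>moment \<theta> = \<kappa> * moment (\<theta> + \<alpha>)\<close>. Dividing by it removes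
  \<kappa> and leaves an identity between probability laws.\<close>

lemma tilted_step:
  assumes \<theta>: "0 < \<theta>" and [measurable]: "F \<in> borel_measurable seqM"
  shows "(\<integral>\<^sup>+E. F (\<lambda>i. J E i / T E) \<partial>tilted \<theta>) =
    (\<integral>\<^sup>+w. (\<integral>\<^sup>+E. F (rank (case_nat w (\<lambda>i. (1 - w) * (J E i / T E)))) \<partial>tilted (\<theta> + \<alpha>)) \<partial>beta_law (1 - \<alpha>) (\<theta> + \<alpha>))"
proof -
  let ?B = "beta_law (1 - \<alpha>) (\<theta> + \<alpha>)"
  interpret B: prob_space ?B using \<theta> alpha by (intro prob_space_beta_law) auto
  have \<theta>': "0 < \<theta> + \<alpha>" using \<theta> alpha by simp
  interpret tl: prob_space "tilted (\<theta> + \<alpha>)" by (rule prob_space_tilted[OF \<theta>'])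
  define \<kappa> where "\<kappa> = \<alpha> * Gamma (\<theta> + \<alpha>) / Gamma (1 + \<theta>)"
  have m: "ennreal (moment \<theta>) = ennreal \<kappa> * ennreal (moment (\<theta> + \<alpha>))"
    using tilted_mecke[OF \<theta>, of "\<lambda>_. 1"] moment[OF \<theta>] moment[OF \<theta>']
    by (simp add: \<kappa>_def B.emeasure_space_1[simplified])
  have "ennreal (moment \<theta>) * (\<integral>\<^sup>+E. F (\<lambda>i. J E i / T E) \<partial>tilted \<theta>) =
    ennreal \<kappa> * (\<integral>\<^sup>+w. ennreal (moment (\<theta> + \<alpha>)) * (\<integral>\<^sup>+E. F (rank (case_nat w (\<lambda>i. (1 - w) * (J E i / T E)))) \<partial>tilted (\<theta> + \<alpha>)) \<partial>?B)"
    unfolding \<kappa>_def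
    by (subst nn_integral_tilted[OF \<theta>], measurable, subst tilted_mecke[OF \<theta>], measurable,
        subst nn_integral_tilted[OF \<theta>'], measurable)
  also have "\<dots> = ennreal (moment \<theta>) * (\<integral>\<^sup>+w. (\<integral>\<^sup>+E. F (rank (case_nat w (\<lambda>i. (1 - w) * (J E i / T E)))) \<partial>tilted (\<theta> + \<alpha>)) \<partial>?B)"
    unfolding m by (subst nn_integral_cmult) (measurable, simp add: mult.assoc)
  finally show ?thesis using moment_pos[OF \<theta>] by (subst (asm) ennreal_mult_cancel_left) auto
qed

text \<open>Each step breaks off one stick and raises \<theta> by \<alpha>, in accordance with the
  successive Beta parameters of \<open>GEM_space\<close>; the jumps that still divide the residual
  mass keep the tilt \<open>\<theta> + real n * \<alpha>\<close>.\<close>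

lemma tilted_iterate:
  assumes "0 < \<theta>" "F \<in> borel_measurable seqM"
  shows "(\<integral>\<^sup>+E. F (\<lambda>i. J E i / T E) \<partial>tilted \<theta>) =
    (\<integral>\<^sup>+W. (\<integral>\<^sup>+E. F (rank (partial_stick n W (\<lambda>i. J E i / T E))) \<partial>tilted (\<theta> + real n * \<alpha>)) \<partial>GEM_space \<alpha> \<theta>)"
  using assms
proof (induction n arbitrary: \<theta> F)
  case 0
  note [measurable] = 0(2)
  have "(\<integral>\<^sup>+E. F (\<lambda>i. J E i / T E) \<partial>tilted \<theta>) = (\<integral>\<^sup>+E. F (rank (\<lambda>i. J E i / T E)) \<partial>tilted \<theta>)"
    using AE_tilted_good[of \<theta>] by (intro nn_integral_cong_AE) (auto elim!: eventually_mono simp: normalised_jumps(4))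
  then show ?case
    by (simp add: partial_stick_0 prob_space.emeasure_space_1[OF prob_space_GEM_space[OF 0(1)], simplified])
next
  case (Suc n)
  note [measurable] = Suc.prems(2)
  have \<theta>: "0 < \<theta>" "0 < \<theta> + \<alpha>" "0 < \<theta> + real (Suc n) * \<alpha>"
    using Suc.prems(1) alpha by (auto intro: add_pos_nonneg)
  interpret tl: prob_space "tilted (\<theta> + real (Suc n) * \<alpha>)" by (rule prob_space_tilted[OF \<theta>(3)])
  have shift: "\<theta> + \<alpha> + real n * \<alpha> = \<theta> + real (Suc n) * \<alpha>" by (simp add: algebra_simps)
  have "(\<integral>\<^sup>+E. F (\<lambda>i. J E i / T E) \<partial>tilted \<theta>) =
    (\<integral>\<^sup>+w. (\<integral>\<^sup>+E. F (rank (case_nat w (\<lambda>i. (1 - w) * (J E i / T E)))) \<partial>tilted (\<theta> + \<alpha>)) \<partial>beta_law (1 - \<alpha>) (\<theta> + \<alpha>))"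
    by (rule tilted_step[OF \<theta>(1)]) measurable
  also have "\<dots> = (\<integral>\<^sup>+w. (\<integral>\<^sup>+W. (\<integral>\<^sup>+E. F (rank (case_nat w (\<lambda>i. (1 - w) * rank (partial_stick n W (\<lambda>i. J E i / T E)) i)))
      \<partial>tilted (\<theta> + real (Suc n) * \<alpha>)) \<partial>GEM_space \<alpha> (\<theta> + \<alpha>)) \<partial>beta_law (1 - \<alpha>) (\<theta> + \<alpha>))"
    unfolding shift[symmetric]
    by (rule nn_integral_cong, rule Suc.IH[OF \<theta>(2), of "\<lambda>s. F (rank (case_nat w (\<lambda>i. (1 - w) * s i)))" for w]) measurable
  also have "\<dots> = (\<integral>\<^sup>+w. (\<integral>\<^sup>+W. (\<integral>\<^sup>+E. F (rank (partial_stick (Suc n) (case_nat w W) (\<lambda>i. J E i / T E)))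
      \<partial>tilted (\<theta> + real (Suc n) * \<alpha>)) \<partial>GEM_space \<alpha> (\<theta> + \<alpha>)) \<partial>beta_law (1 - \<alpha>) (\<theta> + \<alpha>))"
  proof (rule nn_integral_cong_AE, rule AE_mp[OF AE_beta_law], rule AE_I2, rule impI, rule nn_integral_cong)
    fix w :: real and W :: "nat \<Rightarrow> real" assume w: "0 < w \<and> w < 1"
    show "(\<integral>\<^sup>+E. F (rank (case_nat w (\<lambda>i. (1 - w) * rank (partial_stick n W (\<lambda>i. J E i / T E)) i))) \<partial>tilted (\<theta> + real (Suc n) * \<alpha>)) =
      (\<integral>\<^sup>+E. F (rank (partial_stick (Suc n) (case_nat w W) (\<lambda>i. J E i / T E))) \<partial>tilted (\<theta> + real (Suc n) * \<alpha>))"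
    proof (rule nn_integral_cong_AE)
      show "AE E in tilted (\<theta> + real (Suc n) * \<alpha>).
        F (rank (case_nat w (\<lambda>i. (1 - w) * rank (partial_stick n W (\<lambda>i. J E i / T E)) i))) =
        F (rank (partial_stick (Suc n) (case_nat w W) (\<lambda>i. J E i / T E)))"
        using AE_tilted_good
      proof eventually_elim
        case (elim E)
        show ?case unfolding partial_stick_Suc
          using w normalised_jumps[OF elim]
          by (subst rank_case_nat_rank) (auto intro!: finite_superlevel_partial_stick)
      qed
    qed
  qed
  also have "\<dots> = (\<integral>\<^sup>+W. (\<integral>\<^sup>+E. F (rank (partial_stick (Suc n) W (\<lambda>i. J E i / T E)))
      \<partial>tilted (\<theta> + real (Suc n) * \<alpha>)) \<partial>GEM_space \<alpha> \<theta>)"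
    by (rule nn_integral_GEM_space[OF \<theta>(1), symmetric]) measurable
  finally show ?case .
qed

text \<open>The left side of \<open>tilted_iterate\<close> does not depend on \<open>n\<close>, so
  \<open>n\<close> may tend to infinity. A generating event involves finitely many thresholds, the
  non-positive ones being void. Once the residual mass is below all positive ones, the jumps inside
  it have no influence and the integrand equals its limit exactly; dominated convergence
  concludes.\<close>

lemma PD_eq_tilted:
  assumes \<theta>: "0 < \<theta>"
  shows "PD \<alpha> \<theta> = distr (tilted \<theta>) seqM (\<lambda>E i. J E i / T E)"
proof (rule measure_eqI_seqM[symmetric])
  interpret tl: prob_space "tilted \<theta>" by (rule prob_space_tilted[OF \<theta>])
  interpret G: prob_space "GEM_space \<alpha> \<theta>" by (rule prob_space_GEM_space[OF \<theta>])
  have X[measurable]: "(\<lambda>E i. J E i / T E) \<in> measurable (tilted \<theta>) seqM" by measurable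
  have R[measurable]: "(\<lambda>W. rank (stick W)) \<in> measurable (GEM_space \<alpha> \<theta>) seqM" by measurable
  show "finite_measure (distr (tilted \<theta>) seqM (\<lambda>E i. J E i / T E))"
    by (intro prob_space.finite_measure tl.prob_space_distr X)
  fix L :: "(nat \<times> real) list"
  let ?A = "{s. \<forall>(k, q)\<in>set L. q \<le> s k} :: (nat \<Rightarrow> real) set"
  have A[measurable]: "?A \<in> sets seqM"
  proof -
    have "{s \<in> space seqM. \<forall>p\<in>set L. snd p \<le> s (fst p)} \<in> sets seqM" by measurable
    then show ?thesis by (simp add: case_prod_beta)
  qed
  define F where "F s = (of_bool (s \<in> ?A) :: ennreal)" for s
  have F[measurable]: "F \<in> borel_measurable seqM"
    using borel_measurable_indicator[OF A] by (simp add: F_def[abs_def] indicator_def[abs_def])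
  define \<phi> where "\<phi> n W = (\<integral>\<^sup>+E. F (rank (partial_stick n W (\<lambda>i. J E i / T E))) \<partial>tilted (\<theta> + real n * \<alpha>))" for n W
  have pn: "prob_space (tilted (\<theta> + real n * \<alpha>))" for n
    using \<theta> alpha by (intro prob_space_tilted add_pos_nonneg) auto
  have [measurable]: "\<phi> n \<in> borel_measurable (GEM_space \<alpha> \<theta>)" for n
  proof -
    interpret prob_space "tilted (\<theta> + real n * \<alpha>)" by (rule pn)
    show ?thesis unfolding \<phi>_def by measurable
  qed
  have const: "emeasure (distr (tilted \<theta>) seqM (\<lambda>E i. J E i / T E)) ?A = (\<integral>\<^sup>+W. \<phi> n W \<partial>GEM_space \<alpha> \<theta>)" for n
    unfolding emeasure_distr_of_bool[OF X A] \<phi>_def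
    using tilted_iterate[OF \<theta> F, of n] by (simp add: F_def)
  have "(\<lambda>n. \<integral>\<^sup>+W. \<phi> n W \<partial>GEM_space \<alpha> \<theta>) \<longlonglongrightarrow> (\<integral>\<^sup>+W. F (rank (stick W)) \<partial>GEM_space \<alpha> \<theta>)"
  proof (rule nn_integral_dominated_convergence[where w = "\<lambda>_. 1"])
    show "AE W in GEM_space \<alpha> \<theta>. \<phi> n W \<le> 1" for n
    proof (rule AE_I2)
      fix W
      have "\<phi> n W \<le> (\<integral>\<^sup>+E. 1 \<partial>tilted (\<theta> + real n * \<alpha>))"
        unfolding \<phi>_def by (intro nn_integral_mono) (simp add: F_def)
      then show "\<phi> n W \<le> 1" using prob_space.emeasure_space_1[OF pn[of n]] by simp
    qed
    show "(\<integral>\<^sup>+W. 1 \<partial>GEM_space \<alpha> \<theta>) < \<infinity>" using G.emeasure_space_1 by simp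
    show "AE W in GEM_space \<alpha> \<theta>. (\<lambda>n. \<phi> n W) \<longlonglongrightarrow> F (rank (stick W))"
      using AE_GEM_space[OF \<theta>] AE_rem_tendsto_0[OF \<theta>]
    proof eventually_elim
      case (elim W)
      have "eventually (\<lambda>n. \<forall>p\<in>set L. 0 < snd p \<longrightarrow> (\<forall>m\<ge>n. rem W m < snd p)) sequentially"
      proof (rule eventually_ball_finite, simp, rule ballI)
        fix p assume "p \<in> set L"
        show "eventually (\<lambda>n. 0 < snd p \<longrightarrow> (\<forall>m\<ge>n. rem W m < snd p)) sequentially"
        proof (cases "0 < snd p")
          case True
          then obtain n0 where "\<forall>m\<ge>n0. rem W m < snd p" using elim(2) by blast
          then show ?thesis by (auto simp: eventually_sequentially intro!: exI[of _ n0])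
        qed simp
      qed
      then have "eventually (\<lambda>n. \<phi> n W = F (rank (stick W))) sequentially"
      proof eventually_elim
        case n: (elim n)
        have fin_stick: "finite {i. x \<le> stick W i}" if x: "0 < x" for x
        proof -
          obtain n0 where n0: "\<forall>m\<ge>n0. rem W m < x" using elim(2) x by blast
          have "{i. x \<le> stick W i} = {i. x \<le> partial_stick n0 W (\<lambda>_. 0) i}"
            by (rule superlevel_partial_stick[symmetric]) (use elim(1) n0 in auto)
          then show ?thesis using finite_superlevel_partial_stick[of "\<lambda>_. 0" x n0 W] x by simp
        qed
        have "\<phi> n W = (\<integral>\<^sup>+E. F (rank (stick W)) \<partial>tilted (\<theta> + real n * \<alpha>))"
          unfolding \<phi>_def
        proof (rule nn_integral_cong_AE)
          show "AE E in tilted (\<theta> + real n * \<alpha>). F (rank (partial_stick n W (\<lambda>i. J E i / T E))) = F (rank (stick W))"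
            using AE_tilted_good
          proof eventually_elim
            case E: (elim E)
            note nj = normalised_jumps[OF E]
            have fin_ps: "finite {i. x \<le> partial_stick n W (\<lambda>i. J E i / T E) i}" if "0 < x" for x
              by (rule finite_superlevel_partial_stick) (use nj that in auto)
            have "snd p \<le> rank (partial_stick n W (\<lambda>i. J E i / T E)) (fst p) \<longleftrightarrow> snd p \<le> rank (stick W) (fst p)"
              if p: "p \<in> set L" for p
            proof (cases "0 < snd p")
              case True
              have eq: "{i. snd p \<le> partial_stick n W (\<lambda>i. J E i / T E) i} = {i. snd p \<le> stick W i}"
                by (rule superlevel_partial_stick) (use elim(1) n p True nj in auto)
              show ?thesis by (simp only: le_rank_iff[OF fin_ps True] le_rank_iff[OF fin_stick True] eq)
            next
              case False
              then show ?thesis using rank_nonneg[of "stick W" "fst p"]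
                rank_nonneg[of "partial_stick n W (\<lambda>i. J E i / T E)" "fst p"] by linarith
            qed
            then show ?case by (simp add: F_def case_prod_beta)
          qed
        qed
        then show ?case using prob_space.emeasure_space_1[OF pn[of n]] by simp
      qed
      then show ?case by (rule tendsto_eventually)
    qed
  qed measurable
  then have "emeasure (distr (tilted \<theta>) seqM (\<lambda>E i. J E i / T E)) ?A = (\<integral>\<^sup>+W. F (rank (stick W)) \<partial>GEM_space \<alpha> \<theta>)"
    unfolding const[symmetric] by (rule LIMSEQ_unique[OF tendsto_const])
  also have "\<dots> = emeasure (PD \<alpha> \<theta>) ?A"
    unfolding PD_def emeasure_distr_of_bool[OF R A] F_def ..
  finally show "emeasure (distr (tilted \<theta>) seqM (\<lambda>E i. J E i / T E)) ?A = emeasure (PD \<alpha> \<theta>) ?A" .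
qed (simp_all add: PD_def)

end

section \<open>The tilt of the fragmented sequence\<close>

lemma nn_integral_FTC_einterval:
  fixes f F :: "real \<Rightarrow> real" and a b :: ereal
  assumes ab: "a < b"
    and F: "\<And>x. a < ereal x \<Longrightarrow> ereal x < b \<Longrightarrow> DERIV F x :> f x"
    and f: "\<And>x. a < ereal x \<Longrightarrow> ereal x < b \<Longrightarrow> isCont f x"
    and nonneg: "\<And>x. a < ereal x \<Longrightarrow> ereal x < b \<Longrightarrow> 0 \<le> f x"
    and A: "((F \<circ> real_of_ereal) \<longlongrightarrow> A) (at_right a)"
    and B: "((F \<circ> real_of_ereal) \<longlongrightarrow> B) (at_left b)"
  shows "(\<integral>\<^sup>+x. ennreal (f x) * indicator (einterval a b) x \<partial>lborel) = ennreal (B - A)"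
proof -
  have nn: "AE x in lborel. a < ereal x \<longrightarrow> ereal x < b \<longrightarrow> 0 \<le> f x" using nonneg by auto
  note FTC = interval_integral_FTC_nonneg[OF ab F f nn A B]
  have "(\<integral>\<^sup>+x. ennreal (f x) * indicator (einterval a b) x \<partial>lborel) =
      (\<integral>\<^sup>+x. ennreal (indicator (einterval a b) x *\<^sub>R f x) \<partial>lborel)"
    by (rule nn_integral_cong) (simp add: indicator_def)
  also have "\<dots> = ennreal (LINT x|lborel. indicator (einterval a b) x *\<^sub>R f x)"
    using FTC(1) nonneg unfolding set_integrable_def
    by (intro nn_integral_eq_integral) (auto simp: indicator_def einterval_iff)
  also have "(LINT x|lborel. indicator (einterval a b) x *\<^sub>R f x) = B - A"
    using FTC(2) by (simp only: interval_lebesgue_integral_le_eq[OF less_imp_le[OF ab]] set_lebesgue_integral_def)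
  finally show ?thesis .
qed

lemma filterlim_powr_at_top:
  fixes a :: real
  assumes "0 < a" and f: "filterlim f at_top G"
  shows "filterlim (\<lambda>x. f x powr a) at_top G"
proof -
  have "((\<lambda>x. f x powr (- a)) \<longlongrightarrow> 0) G" using assms by (intro tendsto_neg_powr) auto
  moreover have "eventually (\<lambda>x. 0 < f x powr (- a)) G"
    using filterlim_at_top_dense[THEN iffD1, OF f, rule_format, of 0] by eventually_elim simp
  ultimately have "filterlim (\<lambda>x. inverse (f x powr (- a))) at_top G" by (rule filterlim_inverse_at_top)
  then show ?thesis by (simp add: powr_minus)
qed

lemma gamma_law_sets [simp, measurable_cong]: "sets (gamma_law k) = sets borel"
  and gamma_law_space [simp]: "space (gamma_law k) = UNIV"
  by (simp_all add: gamma_law_def)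

lemma measurable_gamma_density [measurable]: "gamma_density k \<in> borel_measurable borel"
  unfolding gamma_density_def by measurable

lemma prob_space_gamma_law:
  assumes "0 < k" shows "prob_space (gamma_law k)"
proof (rule prob_spaceI)
  have G: "0 < Gamma k" using assms by (rule Gamma_real_pos)
  then have nz: "Gamma k \<noteq> 0" by linarith
  have "emeasure (gamma_law k) UNIV = (\<integral>\<^sup>+x. ennreal (gamma_density k x) \<partial>lborel)"
    unfolding gamma_law_def by (simp add: emeasure_density)
  also have "\<dots> = (\<integral>\<^sup>+x. ennreal (1 / Gamma k) * (ennreal (x powr (k - 1) * exp (- (1 * x))) * indicator {0<..} x) \<partial>lborel)"
    using G by (intro nn_integral_cong) (auto simp: gamma_density_def indicator_def ennreal_mult'[symmetric])
  also have "\<dots> = ennreal (1 / Gamma k) * ennreal (Gamma k * 1 powr (- k))"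
    using assms by (subst nn_integral_cmult, measurable, subst nn_integral_Gamma) auto
  also have "\<dots> = 1" using G nz by (simp add: ennreal_mult'[symmetric])
  finally show "emeasure (gamma_law k) (space (gamma_law k)) = 1" by simp
qed

context stable_index
begin

lemma measurable_superposition_scale [measurable]: "superposition_scale \<in> borel_measurable borel"
  unfolding superposition_scale_def by measurable

text \<open>The primitive is \<open>(1 + y powr (- \<alpha>)) powr (1 - 1 / \<alpha>) / (1 -
  \<alpha>)\<close>, which vanishes at \<open>0\<close>. At the upper end of the region
  \<open>y powr (- \<alpha>)\<close> equals \<open>s / g\<close>.\<close>

lemma nn_integral_fragment_size:
  assumes s: "0 \<le> s" and g: "0 < g"
  shows "(\<integral>\<^sup>+y. ennreal (y powr (- \<alpha>) / superposition_scale y) * indicator {y. 0 < y \<and> s * y powr \<alpha> < g} y \<partial>lborel) =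
    ennreal ((g / (s + g)) powr (1 / \<alpha> - 1) / (1 - \<alpha>))"
proof -
  let ?p = "1 / \<alpha> - 1"
  have p: "0 < ?p" using alpha by (simp add: field_simps)
  define G where "G y = (1 + y powr (- \<alpha>)) powr (- ?p) / (1 - \<alpha>)" for y :: real
  have DG: "DERIV G y :> y powr (- \<alpha>) / superposition_scale y" if y: "0 < y" for y
  proof -
    have pos: "0 < 1 + y powr (- \<alpha>)" by (simp add: add_pos_nonneg)
    have "DERIV G y :> (- ?p * (1 + y powr (- \<alpha>)) powr (- ?p - 1) * (- \<alpha> * y powr (- \<alpha> - 1))) / (1 - \<alpha>)"
      unfolding G_def using y pos alpha by (auto intro!: derivative_eq_intros)
    also have "(- ?p * (1 + y powr (- \<alpha>)) powr (- ?p - 1) * (- \<alpha> * y powr (- \<alpha> - 1))) / (1 - \<alpha>) =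
        (?p * \<alpha> / (1 - \<alpha>)) * ((1 + y powr (- \<alpha>)) powr (- 1 / \<alpha>) * y powr (- \<alpha> - 1))"
      by (simp add: field_simps)
    also have "?p * \<alpha> / (1 - \<alpha>) = 1" using alpha by (simp add: field_simps)
    also have "(1 + y powr (- \<alpha>)) powr (- 1 / \<alpha>) = y / superposition_scale y"
    proof -
      have "1 + y powr (- \<alpha>) = y powr (- \<alpha>) * (1 + y powr \<alpha>)"
        using y by (simp add: distrib_left powr_add[symmetric])
      then have "(1 + y powr (- \<alpha>)) powr (- 1 / \<alpha>) = (y powr (- \<alpha>)) powr (- 1 / \<alpha>) * (1 + y powr \<alpha>) powr (- 1 / \<alpha>)"
        by (simp add: powr_mult)
      also have "\<dots> = y * inverse (superposition_scale y)"
        using y alpha by (simp add: powr_powr superposition_scale_def powr_minus[symmetric])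
      finally show ?thesis by (simp add: divide_inverse)
    qed
    also have "1 * (y / superposition_scale y * y powr (- \<alpha> - 1)) = y powr (- \<alpha>) / superposition_scale y"
      using y by (simp add: powr_diff)
    finally show ?thesis .
  qed
  have cont: "isCont (\<lambda>y. y powr (- \<alpha>) / superposition_scale y) y" if "0 < y" for y
  proof -
    have "1 + y powr \<alpha> \<noteq> 0" using powr_ge_zero[of y \<alpha>] by linarith
    then show ?thesis using that unfolding superposition_scale_def by (intro continuous_intros) auto
  qed
  have nonneg: "0 \<le> y powr (- \<alpha>) / superposition_scale y" for y
    using superposition_scale_pos[of y] by simp
  have lim0: "(G \<longlongrightarrow> 0) (at_right 0)"
  proof -
    have "((\<lambda>y::real. y powr \<alpha>) \<longlongrightarrow> 0) (at_right 0)"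
      using alpha by (intro tendsto_zero_powrI[OF _ tendsto_const]) (auto simp: eventually_at_filter)
    moreover have "eventually (\<lambda>y::real. 0 < y powr \<alpha>) (at_right 0)"
      by (auto simp: eventually_at_filter)
    ultimately have "filterlim (\<lambda>y::real. inverse (y powr \<alpha>)) at_top (at_right 0)"
      by (rule filterlim_inverse_at_top)
    then have "filterlim (\<lambda>y::real. 1 + y powr (- \<alpha>)) at_top (at_right 0)"
      unfolding powr_minus by (rule filterlim_tendsto_add_at_top[OF tendsto_const])
    then have "((\<lambda>y::real. (1 + y powr (- \<alpha>)) powr (- ?p)) \<longlongrightarrow> 0) (at_right 0)"
      using p by (intro tendsto_neg_powr) auto
    then have "(G \<longlongrightarrow> 0 / (1 - \<alpha>)) (at_right 0)" unfolding G_def using alpha by (intro tendsto_divide tendsto_const) auto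
    then show ?thesis by simp
  qed
  show ?thesis
  proof (cases "s = 0")
    \<comment> \<open>For \<open>s = 0\<close> the region is the whole half-line, and the limit at
      infinity replaces the value at the endpoint \<open>Y\<close>.\<close>
    case True
    have "((\<lambda>y::real. y powr (- \<alpha>)) \<longlongrightarrow> 0) at_top" using alpha by (intro tendsto_neg_powr filterlim_ident) auto
    then have "(G \<longlongrightarrow> (1 + 0) powr (- ?p) / (1 - \<alpha>)) at_top"
      unfolding G_def using alpha by (intro tendsto_intros) auto
    then have "(\<integral>\<^sup>+y. ennreal (y powr (- \<alpha>) / superposition_scale y) * indicator (einterval (ereal 0) \<infinity>) y \<partial>lborel) =
       ennreal ((1 + 0) powr (- ?p) / (1 - \<alpha>) - 0)"
      using lim0 by (intro nn_integral_FTC_einterval[where F = G] DG cont nonneg)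
        (simp_all only: ereal_tendsto_simps1, auto)
    moreover have "einterval (ereal 0) \<infinity> = {y. 0 < y \<and> s * y powr \<alpha> < g}" using True g by auto
    ultimately show ?thesis using True g by simp
  next
    case False
    then have s: "0 < s" using s by simp
    define Y where "Y = (g / s) powr (1 / \<alpha>)"
    have Y: "0 < Y" using s g by (simp add: Y_def)
    have Y\<alpha>: "Y powr \<alpha> = g / s" unfolding Y_def using s g alpha by (simp add: powr_powr)
    have "(G \<longlongrightarrow> G Y) (at_left Y)"
      using DERIV_isCont[OF DG[OF Y]] by (auto simp: isCont_def intro: tendsto_mono[OF at_le])
    then have "(\<integral>\<^sup>+y. ennreal (y powr (- \<alpha>) / superposition_scale y) * indicator (einterval (ereal 0) (ereal Y)) y \<partial>lborel) =
       ennreal (G Y - 0)"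
      using lim0 Y by (intro nn_integral_FTC_einterval[where F = G] DG cont nonneg)
        (simp_all only: ereal_tendsto_simps1, auto)
    moreover have "einterval (ereal 0) (ereal Y) = {y. 0 < y \<and> s * y powr \<alpha> < g}"
    proof -
      have "y < Y \<longleftrightarrow> s * y powr \<alpha> < g" if "0 < y" for y
      proof -
        have "y < Y \<longleftrightarrow> y powr \<alpha> < Y powr \<alpha>" using powr_less_mono2[of \<alpha> y Y] powr_mono2[of \<alpha> Y y] that Y alpha
          by (cases "y < Y") auto
        also have "\<dots> \<longleftrightarrow> s * y powr \<alpha> < g" unfolding Y\<alpha> using s by (simp add: field_simps)
        finally show ?thesis .
      qed
      then show ?thesis by (auto simp: einterval_eq_Icc)
    qed
    moreover have "G Y = (g / (s + g)) powr ?p / (1 - \<alpha>)"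
    proof -
      have "1 + Y powr (- \<alpha>) = (s + g) / g" using s g by (simp add: powr_minus Y\<alpha> field_simps)
      then have "(1 + Y powr (- \<alpha>)) powr (- ?p) = ((s + g) / g) powr (- ?p)" by simp
      also have "\<dots> = (inverse ((s + g) / g)) powr ?p"
      proof -
        have "inverse ((s + g) / g) powr ?p = inverse (((s + g) / g) powr ?p)"
          by (rule inverse_powr)
        then show ?thesis by (simp only: powr_minus)
      qed
      finally show ?thesis unfolding G_def by simp
    qed
    ultimately show ?thesis by simp
  qed
qed

text \<open>The variable \<open>g\<close> is chosen so that
  \<open>(s + g) powr (1 / \<alpha>)\<close> equals
  \<open>s powr (1 / \<alpha>) * superposition_scale y\<close> at
  \<open>g = s * y powr \<alpha>\<close>; the integrand is an exact derivative in \<open>g\<close>.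
  This \<open>g\<close> later becomes the Gamma variable.\<close>

lemma nn_integral_gamma_tail:
  assumes s: "0 \<le> s" and y: "0 < y" and t: "0 < t"
  shows "(\<integral>\<^sup>+g. ennreal (exp (- (t * (s + g) powr (1 / \<alpha>))) * ((s + g) powr (1 / \<alpha> - 1) / \<alpha>)) * indicator {s * y powr \<alpha><..} g \<partial>lborel) =
    ennreal (exp (- (t * (s powr (1 / \<alpha>) * superposition_scale y))) / t)"
proof -
  define F where "F g = - (exp (- (t * (s + g) powr (1 / \<alpha>))) / t)" for g
  have sg: "0 < s + g" if "s * y powr \<alpha> < g" for g
    using that s powr_ge_zero[of y \<alpha>] by (smt (verit) mult_nonneg_nonneg)
  have s1: "(s + s * y powr \<alpha>) powr (1 / \<alpha>) = s powr (1 / \<alpha>) * superposition_scale y"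
  proof -
    have "s + s * y powr \<alpha> = s * (1 + y powr \<alpha>)" by (simp add: distrib_left)
    then show ?thesis using s powr_ge_zero[of y \<alpha>] by (simp add: powr_mult superposition_scale_def)
  qed
  have l1: "(F \<longlongrightarrow> - (exp (- (t * (s powr (1 / \<alpha>) * superposition_scale y))) / t)) (at_right (s * y powr \<alpha>))"
  proof -
    have "((\<lambda>g. (s + g) powr (1 / \<alpha>)) \<longlongrightarrow> (s + s * y powr \<alpha>) powr (1 / \<alpha>)) (at_right (s * y powr \<alpha>))"
    proof (rule tendsto_powr')
      show "((\<lambda>g. s + g) \<longlongrightarrow> s + s * y powr \<alpha>) (at_right (s * y powr \<alpha>))"
        by (intro tendsto_add tendsto_const tendsto_ident_at)
      have "eventually (\<lambda>g. 0 \<le> s + g) (at_right (s * y powr \<alpha>))"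
        using sg by (auto simp: eventually_at_filter less_imp_le)
      then show "s + s * y powr \<alpha> \<noteq> 0 \<or> 0 < 1 / \<alpha> \<and> eventually (\<lambda>g. 0 \<le> s + g) (at_right (s * y powr \<alpha>))"
        using alpha by simp
    qed (rule tendsto_const)
    then show ?thesis unfolding F_def s1 using t by (intro tendsto_intros) auto
  qed
  have l2: "(F \<longlongrightarrow> 0) at_top"
  proof -
    have "filterlim (\<lambda>g. t * (s + g) powr (1 / \<alpha>)) at_top at_top"
      using t alpha by (intro filterlim_tendsto_pos_mult_at_top[OF tendsto_const] filterlim_powr_at_top
          filterlim_tendsto_add_at_top[OF tendsto_const] filterlim_ident) auto
    then have "((\<lambda>g. exp (- (t * (s + g) powr (1 / \<alpha>)))) \<longlongrightarrow> 0) at_top"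
      by (intro filterlim_compose[OF exp_at_bot] filterlim_compose[OF filterlim_uminus_at_bot_at_top])
    then have "(F \<longlongrightarrow> - (0 / t)) at_top" unfolding F_def using t by (intro tendsto_intros) auto
    then show ?thesis by simp
  qed
  have "(\<integral>\<^sup>+g. ennreal (exp (- (t * (s + g) powr (1 / \<alpha>))) * ((s + g) powr (1 / \<alpha> - 1) / \<alpha>)) *
      indicator (einterval (ereal (s * y powr \<alpha>)) \<infinity>) g \<partial>lborel) =
      ennreal (0 - - (exp (- (t * (s powr (1 / \<alpha>) * superposition_scale y))) / t))"
  proof (rule nn_integral_FTC_einterval[where F = F])
    fix g assume "ereal (s * y powr \<alpha>) < ereal g"
    then have g: "0 < s + g" by (intro sg) simp
    show "DERIV F g :> exp (- (t * (s + g) powr (1 / \<alpha>))) * ((s + g) powr (1 / \<alpha> - 1) / \<alpha>)"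
      unfolding F_def using g t alpha by (auto intro!: derivative_eq_intros simp: field_simps)
    show "isCont (\<lambda>g. exp (- (t * (s + g) powr (1 / \<alpha>))) * ((s + g) powr (1 / \<alpha> - 1) / \<alpha>)) g"
      using g alpha by (intro continuous_intros) auto
    show "0 \<le> exp (- (t * (s + g) powr (1 / \<alpha>))) * ((s + g) powr (1 / \<alpha> - 1) / \<alpha>)"
      using alpha by simp
  qed (use l1 l2 in \<open>simp_all only: ereal_tendsto_simps1, auto\<close>)
  then show ?thesis by simp
qed

text \<open>Once \<open>g\<close> is the outer variable, the \<open>y\<close>-integral is
  \<open>nn_integral_fragment_size\<close>. Its power of \<open>s + g\<close> cancels the one coming
  from \<open>nn_integral_gamma_tail\<close>, and \<open>g powr (1 / \<alpha> - 1)\<close>, the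
  power in the Gamma density, is left.\<close>

lemma nn_integral_levy_tilt:
  assumes s: "0 \<le> s" and t: "0 < t"
  shows "(\<integral>\<^sup>+y. ennreal y * ennreal (1 / (superposition_scale y * t)) *
        ennreal (exp (s - s powr (1 / \<alpha>) * (superposition_scale y * t))) \<partial>levy \<alpha>) =
    ennreal (1 / (Gamma (1 - \<alpha>) * (1 - \<alpha>))) *
      (\<integral>\<^sup>+g. ennreal (g powr (1 / \<alpha> - 1) * exp (s - (s + g) powr (1 / \<alpha>) * t)) * indicator {0<..} g \<partial>lborel)"
proof -
  let ?b = superposition_scale and ?p = "1 / \<alpha> - 1" and ?c = "Gamma (1 - \<alpha>)"
  define k where "k g = exp (- (t * (s + g) powr (1 / \<alpha>))) * ((s + g) powr ?p / \<alpha>)" for g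
  have [measurable]: "k \<in> borel_measurable borel" unfolding k_def by measurable
  define A where "A y g \<longleftrightarrow> 0 < y \<and> s * y powr \<alpha> < g" for y g
  have [measurable]: "Measurable.pred (borel \<Otimes>\<^sub>M borel) (\<lambda>x. A (fst x) (snd x))" unfolding A_def by measurable
  have Am[measurable (raw)]: "Measurable.pred M (\<lambda>w. A (f w) (h w))"
    if [measurable]: "f \<in> borel_measurable M" "h \<in> borel_measurable M" for f h and M :: "'z measure"
    unfolding A_def by measurable
  have "(\<integral>\<^sup>+y. ennreal y * ennreal (1 / (?b y * t)) * ennreal (exp (s - s powr (1 / \<alpha>) * (?b y * t))) \<partial>levy \<alpha>) =
    (\<integral>\<^sup>+y. ennreal y * ennreal (1 / (?b y * t)) * ennreal (exp (s - s powr (1 / \<alpha>) * (?b y * t))) * ennreal (levy_density \<alpha> y) * indicator {0<..} y \<partial>lborel)"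
    by (rule nn_integral_levy) measurable
  also have "\<dots> = (\<integral>\<^sup>+y. (\<integral>\<^sup>+g. ennreal (exp s * \<alpha> / ?c) * (ennreal (y powr (- \<alpha>) / ?b y) * (ennreal (k g) * of_bool (A y g))) \<partial>lborel) \<partial>lborel)"
  proof (rule nn_integral_cong)
    fix y :: real
    show "ennreal y * ennreal (1 / (?b y * t)) * ennreal (exp (s - s powr (1 / \<alpha>) * (?b y * t))) * ennreal (levy_density \<alpha> y) * indicator {0<..} y =
      (\<integral>\<^sup>+g. ennreal (exp s * \<alpha> / ?c) * (ennreal (y powr (- \<alpha>) / ?b y) * (ennreal (k g) * of_bool (A y g))) \<partial>lborel)"
    proof (cases "0 < y")
      case True
      note b = superposition_scale_pos[of y]
      have "(\<integral>\<^sup>+g. ennreal (exp s * \<alpha> / ?c) * (ennreal (y powr (- \<alpha>) / ?b y) * (ennreal (k g) * of_bool (A y g))) \<partial>lborel) =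
         ennreal (exp s * \<alpha> / ?c) * (ennreal (y powr (- \<alpha>) / ?b y) * (\<integral>\<^sup>+g. ennreal (k g) * indicator {s * y powr \<alpha><..} g \<partial>lborel))"
        using True by (subst nn_integral_cmult, measurable, subst nn_integral_cmult, measurable)
          (simp add: A_def indicator_def of_bool_def)
      also have "\<dots> = ennreal (exp s * \<alpha> / ?c) * (ennreal (y powr (- \<alpha>) / ?b y) * ennreal (exp (- (t * (s powr (1 / \<alpha>) * ?b y))) / t))"
        unfolding k_def by (simp only: nn_integral_gamma_tail[OF s True t])
      also have "\<dots> = ennreal (exp s * \<alpha> / ?c * (y powr (- \<alpha>) / ?b y * (exp (- (t * (s powr (1 / \<alpha>) * ?b y))) / t)))"
        using b t alpha Gamma_pos by (simp add: ennreal_mult'[symmetric])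
      also have "exp s * \<alpha> / ?c * (y powr (- \<alpha>) / ?b y * (exp (- (t * (s powr (1 / \<alpha>) * ?b y))) / t)) =
         y * (1 / (?b y * t)) * exp (s - s powr (1 / \<alpha>) * (?b y * t)) * levy_density \<alpha> y"
        using True b t by (simp add: levy_density_def powr_diff[of y "- \<alpha>" 1] exp_diff exp_minus field_simps)
      also have "ennreal \<dots> = ennreal y * ennreal (1 / (?b y * t)) * ennreal (exp (s - s powr (1 / \<alpha>) * (?b y * t))) * ennreal (levy_density \<alpha> y)"
        by (subst ennreal_mult''[OF levy_density_nonneg], subst ennreal_mult''[OF exp_ge_zero], subst ennreal_mult'')
            (use b t in simp_all)
      finally show ?thesis using True by simp
    qed (simp add: A_def)
  qed
  also have "\<dots> = (\<integral>\<^sup>+g. (\<integral>\<^sup>+y. ennreal (exp s * \<alpha> / ?c) * (ennreal (y powr (- \<alpha>) / ?b y) * (ennreal (k g) * of_bool (A y g))) \<partial>lborel) \<partial>lborel)"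
    by (rule lborel_pair.Fubini') measurable
  also have "\<dots> = (\<integral>\<^sup>+g. ennreal (1 / (?c * (1 - \<alpha>))) * (ennreal (g powr ?p * exp (s - (s + g) powr (1 / \<alpha>) * t)) * indicator {0<..} g) \<partial>lborel)"
  proof (rule nn_integral_cong)
    fix g :: real
    show "(\<integral>\<^sup>+y. ennreal (exp s * \<alpha> / ?c) * (ennreal (y powr (- \<alpha>) / ?b y) * (ennreal (k g) * of_bool (A y g))) \<partial>lborel) =
      ennreal (1 / (?c * (1 - \<alpha>))) * (ennreal (g powr ?p * exp (s - (s + g) powr (1 / \<alpha>) * t)) * indicator {0<..} g)"
    proof (cases "0 < g")
      case True
      have "(\<integral>\<^sup>+y. ennreal (exp s * \<alpha> / ?c) * (ennreal (y powr (- \<alpha>) / ?b y) * (ennreal (k g) * of_bool (A y g))) \<partial>lborel) =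
        (\<integral>\<^sup>+y. (ennreal (exp s * \<alpha> / ?c) * ennreal (k g)) * (ennreal (y powr (- \<alpha>) / ?b y) * indicator {y. 0 < y \<and> s * y powr \<alpha> < g} y) \<partial>lborel)"
        by (rule nn_integral_cong) (simp add: A_def indicator_def mult_ac)
      also have "\<dots> = (ennreal (exp s * \<alpha> / ?c) * ennreal (k g)) * ennreal ((g / (s + g)) powr ?p / (1 - \<alpha>))"
        by (subst nn_integral_cmult) (measurable, simp only: nn_integral_fragment_size[OF s True])
      also have "\<dots> = ennreal (exp s * \<alpha> / ?c * k g * ((g / (s + g)) powr ?p / (1 - \<alpha>)))"
        using alpha Gamma_pos by (simp add: ennreal_mult'[symmetric] ennreal_mult''[symmetric] k_def)
      also have "exp s * \<alpha> / ?c * k g * ((g / (s + g)) powr ?p / (1 - \<alpha>)) =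
         1 / (?c * (1 - \<alpha>)) * (g powr ?p * exp (s - (s + g) powr (1 / \<alpha>) * t))"
      proof -
        have e: "exp (s - (s + g) powr (1 / \<alpha>) * t) = exp s * exp (- (t * (s + g) powr (1 / \<alpha>)))"
          by (simp add: mult_exp_exp mult.commute)
        have "(s + g) powr ?p * (g / (s + g)) powr ?p = g powr ?p"
          using True s by (simp add: powr_mult[symmetric])
        then have q: "(g / (s + g)) powr ?p = g powr ?p / (s + g) powr ?p" using True s by (simp add: field_simps)
        have "(s + g) powr ?p \<noteq> 0" using True s by simp
        then show ?thesis unfolding k_def e q using alpha by (simp add: field_simps)
      qed
      finally show ?thesis using True alpha Gamma_pos by (simp add: ennreal_mult'[symmetric])
    next
      case False
      have "\<not> A y g" for y
      proof
        assume "A y g"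
        moreover have "0 \<le> s * y powr \<alpha>" using s by simp
        ultimately show False using False unfolding A_def by linarith
      qed
      then show ?thesis using False by simp
    qed
  qed
  also have "\<dots> = ennreal (1 / (?c * (1 - \<alpha>))) *
      (\<integral>\<^sup>+g. ennreal (g powr ?p * exp (s - (s + g) powr (1 / \<alpha>) * t)) * indicator {0<..} g \<partial>lborel)"
    by (rule nn_integral_cmult) measurable
  finally show ?thesis .
qed

text \<open>The factor \<open>exp (- g)\<close> of the Gamma density cancels the
  \<open>exp g\<close> in the tilt at \<open>g + s\<close>, so of the density only a power of
  \<open>g\<close> and the normaliser remain.\<close>

lemma tilt_gamma_convolution:
  assumes \<mu>: "prob_space \<mu>" "sets \<mu> = sets borel"
  shows "ennreal (Gamma (1 / \<alpha>)) * tilt \<alpha> (gamma_law (1 / \<alpha>) \<star> \<mu>) t =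
    (\<integral>\<^sup>+s. (\<integral>\<^sup>+g. ennreal (g powr (1 / \<alpha> - 1) * exp (s - (s + g) powr (1 / \<alpha>) * t)) * indicator {0<..} g \<partial>lborel) \<partial>\<mu>)"
proof -
  interpret \<mu>: prob_space \<mu> by fact
  have [measurable_cong]: "sets \<mu> = sets borel" by fact
  have G: "0 < Gamma (1 / \<alpha>)" using alpha by (intro Gamma_real_pos) simp
  have k: "0 < 1 / \<alpha>" using alpha by simp
  interpret \<gamma>: prob_space "gamma_law (1 / \<alpha>)" by (rule prob_space_gamma_law[OF k])
  interpret pair_sigma_finite lborel \<mu> ..
  have "ennreal (Gamma (1 / \<alpha>)) * tilt \<alpha> (gamma_law (1 / \<alpha>) \<star> \<mu>) t =
    ennreal (Gamma (1 / \<alpha>)) * (\<integral>\<^sup>+g. (\<integral>\<^sup>+s. ennreal (exp ((g + s) - (g + s) powr (1 / \<alpha>) * t)) \<partial>\<mu>) \<partial>gamma_law (1 / \<alpha>))"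
    unfolding tilt_def
    by (subst nn_integral_convolution) (auto intro: \<gamma>.finite_measure_axioms \<mu>.finite_measure_axioms simp: \<mu>(2))
  also have "\<dots> = ennreal (Gamma (1 / \<alpha>)) * (\<integral>\<^sup>+g. ennreal (gamma_density (1 / \<alpha>) g) * (\<integral>\<^sup>+s. ennreal (exp ((g + s) - (g + s) powr (1 / \<alpha>) * t)) \<partial>\<mu>) \<partial>lborel)"
    unfolding gamma_law_def by (subst nn_integral_density) auto
  also have "\<dots> = (\<integral>\<^sup>+g. (\<integral>\<^sup>+s. ennreal (g powr (1 / \<alpha> - 1) * exp (s - (s + g) powr (1 / \<alpha>) * t)) * indicator {0<..} g \<partial>\<mu>) \<partial>lborel)"
  proof (subst nn_integral_cmult[symmetric], measurable, rule nn_integral_cong)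
    fix g :: real
    show "ennreal (Gamma (1 / \<alpha>)) * (ennreal (gamma_density (1 / \<alpha>) g) * (\<integral>\<^sup>+s. ennreal (exp ((g + s) - (g + s) powr (1 / \<alpha>) * t)) \<partial>\<mu>)) =
      (\<integral>\<^sup>+s. ennreal (g powr (1 / \<alpha> - 1) * exp (s - (s + g) powr (1 / \<alpha>) * t)) * indicator {0<..} g \<partial>\<mu>)"
    proof (cases "0 < g")
      case True
      have "ennreal (Gamma (1 / \<alpha>)) * ennreal (gamma_density (1 / \<alpha>) g) = ennreal (g powr (1 / \<alpha> - 1) * exp (- g))"
        using G True by (simp add: gamma_density_def ennreal_mult'[symmetric])
      then have "ennreal (Gamma (1 / \<alpha>)) * (ennreal (gamma_density (1 / \<alpha>) g) * (\<integral>\<^sup>+s. ennreal (exp ((g + s) - (g + s) powr (1 / \<alpha>) * t)) \<partial>\<mu>)) =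
        ennreal (g powr (1 / \<alpha> - 1) * exp (- g)) * (\<integral>\<^sup>+s. ennreal (exp ((g + s) - (g + s) powr (1 / \<alpha>) * t)) \<partial>\<mu>)"
        by (simp add: mult.assoc[symmetric])
      also have "\<dots> = (\<integral>\<^sup>+s. ennreal (g powr (1 / \<alpha> - 1) * exp (- g)) * ennreal (exp ((g + s) - (g + s) powr (1 / \<alpha>) * t)) \<partial>\<mu>)"
        by (rule nn_integral_cmult[symmetric]) measurable
      also have "\<dots> = (\<integral>\<^sup>+s. ennreal (g powr (1 / \<alpha> - 1) * exp (s - (s + g) powr (1 / \<alpha>) * t)) * indicator {0<..} g \<partial>\<mu>)"
        using True by (intro nn_integral_cong)
          (simp add: ennreal_mult''[symmetric] mult.assoc mult_exp_exp algebra_simps)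
      finally show ?thesis .
    qed (simp add: gamma_density_def)
  qed
  also have "\<dots> = (\<integral>\<^sup>+s. (\<integral>\<^sup>+g. ennreal (g powr (1 / \<alpha> - 1) * exp (s - (s + g) powr (1 / \<alpha>) * t)) * indicator {0<..} g \<partial>lborel) \<partial>\<mu>)"
    by (rule Fubini'[symmetric]) measurable
  finally show ?thesis .
qed

text \<open>Representing \<open>exp (- t B) / t\<close> as a tail integral and exchanging the order of integration
  turns the intensity of the size-biased fragment into the Gamma density.\<close>
lemma levy_tilt_eq_gamma_tilt:
  assumes \<mu>: "prob_space \<mu>" "sets \<mu> = sets borel" "AE s in \<mu>. 0 \<le> s" and t: "0 < t"
  shows "(\<integral>\<^sup>+y. ennreal y * (tilt \<alpha> \<mu> (superposition_scale y * t) * ennreal (1 / (superposition_scale y * t))) \<partial>levy \<alpha>) =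
    ennreal (Gamma (1 / \<alpha>) / (Gamma (1 - \<alpha>) * (1 - \<alpha>))) * tilt \<alpha> (gamma_law (1 / \<alpha>) \<star> \<mu>) t"
proof -
  interpret \<mu>: prob_space \<mu> by fact
  have [measurable_cong]: "sets \<mu> = sets borel" by fact
  interpret pair_sigma_finite "levy \<alpha>" \<mu>
    by (intro pair_sigma_finite.intro sigma_finite_levy \<mu>.sigma_finite_measure_axioms)
  let ?b = superposition_scale
  have G: "0 < Gamma (1 / \<alpha>)" using alpha by (intro Gamma_real_pos) simp
  have "(\<integral>\<^sup>+y. ennreal y * (tilt \<alpha> \<mu> (?b y * t) * ennreal (1 / (?b y * t))) \<partial>levy \<alpha>) =
     (\<integral>\<^sup>+y. (\<integral>\<^sup>+s. ennreal y * ennreal (1 / (?b y * t)) * ennreal (exp (s - s powr (1 / \<alpha>) * (?b y * t))) \<partial>\<mu>) \<partial>levy \<alpha>)"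
    unfolding tilt_def by (intro nn_integral_cong, subst nn_integral_cmult) (auto simp: mult_ac)
  also have "\<dots> = (\<integral>\<^sup>+s. (\<integral>\<^sup>+y. ennreal y * ennreal (1 / (?b y * t)) * ennreal (exp (s - s powr (1 / \<alpha>) * (?b y * t))) \<partial>levy \<alpha>) \<partial>\<mu>)"
    by (rule Fubini'[symmetric]) measurable
  also have "\<dots> = (\<integral>\<^sup>+s. ennreal (1 / (Gamma (1 - \<alpha>) * (1 - \<alpha>))) *
      (\<integral>\<^sup>+g. ennreal (g powr (1 / \<alpha> - 1) * exp (s - (s + g) powr (1 / \<alpha>) * t)) * indicator {0<..} g \<partial>lborel) \<partial>\<mu>)"
    using \<mu>(3) by (intro nn_integral_cong_AE) (auto elim!: eventually_mono simp: nn_integral_levy_tilt[OF _ t])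
  also have "\<dots> = ennreal (1 / (Gamma (1 - \<alpha>) * (1 - \<alpha>))) * (ennreal (Gamma (1 / \<alpha>)) * tilt \<alpha> (gamma_law (1 / \<alpha>) \<star> \<mu>) t)"
    by (subst nn_integral_cmult, measurable) (simp only: tilt_gamma_convolution[OF \<mu>(1,2)])
  also have "\<dots> = ennreal (Gamma (1 / \<alpha>) / (Gamma (1 - \<alpha>) * (1 - \<alpha>))) * tilt \<alpha> (gamma_law (1 / \<alpha>) \<star> \<mu>) t"
    using G Gamma_pos alpha by (simp add: mult.assoc[symmetric] ennreal_mult'[symmetric])
  finally show ?thesis .
qed

end

section \<open>Fragmentation of a size-biased pick\<close>

text \<open>The fragmented sequence overwrites the picked entry by \<open>0\<close>, whereas Mecke's
  equation skips it; positive thresholds do not see the difference.\<close>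

lemma card_superlevel_drop:
  fixes a :: "nat \<Rightarrow> real"
  assumes x: "0 < x"
  shows "card {k. x \<le> (if k = i then 0 else a k)} = card {j. x \<le> (if j < i then a j else a (Suc j))}"
proof -
  let ?h = "\<lambda>j. if j < i then j else Suc j"
  have "{k. x \<le> (if k = i then 0 else a k)} = ?h ` {j. x \<le> (if j < i then a j else a (Suc j))}"
  proof (rule set_eqI, rule iffI)
    fix k assume k: "k \<in> {k. x \<le> (if k = i then 0 else a k)}"
    then have "k \<noteq> i" "x \<le> a k" using x by (auto split: if_splits)
    then show "k \<in> ?h ` {j. x \<le> (if j < i then a j else a (Suc j))}"
      by (intro image_eqI[of _ _ "if k < i then k else k - 1"]) auto
  qed (auto split: if_splits)
  moreover have "inj_on ?h {j. x \<le> (if j < i then a j else a (Suc j))}"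
    by (rule inj_onI) (auto split: if_splits)
  ultimately show ?thesis by (simp only: card_image)
qed

context stable_index
begin

text \<open>Equality on sets means that two weighted laws of \<open>P\<close> coincide, hence it
  extends to all non-negative \<open>u\<close>. The bounds on \<open>P \<omega> i\<close> make the
  Bochner integral in the hypothesis a genuine one.\<close>

lemma size_biased_density:
  assumes M: "prob_space M" and P: "P \<in> measurable M seqM" and I: "I \<in> measurable M (count_space UNIV)"
    and P01: "AE \<omega> in M. 0 \<le> P \<omega> i \<and> P \<omega> i \<le> 1"
    and sb: "\<And>A. A \<in> sets seqM \<Longrightarrow>
          measure M {\<omega> \<in> space M. I \<omega> = i \<and> P \<omega> \<in> A} = (\<integral>\<omega>. indicator A (P \<omega>) * P \<omega> i \<partial>M)"
    and u[measurable]: "u \<in> borel_measurable seqM"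
  shows "(\<integral>\<^sup>+\<omega>. of_bool (I \<omega> = i) * u (P \<omega>) \<partial>M) = (\<integral>\<^sup>+\<omega>. ennreal (P \<omega> i) * u (P \<omega>) \<partial>M)"
proof -
  interpret prob_space M by fact
  note [measurable] = P I
  have Pi[measurable]: "(\<lambda>\<omega>. P \<omega> i) \<in> borel_measurable M" by (rule measurable_seqM_component[OF P])
  have "distr (density M (\<lambda>\<omega>. of_bool (I \<omega> = i))) seqM P = distr (density M (\<lambda>\<omega>. ennreal (P \<omega> i))) seqM P"
  proof (rule measure_eqI)
    fix A assume "A \<in> sets (distr (density M (\<lambda>\<omega>. of_bool (I \<omega> = i))) seqM P)"
    then have A[measurable]: "A \<in> sets seqM" by simp
    have "emeasure (distr (density M (\<lambda>\<omega>. of_bool (I \<omega> = i))) seqM P) A =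
        (\<integral>\<^sup>+\<omega>. of_bool (I \<omega> = i) * indicator A (P \<omega>) \<partial>M)"
      using nn_integral_distr_density[of P M seqM "\<lambda>\<omega>. of_bool (I \<omega> = i)" "indicator A"] by simp
    also have "\<dots> = (\<integral>\<^sup>+\<omega>. indicator {\<omega> \<in> space M. I \<omega> = i \<and> P \<omega> \<in> A} \<omega> \<partial>M)"
      by (rule nn_integral_cong) (auto simp: indicator_def)
    also have "\<dots> = ennreal (\<integral>\<omega>. indicator A (P \<omega>) * P \<omega> i \<partial>M)"
      unfolding sb[OF A, symmetric] by (subst nn_integral_indicator) (auto simp: emeasure_eq_measure)
    also have "\<dots> = (\<integral>\<^sup>+\<omega>. ennreal (indicator A (P \<omega>) * P \<omega> i) \<partial>M)"
    proof (rule nn_integral_eq_integral[symmetric])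
      show "integrable M (\<lambda>\<omega>. indicator A (P \<omega>) * P \<omega> i)"
      proof (rule integrable_const_bound)
        show "AE \<omega> in M. norm (indicator A (P \<omega>) * P \<omega> i) \<le> 1"
          using P01 by eventually_elim (simp add: indicator_def)
      qed measurable
      show "AE \<omega> in M. 0 \<le> indicator A (P \<omega>) * P \<omega> i"
        using P01 by eventually_elim (simp add: indicator_def)
    qed
    also have "\<dots> = (\<integral>\<^sup>+\<omega>. ennreal (P \<omega> i) * indicator A (P \<omega>) \<partial>M)"
      by (rule nn_integral_cong) (simp add: indicator_def)
    also have "\<dots> = emeasure (distr (density M (\<lambda>\<omega>. ennreal (P \<omega> i))) seqM P) A"
      using nn_integral_distr_density[of P M seqM "\<lambda>\<omega>. ennreal (P \<omega> i)" "indicator A"] by simp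
    finally show "emeasure (distr (density M (\<lambda>\<omega>. of_bool (I \<omega> = i))) seqM P) A =
        emeasure (distr (density M (\<lambda>\<omega>. ennreal (P \<omega> i))) seqM P) A" .
  qed simp
  then have "(\<integral>\<^sup>+s. u s \<partial>distr (density M (\<lambda>\<omega>. of_bool (I \<omega> = i))) seqM P) =
      (\<integral>\<^sup>+s. u s \<partial>distr (density M (\<lambda>\<omega>. ennreal (P \<omega> i))) seqM P)" by simp
  moreover have "(\<integral>\<^sup>+s. u s \<partial>distr (density M (\<lambda>\<omega>. of_bool (I \<omega> = i))) seqM P) = (\<integral>\<^sup>+\<omega>. of_bool (I \<omega> = i) * u (P \<omega>) \<partial>M)"
    by (rule nn_integral_distr_density) measurable
  moreover have "(\<integral>\<^sup>+s. u s \<partial>distr (density M (\<lambda>\<omega>. ennreal (P \<omega> i))) seqM P) = (\<integral>\<^sup>+\<omega>. ennreal (P \<omega> i) * u (P \<omega>) \<partial>M)"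
    by (rule nn_integral_distr_density) measurable
  ultimately show ?thesis by simp
qed

lemma gamma_convolution:
  assumes \<mu>: "prob_space \<mu>" "sets \<mu> = sets borel" "AE s in \<mu>. 0 \<le> s"
  shows "prob_space (gamma_law (1 / \<alpha>) \<star> \<mu>)" "sets (gamma_law (1 / \<alpha>) \<star> \<mu>) = sets borel"
    "AE s in gamma_law (1 / \<alpha>) \<star> \<mu>. 0 \<le> s"
proof -
  let ?\<gamma> = "gamma_law (1 / \<alpha>)"
  interpret \<mu>: prob_space \<mu> by fact
  interpret \<gamma>: prob_space ?\<gamma> using alpha by (intro prob_space_gamma_law) simp
  interpret pair_sigma_finite ?\<gamma> \<mu> ..
  have [measurable_cong]: "sets \<mu> = sets borel" by fact
  have [measurable]: "(\<lambda>(x, y). x + y) \<in> borel_measurable (?\<gamma> \<Otimes>\<^sub>M \<mu>)" by measurable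
  have "AE g in ?\<gamma>. 0 \<le> g"
    unfolding gamma_law_def by (subst AE_density) (auto simp: gamma_density_def)
  then have "AE p in ?\<gamma> \<Otimes>\<^sub>M \<mu>. 0 \<le> fst p + snd p"
  proof (intro AE_pair_measure)
    assume g: "AE g in ?\<gamma>. 0 \<le> g"
    show "AE x in ?\<gamma>. AE y in \<mu>. 0 \<le> fst (x, y) + snd (x, y)"
      using g by eventually_elim (use \<mu>(3) in \<open>auto elim!: eventually_mono\<close>)
  qed measurable
  then show "AE s in ?\<gamma> \<star> \<mu>. 0 \<le> s"
    unfolding convolution_def by (subst AE_distr_iff) (auto simp: case_prod_beta)
  show "prob_space (?\<gamma> \<star> \<mu>)" unfolding convolution_def
    by (intro prob_space.prob_space_distr prob_space_pair \<gamma>.prob_space_axioms \<mu>.prob_space_axioms) measurable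
qed simp

text \<open>The Mecke equation decouples the size-biased jump \<open>x\<close> from the others. Substituting
  \<open>x = y T E'\<close> cancels the tilt \<open>T E' powr - (1 - \<alpha>)\<close> of the fragmenting sequence, and the superposition
  of \<open>y J E'\<close> and \<open>J E\<close> is a rescaling of \<open>J E\<close>.\<close>
lemma fragmentation_integral:
  assumes \<mu>: "prob_space \<mu>" "sets \<mu> = sets borel" "AE s in \<mu>. 0 \<le> s"
    and F[measurable]: "F \<in> borel_measurable seqM"
  shows "ennreal (moment (1 - \<alpha>)) * (\<integral>\<^sup>+E. tilt \<alpha> \<mu> (T E) * (\<Sum>i. ennreal (J E i / T E) *
      (\<integral>\<^sup>+E'. F (rank (case_sum (\<lambda>j. J E i / T E * (J E' j / T E')) (\<lambda>k. if k = i then 0 else J E k / T E))) \<partial>tilted (1 - \<alpha>))) \<partial>exp_space) =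
    ennreal (Gamma (1 / \<alpha>) / (Gamma (1 - \<alpha>) * (1 - \<alpha>))) *
    (\<integral>\<^sup>+E. tilt \<alpha> (gamma_law (1 / \<alpha>) \<star> \<mu>) (T E) * F (\<lambda>i. J E i / T E) \<partial>exp_space)"
proof -
  have \<theta>: "0 < 1 - \<alpha>" using alpha by simp
  interpret tl: prob_space "tilted (1 - \<alpha>)" by (rule prob_space_tilted[OF \<theta>])
  have h[measurable]: "tilt \<alpha> \<mu> \<in> borel_measurable borel" using \<mu> by measurable
  \<comment> \<open>\<open>x\<close> is the picked jump, \<open>E\<close> carries the other jumps
    and \<open>E'\<close> the fragmenting sequence. The total is \<open>x + T E\<close>, and
    \<open>x / (x + T E)\<close> is the size-biased weight.\<close>
  define \<Psi> where "\<Psi> x E E' = tilt \<alpha> \<mu> (x + T E) * (ennreal (x / (x + T E)) *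
    F (rank (case_sum (\<lambda>j. x / (x + T E) * (J E' j / T E')) (\<lambda>j. J E j / (x + T E)))))" for x E E'
  have \<Psi>[measurable (raw)]: "(\<lambda>w. \<Psi> (f w) (f1 w) (f2 w)) \<in> borel_measurable M"
    if [measurable]: "f \<in> borel_measurable M" "f1 \<in> measurable M seqM" "f2 \<in> measurable M seqM" for f f1 f2 and M :: "'z measure"
    unfolding \<Psi>_def by measurable
  \<comment> \<open>Takes the total and the ranking before normalisation. Multiplying both by the
    same factor does not change the argument of \<open>F\<close>, so the scale of the superposition
    survives only in the tilt and in \<open>1 / fst p\<close>.\<close>
  define F2 where "F2 p = tilt \<alpha> \<mu> (fst p) * (ennreal (1 / fst p) * F (\<lambda>i. snd p i / fst p))" for p
  have F2[measurable]: "F2 \<in> borel_measurable (borel \<Otimes>\<^sub>M seqM)" unfolding F2_def by measurable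
  have "(\<integral>\<^sup>+E. tilt \<alpha> \<mu> (T E) * (\<Sum>i. ennreal (J E i / T E) *
      (\<integral>\<^sup>+E'. F (rank (case_sum (\<lambda>j. J E i / T E * (J E' j / T E')) (\<lambda>k. if k = i then 0 else J E k / T E))) \<partial>tilted (1 - \<alpha>))) \<partial>exp_space) =
    (\<integral>\<^sup>+E. (\<Sum>i. (\<integral>\<^sup>+E'. \<Psi> (J E i) (merge_gap i E) E' \<partial>tilted (1 - \<alpha>))) \<partial>exp_space)"
  proof (rule nn_integral_cong_AE)
    show "AE E in exp_space. tilt \<alpha> \<mu> (T E) * (\<Sum>i. ennreal (J E i / T E) *
      (\<integral>\<^sup>+E'. F (rank (case_sum (\<lambda>j. J E i / T E * (J E' j / T E')) (\<lambda>k. if k = i then 0 else J E k / T E))) \<partial>tilted (1 - \<alpha>))) =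
      (\<Sum>i. (\<integral>\<^sup>+E'. \<Psi> (J E i) (merge_gap i E) E' \<partial>tilted (1 - \<alpha>)))"
      using AE_good
    proof eventually_elim
      case (elim E)
      have "(\<integral>\<^sup>+E'. \<Psi> (J E i) (merge_gap i E) E' \<partial>tilted (1 - \<alpha>)) = tilt \<alpha> \<mu> (T E) * (ennreal (J E i / T E) *
        (\<integral>\<^sup>+E'. F (rank (case_sum (\<lambda>j. J E i / T E * (J E' j / T E')) (\<lambda>k. if k = i then 0 else J E k / T E))) \<partial>tilted (1 - \<alpha>)))" for i
      proof -
        have [measurable]: "(\<lambda>E'. F (rank (case_sum (\<lambda>j. J E i / T E * (J E' j / T E')) (\<lambda>k. if k = i then 0 else J E k / T E)))) \<in> borel_measurable (tilted (1 - \<alpha>))"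
        proof -
          have [measurable]: "(\<lambda>E' :: nat \<Rightarrow> real. (\<lambda>k. if k = i then 0 else J E k / T E)) \<in> measurable (tilted (1 - \<alpha>)) seqM"
            by (rule measurable_seqMI) simp
          show ?thesis by measurable
        qed
        have "(\<integral>\<^sup>+E'. \<Psi> (J E i) (merge_gap i E) E' \<partial>tilted (1 - \<alpha>)) = (\<integral>\<^sup>+E'. tilt \<alpha> \<mu> (T E) * (ennreal (J E i / T E) *
            F (rank (case_sum (\<lambda>j. J E i / T E * (J E' j / T E')) (\<lambda>k. if k = i then 0 else J E k / T E)))) \<partial>tilted (1 - \<alpha>))"
        proof (rule nn_integral_cong_AE)
          show "AE E' in tilted (1 - \<alpha>). \<Psi> (J E i) (merge_gap i E) E' = tilt \<alpha> \<mu> (T E) * (ennreal (J E i / T E) *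
            F (rank (case_sum (\<lambda>j. J E i / T E * (J E' j / T E')) (\<lambda>k. if k = i then 0 else J E k / T E))))"
            using AE_tilted_good
          proof eventually_elim
            case E': (elim E')
            have "rank (case_sum (\<lambda>j. J E i / T E * (J E' j / T E')) (\<lambda>j. J (merge_gap i E) j / T E)) =
              rank (case_sum (\<lambda>j. J E i / T E * (J E' j / T E')) (\<lambda>k. if k = i then 0 else J E k / T E))"
            proof (rule rank_eqI)
              fix x :: real assume x: "0 < x"
              have eq: "J (merge_gap i E) j / T E = (if j < i then J E j / T E else J E (Suc j) / T E)" for j
                by (simp add: stable_jump_merge_gap)
              have f1: "finite {j. x \<le> J E i / T E * (J E' j / T E')}"
                using finite_superlevel_scaled_jumps[OF E' x, of "J E i / T E / T E'"] by simp
              have f2: "finite {j. x \<le> J (merge_gap i E) j / T E}"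
                using finite_superlevel_summable[OF summable_divide[OF good_merge_gap(2)[OF elim]] x] .
              have f3: "finite {k. x \<le> (if k = i then 0 else J E k / T E)}"
                by (rule finite_subset[OF _ normalised_jumps(1)[OF elim x]]) (use x in \<open>auto split: if_splits\<close>)
              have "card {j. x \<le> J (merge_gap i E) j / T E} = card {k. x \<le> (if k = i then 0 else J E k / T E)}"
                by (simp only: eq card_superlevel_drop[OF x])
              then show "card {j. x \<le> case_sum (\<lambda>j. J E i / T E * (J E' j / T E')) (\<lambda>j. J (merge_gap i E) j / T E) j} =
                card {j. x \<le> case_sum (\<lambda>j. J E i / T E * (J E' j / T E')) (\<lambda>k. if k = i then 0 else J E k / T E) j}"
                by (simp only: card_superlevel_case_sum[OF f1 f2] card_superlevel_case_sum[OF f1 f3])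
            qed
            then show ?case unfolding \<Psi>_def good_merge_gap(1)[OF elim, of i, symmetric] by (simp only:)
          qed
        qed
        also have "\<dots> = tilt \<alpha> \<mu> (T E) * (ennreal (J E i / T E) *
            (\<integral>\<^sup>+E'. F (rank (case_sum (\<lambda>j. J E i / T E * (J E' j / T E')) (\<lambda>k. if k = i then 0 else J E k / T E))) \<partial>tilted (1 - \<alpha>)))"
          by (subst nn_integral_cmult, measurable, subst nn_integral_cmult, measurable)
        finally show ?thesis .
      qed
      then show ?case by simp
    qed
  qed
  also have "\<dots> = (\<integral>\<^sup>+x. (\<integral>\<^sup>+E. (\<integral>\<^sup>+E'. \<Psi> x E E' \<partial>tilted (1 - \<alpha>)) \<partial>exp_space) \<partial>levy \<alpha>)"
    using mecke_jump[of "\<lambda>p. (\<integral>\<^sup>+E'. \<Psi> (fst p) (snd p) E' \<partial>tilted (1 - \<alpha>))"] by simp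
  also have "ennreal (moment (1 - \<alpha>)) * \<dots> = (\<integral>\<^sup>+x. (\<integral>\<^sup>+E. (\<integral>\<^sup>+E'. ennreal (T E' powr (- (1 - \<alpha>))) * \<Psi> x E E' \<partial>exp_space) \<partial>exp_space) \<partial>levy \<alpha>)"
  proof -
    have "ennreal (moment (1 - \<alpha>)) * (\<integral>\<^sup>+x. (\<integral>\<^sup>+E. (\<integral>\<^sup>+E'. \<Psi> x E E' \<partial>tilted (1 - \<alpha>)) \<partial>exp_space) \<partial>levy \<alpha>) =
      (\<integral>\<^sup>+x. ennreal (moment (1 - \<alpha>)) * (\<integral>\<^sup>+E. (\<integral>\<^sup>+E'. \<Psi> x E E' \<partial>tilted (1 - \<alpha>)) \<partial>exp_space) \<partial>levy \<alpha>)"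
      by (rule nn_integral_cmult[symmetric]) measurable
    also have "\<dots> = (\<integral>\<^sup>+x. (\<integral>\<^sup>+E. ennreal (moment (1 - \<alpha>)) * (\<integral>\<^sup>+E'. \<Psi> x E E' \<partial>tilted (1 - \<alpha>)) \<partial>exp_space) \<partial>levy \<alpha>)"
      by (rule nn_integral_cong, rule nn_integral_cmult[symmetric]) measurable
    also have "\<dots> = (\<integral>\<^sup>+x. (\<integral>\<^sup>+E. (\<integral>\<^sup>+E'. ennreal (T E' powr (- (1 - \<alpha>))) * \<Psi> x E E' \<partial>exp_space) \<partial>exp_space) \<partial>levy \<alpha>)"
      by (rule nn_integral_cong, rule nn_integral_cong, rule nn_integral_tilted[OF \<theta>]) measurable
    finally show ?thesis .
  qed
  also have "\<dots> = (\<integral>\<^sup>+E. (\<integral>\<^sup>+x. (\<integral>\<^sup>+E'. ennreal (T E' powr (- (1 - \<alpha>))) * \<Psi> x E E' \<partial>exp_space) \<partial>levy \<alpha>) \<partial>exp_space)"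
    by (rule lev_es.Fubini'[symmetric]) measurable
  also have "\<dots> = (\<integral>\<^sup>+E. (\<integral>\<^sup>+E'. (\<integral>\<^sup>+x. ennreal (T E' powr (- (1 - \<alpha>))) * \<Psi> x E E' \<partial>levy \<alpha>) \<partial>exp_space) \<partial>exp_space)"
    by (intro nn_integral_cong lev_es.Fubini'[symmetric]) measurable
  also have "\<dots> = (\<integral>\<^sup>+E. (\<integral>\<^sup>+E'. (\<integral>\<^sup>+y. ennreal y * F2 (y * T E' + T E, rank (case_sum (\<lambda>i. y * J E' i) (J E))) \<partial>levy \<alpha>) \<partial>exp_space) \<partial>exp_space)"
  proof (rule nn_integral_cong_AE, rule AE_mp[OF AE_good], rule AE_I2, rule impI, rule nn_integral_cong_AE, rule AE_mp[OF AE_good], rule AE_I2, rule impI)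
    fix E E' assume E: "good \<alpha> E" and E': "good \<alpha> E'"
    note T = good_T_pos[OF E] and T' = good_T_pos[OF E']
    have "(\<integral>\<^sup>+x. ennreal (T E' powr (- (1 - \<alpha>))) * \<Psi> x E E' \<partial>levy \<alpha>) =
       ennreal (T E' powr (- (1 - \<alpha>))) * (\<integral>\<^sup>+x. \<Psi> x E E' \<partial>levy \<alpha>)"
      by (rule nn_integral_cmult) measurable
    \<comment> \<open>The power \<open>\<alpha>\<close> is absorbed by the substitution
      \<open>x = T E' * y\<close> in the Levy measure, and the power \<open>- 1\<close> cancels the
      factor \<open>T E'\<close> in the weight of the picked jump.\<close>
    also have "\<dots> = ennreal (T E' powr (- 1)) * (ennreal (T E' powr \<alpha>) * (\<integral>\<^sup>+x. \<Psi> x E E' \<partial>levy \<alpha>))"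
    proof -
      have "T E' powr (- (1 - \<alpha>)) = T E' powr (- 1) * T E' powr \<alpha>" by (subst powr_add[symmetric]) simp
      then have "ennreal (T E' powr (- (1 - \<alpha>))) = ennreal (T E' powr (- 1)) * ennreal (T E' powr \<alpha>)"
        by (simp only: ennreal_mult'[OF powr_ge_zero])
      then show ?thesis by (simp only: mult.assoc)
    qed
    also have "ennreal (T E' powr \<alpha>) * (\<integral>\<^sup>+x. \<Psi> x E E' \<partial>levy \<alpha>) = (\<integral>\<^sup>+y. \<Psi> (T E' * y) E E' \<partial>levy \<alpha>)"
      by (rule nn_integral_levy_scale[OF _ T', symmetric]) measurable
    also have "ennreal (T E' powr (- 1)) * (\<integral>\<^sup>+y. \<Psi> (T E' * y) E E' \<partial>levy \<alpha>) = (\<integral>\<^sup>+y. ennreal (T E' powr (- 1)) * \<Psi> (T E' * y) E E' \<partial>levy \<alpha>)"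
      by (rule nn_integral_cmult[symmetric]) measurable
    also have "\<dots> = (\<integral>\<^sup>+y. ennreal y * F2 (y * T E' + T E, rank (case_sum (\<lambda>i. y * J E' i) (J E))) \<partial>levy \<alpha>)"
    proof (rule nn_integral_cong_AE, rule AE_mp[OF AE_levy_pos], rule AE_I2, rule impI)
      fix y :: real assume y: "0 < y"
      define \<tau> where "\<tau> = y * T E' + T E"
      have \<tau>: "0 < \<tau>" using y T T' by (simp add: \<tau>_def add_pos_pos)
      have \<tau>2: "T E' * y + T E = \<tau>" by (simp add: \<tau>_def mult.commute)
      let ?f = "case_sum (\<lambda>i. y * J E' i) (J E)"
      have fin: "finite {j. x \<le> ?f j}" if "0 < x" for x
        unfolding superlevel_case_sum
        using finite_superlevel_scaled_jumps[OF E' that, of y] finite_superlevel_scaled_jumps[OF E that, of 1] by simp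
      have "case_sum (\<lambda>j. T E' * y / \<tau> * (J E' j / T E')) (\<lambda>j. J E j / \<tau>) = (\<lambda>i. 1 / \<tau> * ?f i)"
        using T' by (auto split: sum.split)
      then have r: "rank (case_sum (\<lambda>j. T E' * y / \<tau> * (J E' j / T E')) (\<lambda>j. J E j / \<tau>)) = (\<lambda>n. rank ?f n / \<tau>)"
        using rank_scale[OF fin, of "1 / \<tau>"] \<tau> by auto
      have e: "ennreal (T E' powr (- 1)) * ennreal (T E' * y / \<tau>) = ennreal y * ennreal (1 / \<tau>)"
        using T' y \<tau> by (simp add: ennreal_mult'[symmetric] powr_minus)
      have comm: "a * (h * (b * f)) = (a * b) * (h * f)" for a h b f :: ennreal by (simp only: mult_ac)
      show "ennreal (T E' powr (- 1)) * \<Psi> (T E' * y) E E' = ennreal y * F2 (y * T E' + T E, rank ?f)"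
        unfolding \<Psi>_def F2_def \<tau>2 fst_conv snd_conv \<tau>_def[symmetric] r
        unfolding comm[of "ennreal (T E' powr (- 1))"] comm[of "ennreal y"] e ..
    qed
    finally show "(\<integral>\<^sup>+x. ennreal (T E' powr (- (1 - \<alpha>))) * \<Psi> x E E' \<partial>levy \<alpha>) =
      (\<integral>\<^sup>+y. ennreal y * F2 (y * T E' + T E, rank (case_sum (\<lambda>i. y * J E' i) (J E))) \<partial>levy \<alpha>)" .
  qed
  \<comment> \<open>The superposition identity holds for fixed \<open>y\<close>, so \<open>y\<close>
    has to become the outermost variable.\<close>
  also have "\<dots> = (\<integral>\<^sup>+E. (\<integral>\<^sup>+y. (\<integral>\<^sup>+E'. ennreal y * F2 (y * T E' + T E, rank (case_sum (\<lambda>i. y * J E' i) (J E))) \<partial>exp_space) \<partial>levy \<alpha>) \<partial>exp_space)"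
    by (intro nn_integral_cong lev_es.Fubini') measurable
  also have "\<dots> = (\<integral>\<^sup>+y. (\<integral>\<^sup>+E. (\<integral>\<^sup>+E'. ennreal y * F2 (y * T E' + T E, rank (case_sum (\<lambda>i. y * J E' i) (J E))) \<partial>exp_space) \<partial>exp_space) \<partial>levy \<alpha>)"
    by (rule lev_es.Fubini') measurable
  also have "\<dots> = (\<integral>\<^sup>+y. (\<integral>\<^sup>+E. ennreal y * F2 (superposition_scale y * T E, \<lambda>i. superposition_scale y * J E i) \<partial>exp_space) \<partial>levy \<alpha>)"
  proof (rule nn_integral_cong_AE, rule AE_mp[OF AE_levy_pos], rule AE_I2, rule impI)
    fix y :: real assume y: "0 < y"
    show "(\<integral>\<^sup>+E. (\<integral>\<^sup>+E'. ennreal y * F2 (y * T E' + T E, rank (case_sum (\<lambda>i. y * J E' i) (J E))) \<partial>exp_space) \<partial>exp_space) =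
      (\<integral>\<^sup>+E. ennreal y * F2 (superposition_scale y * T E, \<lambda>i. superposition_scale y * J E i) \<partial>exp_space)"
      using nn_integral_superposition[OF y, of "\<lambda>p. ennreal y * F2 p"] by simp
  qed
  \<comment> \<open>Now \<open>y\<close> moves inside again: for fixed \<open>E\<close> the
    normalised sequence no longer depends on it, and \<open>levy_tilt_eq_gamma_tilt\<close>
    evaluates what is left.\<close>
  also have "\<dots> = (\<integral>\<^sup>+E. (\<integral>\<^sup>+y. ennreal y * F2 (superposition_scale y * T E, \<lambda>i. superposition_scale y * J E i) \<partial>levy \<alpha>) \<partial>exp_space)"
    by (rule lev_es.Fubini'[symmetric]) measurable
  also have "\<dots> = (\<integral>\<^sup>+E. ennreal (Gamma (1 / \<alpha>) / (Gamma (1 - \<alpha>) * (1 - \<alpha>))) * (tilt \<alpha> (gamma_law (1 / \<alpha>) \<star> \<mu>) (T E) * F (\<lambda>i. J E i / T E)) \<partial>exp_space)"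
  proof (rule nn_integral_cong_AE, rule AE_mp[OF AE_good], rule AE_I2, rule impI)
    fix E assume E: "good \<alpha> E"
    note T = good_T_pos[OF E]
    have "(\<lambda>i. superposition_scale y * J E i / (superposition_scale y * T E)) = (\<lambda>i. J E i / T E)" for y
      using superposition_scale_pos[of y] by auto
    then have "(\<integral>\<^sup>+y. ennreal y * F2 (superposition_scale y * T E, \<lambda>i. superposition_scale y * J E i) \<partial>levy \<alpha>) =
      (\<integral>\<^sup>+y. (ennreal y * (tilt \<alpha> \<mu> (superposition_scale y * T E) * ennreal (1 / (superposition_scale y * T E)))) * F (\<lambda>i. J E i / T E) \<partial>levy \<alpha>)"
      unfolding F2_def fst_conv snd_conv by (simp only: mult.assoc)
    also have "\<dots> = (\<integral>\<^sup>+y. ennreal y * (tilt \<alpha> \<mu> (superposition_scale y * T E) * ennreal (1 / (superposition_scale y * T E))) \<partial>levy \<alpha>) * F (\<lambda>i. J E i / T E)"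
      by (rule nn_integral_multc) measurable
    finally show "(\<integral>\<^sup>+y. ennreal y * F2 (superposition_scale y * T E, \<lambda>i. superposition_scale y * J E i) \<partial>levy \<alpha>) =
      ennreal (Gamma (1 / \<alpha>) / (Gamma (1 - \<alpha>) * (1 - \<alpha>))) * (tilt \<alpha> (gamma_law (1 / \<alpha>) \<star> \<mu>) (T E) * F (\<lambda>i. J E i / T E))"
      unfolding levy_tilt_eq_gamma_tilt[OF \<mu> T] by (simp only: mult.assoc)
  qed
  also have "\<dots> = ennreal (Gamma (1 / \<alpha>) / (Gamma (1 - \<alpha>) * (1 - \<alpha>))) *
    (\<integral>\<^sup>+E. tilt \<alpha> (gamma_law (1 / \<alpha>) \<star> \<mu>) (T E) * F (\<lambda>i. J E i / T E) \<partial>exp_space)"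
  proof (rule nn_integral_cmult)
    have [measurable]: "tilt \<alpha> (gamma_law (1 / \<alpha>) \<star> \<mu>) \<in> borel_measurable borel"
      by (intro measurable_tilt gamma_convolution[OF \<mu>])
    show "(\<lambda>E. tilt \<alpha> (gamma_law (1 / \<alpha>) \<star> \<mu>) (T E) * F (\<lambda>i. J E i / T E)) \<in> borel_measurable exp_space" by measurable
  qed
  finally show ?thesis .
qed

end

section \<open>From the integral identity to the law of the fragmented sequence\<close>

context stable_index
begin

lemma nn_integral_Palpha:
  assumes \<mu>: "prob_space \<mu>" "sets \<mu> = sets borel" "AE s in \<mu>. 0 \<le> s" and [measurable]: "f \<in> borel_measurable seqM"
  shows "(\<integral>\<^sup>+s. f s \<partial>Palpha \<alpha> \<mu>) = (\<integral>\<^sup>+E. tilt \<alpha> \<mu> (T E) * f (\<lambda>i. J E i / T E) \<partial>exp_space)"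
proof -
  have [measurable]: "tilt \<alpha> \<mu> \<in> borel_measurable borel" using \<mu> by measurable
  show ?thesis unfolding Palpha_eq[OF \<mu>] by (rule nn_integral_distr_density) measurable
qed

lemma AE_Palpha:
  assumes \<mu>: "prob_space \<mu>" "sets \<mu> = sets borel" "AE s in \<mu>. 0 \<le> s"
  shows "AE s in Palpha \<alpha> \<mu>. 0 \<le> s i \<and> s i \<le> 1"
proof -
  have [measurable]: "tilt \<alpha> \<mu> \<in> borel_measurable borel" using \<mu> by measurable
  have "AE E in density exp_space (\<lambda>E. tilt \<alpha> \<mu> (T E)). 0 \<le> J E i / T E \<and> J E i / T E \<le> 1"
    by (subst AE_density, measurable, rule AE_mp[OF AE_good])
      (intro AE_I2 impI conjI normalised_jumps(2,3))
  then show ?thesis unfolding Palpha_eq[OF \<mu>] by (subst AE_distr_iff) measurable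
qed

end

text \<open>The pick is represented by its index \<open>I\<close>. Independence from
  \<open>Q\<close> is stated for the pair \<open>(P, I)\<close>, as the fragmented entry depends on
  both. Setting the picked entry to \<open>0\<close> deletes it, because \<open>rank\<close> ignores
  zeros.\<close>

theorem theorem4p2:
  fixes \<alpha> :: real and \<mu> :: "real measure" and M :: "'a measure"
    and P Q :: "'a \<Rightarrow> nat \<Rightarrow> real" and I :: "'a \<Rightarrow> nat"
  assumes alpha: "0 < \<alpha>" "\<alpha> < 1"
    and zeta: "prob_space \<mu>" "sets \<mu> = sets borel" "AE x in \<mu>. 0 \<le> x"
    and M: "prob_space M"
    and P_meas: "P \<in> measurable M seqM"
    and I_meas: "I \<in> measurable M (count_space UNIV)"
    and Q_meas: "Q \<in> measurable M seqM"
    and P_law: "distr M seqM P = Palpha \<alpha> \<mu>"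
    and size_biased: "\<And>A i. A \<in> sets seqM \<Longrightarrow>
          measure M {\<omega> \<in> space M. I \<omega> = i \<and> P \<omega> \<in> A}
            = (\<integral>\<omega>. indicator A (P \<omega>) * P \<omega> i \<partial>M)"
    and Q_law: "distr M seqM Q = PD \<alpha> (1 - \<alpha>)"
    and indep: "distr M ((seqM \<Otimes>\<^sub>M count_space UNIV) \<Otimes>\<^sub>M seqM) (\<lambda>\<omega>. ((P \<omega>, I \<omega>), Q \<omega>))
           = distr M (seqM \<Otimes>\<^sub>M count_space UNIV) (\<lambda>\<omega>. (P \<omega>, I \<omega>)) \<Otimes>\<^sub>M distr M seqM Q"
  shows "distr M seqM
           (\<lambda>\<omega>. rank (\<lambda>j. case j of
                          Inl i \<Rightarrow> P \<omega> (I \<omega>) * Q \<omega> i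
                        | Inr k \<Rightarrow> (if k = I \<omega> then 0 else P \<omega> k)))
         = Palpha \<alpha> (gamma_law (1 / \<alpha>) \<star> \<mu>)"
proof -
  interpret stable_index \<alpha> by unfold_locales (fact alpha)+
  interpret M: prob_space M by fact
  note [measurable] = P_meas I_meas Q_meas
  let ?\<mu>' = "gamma_law (1 / \<alpha>) \<star> \<mu>"
  note \<mu>' = gamma_convolution[OF zeta]
  have \<theta>: "0 < 1 - \<alpha>" using alpha by simp
  let ?PD = "PD \<alpha> (1 - \<alpha>)"
  have sets_PD[measurable_cong]: "sets ?PD = sets seqM" by (simp add: PD_def)
  interpret PD: prob_space ?PD unfolding Q_law[symmetric] by (rule M.prob_space_distr) measurable
  define \<Phi> :: "((nat \<Rightarrow> real) \<times> nat) \<times> (nat \<Rightarrow> real) \<Rightarrow> nat \<Rightarrow> real" where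
    "\<Phi> x = rank (case_sum (\<lambda>j. fst (fst x) (snd (fst x)) * snd x j) (\<lambda>k. if k = snd (fst x) then 0 else fst (fst x) k))" for x
  have \<Phi>[measurable]: "\<Phi> \<in> measurable ((seqM \<Otimes>\<^sub>M count_space UNIV) \<Otimes>\<^sub>M seqM) seqM"
  proof -
    let ?N = "(seqM \<Otimes>\<^sub>M count_space UNIV) \<Otimes>\<^sub>M seqM :: (((nat \<Rightarrow> real) \<times> nat) \<times> (nat \<Rightarrow> real)) measure"
    have c: "(\<lambda>x. fst (fst x) k) \<in> borel_measurable ?N" for k
      by (rule measurable_seqM_component) measurable
    have [measurable]: "(\<lambda>x. fst (fst x) (snd (fst x))) \<in> borel_measurable ?N"
      by (rule measurable_compose_countable[OF c]) measurable
    have [measurable]: "(\<lambda>x k. if k = snd (fst x) then 0 else fst (fst x) k) \<in> measurable ?N seqM"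
      by (rule measurable_seqMI, rule measurable_If) (use c in measurable)
    show ?thesis unfolding \<Phi>_def by measurable
  qed
  let ?X = "\<lambda>\<omega>. \<Phi> ((P \<omega>, I \<omega>), Q \<omega>)"
  have X[measurable]: "?X \<in> measurable M seqM" by measurable
  let ?m = "ennreal (moment (1 - \<alpha>))" and ?k = "ennreal (Gamma (1 / \<alpha>) / (Gamma (1 - \<alpha>) * (1 - \<alpha>)))"
  have key: "?m * emeasure (distr M seqM ?X) A = ?k * emeasure (Palpha \<alpha> ?\<mu>') A"
    if A[measurable]: "A \<in> sets seqM" for A
  proof -
    let ?F = "indicator A :: (nat \<Rightarrow> real) \<Rightarrow> ennreal"
    \<comment> \<open>\<open>Q\<close> is integrated out for a fixed sequence and index, which is
      possible by independence.\<close>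
    define \<psi> where "\<psi> i p = (\<integral>\<^sup>+q. ?F (\<Phi> ((p, i), q)) \<partial>?PD)" for i p
    have \<psi>_meas[measurable]: "\<psi> i \<in> borel_measurable seqM" for i unfolding \<psi>_def by measurable
    have "emeasure (distr M seqM ?X) A = (\<integral>\<^sup>+\<omega>. ?F (?X \<omega>) \<partial>M)"
      using emeasure_distr_of_bool[OF X A] by (simp add: indicator_def)
    also have "\<dots> = (\<integral>\<^sup>+x. ?F (\<Phi> x) \<partial>distr M ((seqM \<Otimes>\<^sub>M count_space UNIV) \<Otimes>\<^sub>M seqM) (\<lambda>\<omega>. ((P \<omega>, I \<omega>), Q \<omega>)))"
      by (rule nn_integral_distr[symmetric]) measurable
    also have "\<dots> = (\<integral>\<^sup>+y. (\<integral>\<^sup>+q. ?F (\<Phi> (y, q)) \<partial>?PD) \<partial>distr M (seqM \<Otimes>\<^sub>M count_space UNIV) (\<lambda>\<omega>. (P \<omega>, I \<omega>)))"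
      unfolding indep Q_law by (rule PD.nn_integral_fst[symmetric]) measurable
    also have "\<dots> = (\<integral>\<^sup>+\<omega>. \<psi> (I \<omega>) (P \<omega>) \<partial>M)"
      unfolding \<psi>_def by (rule nn_integral_distr) measurable
    \<comment> \<open>The integral is split by the value of \<open>I\<close> because
      \<open>size_biased\<close> concerns one index at a time.\<close>
    also have "\<dots> = (\<integral>\<^sup>+\<omega>. (\<Sum>i. of_bool (I \<omega> = i) * \<psi> i (P \<omega>)) \<partial>M)"
    proof (rule nn_integral_cong)
      fix \<omega>
      have "(\<Sum>i. of_bool (I \<omega> = i) * \<psi> i (P \<omega>)) = (\<Sum>i\<in>{I \<omega>}. of_bool (I \<omega> = i) * \<psi> i (P \<omega>))"
        by (rule suminf_finite) auto
      then show "\<psi> (I \<omega>) (P \<omega>) = (\<Sum>i. of_bool (I \<omega> = i) * \<psi> i (P \<omega>))" by simp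
    qed
    also have "\<dots> = (\<Sum>i. \<integral>\<^sup>+\<omega>. of_bool (I \<omega> = i) * \<psi> i (P \<omega>) \<partial>M)"
      by (rule nn_integral_suminf) measurable
    also have "\<dots> = (\<Sum>i. \<integral>\<^sup>+E. tilt \<alpha> \<mu> (T E) * (ennreal (J E i / T E) * \<psi> i (\<lambda>k. J E k / T E)) \<partial>exp_space)"
    proof (rule suminf_cong)
      fix i
      have P01: "AE \<omega> in M. 0 \<le> P \<omega> i \<and> P \<omega> i \<le> 1"
        using AE_Palpha[OF zeta, of i] unfolding P_law[symmetric] by (rule AE_distrD[OF P_meas])
      have "(\<integral>\<^sup>+\<omega>. of_bool (I \<omega> = i) * \<psi> i (P \<omega>) \<partial>M) = (\<integral>\<^sup>+\<omega>. ennreal (P \<omega> i) * \<psi> i (P \<omega>) \<partial>M)"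
        by (rule size_biased_density[OF M P_meas I_meas P01 size_biased \<psi>_meas])
      also have "\<dots> = (\<integral>\<^sup>+s. ennreal (s i) * \<psi> i s \<partial>distr M seqM P)"
        by (rule nn_integral_distr[symmetric]) measurable
      also have "\<dots> = (\<integral>\<^sup>+E. tilt \<alpha> \<mu> (T E) * (ennreal (J E i / T E) * \<psi> i (\<lambda>k. J E k / T E)) \<partial>exp_space)"
        unfolding P_law by (rule nn_integral_Palpha[OF zeta]) measurable
      finally show "(\<integral>\<^sup>+\<omega>. of_bool (I \<omega> = i) * \<psi> i (P \<omega>) \<partial>M) =
        (\<integral>\<^sup>+E. tilt \<alpha> \<mu> (T E) * (ennreal (J E i / T E) * \<psi> i (\<lambda>k. J E k / T E)) \<partial>exp_space)" .
    qed
    also have "\<dots> = (\<integral>\<^sup>+E. (\<Sum>i. tilt \<alpha> \<mu> (T E) * (ennreal (J E i / T E) * \<psi> i (\<lambda>k. J E k / T E))) \<partial>exp_space)"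
    proof (rule nn_integral_suminf[symmetric])
      have [measurable]: "tilt \<alpha> \<mu> \<in> borel_measurable borel" using zeta by measurable
      show "(\<lambda>E. tilt \<alpha> \<mu> (T E) * (ennreal (J E i / T E) * \<psi> i (\<lambda>k. J E k / T E))) \<in> borel_measurable exp_space" for i
        by measurable
    qed
    also have "\<dots> = (\<integral>\<^sup>+E. tilt \<alpha> \<mu> (T E) * (\<Sum>i. ennreal (J E i / T E) * \<psi> i (\<lambda>k. J E k / T E)) \<partial>exp_space)"
      by (simp only: ennreal_suminf_cmult)
    finally have 1: "emeasure (distr M seqM ?X) A =
      (\<integral>\<^sup>+E. tilt \<alpha> \<mu> (T E) * (\<Sum>i. ennreal (J E i / T E) * \<psi> i (\<lambda>k. J E k / T E)) \<partial>exp_space)" .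
    have \<psi>: "\<psi> i (\<lambda>k. J E k / T E) = (\<integral>\<^sup>+E'. ?F (rank (case_sum (\<lambda>j. J E i / T E * (J E' j / T E'))
        (\<lambda>k. if k = i then 0 else J E k / T E))) \<partial>tilted (1 - \<alpha>))" for i E
    proof -
      let ?p = "\<lambda>k. J E k / T E"
      have c: "(\<lambda>q. ((?p, i), q)) \<in> measurable seqM ((seqM \<Otimes>\<^sub>M count_space UNIV) \<Otimes>\<^sub>M seqM)"
        by (intro measurable_Pair measurable_ident measurable_const) (simp_all add: space_pair_measure)
      have m: "(\<lambda>q. ?F (\<Phi> ((?p, i), q))) \<in> borel_measurable (distr (tilted (1 - \<alpha>)) seqM (\<lambda>E i. J E i / T E))"
        unfolding measurable_distr_eq1
        by (rule measurable_compose[OF c], rule measurable_compose[OF \<Phi>], rule borel_measurable_indicator[OF A])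
      have "\<psi> i ?p = (\<integral>\<^sup>+E'. ?F (\<Phi> ((?p, i), \<lambda>j. J E' j / T E')) \<partial>tilted (1 - \<alpha>))"
        unfolding \<psi>_def PD_eq_tilted[OF \<theta>] by (rule nn_integral_distr[OF _ m]) measurable
      then show ?thesis by (simp only: \<Phi>_def fst_conv snd_conv)
    qed
    have "?m * emeasure (distr M seqM ?X) A = ?k * (\<integral>\<^sup>+E. tilt \<alpha> ?\<mu>' (T E) * ?F (\<lambda>i. J E i / T E) \<partial>exp_space)"
      unfolding 1 \<psi> by (rule fragmentation_integral[OF zeta]) measurable
    also have "(\<integral>\<^sup>+E. tilt \<alpha> ?\<mu>' (T E) * ?F (\<lambda>i. J E i / T E) \<partial>exp_space) = (\<integral>\<^sup>+s. ?F s \<partial>Palpha \<alpha> ?\<mu>')"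
      by (rule nn_integral_Palpha[OF \<mu>', symmetric]) measurable
    also have "\<dots> = emeasure (Palpha \<alpha> ?\<mu>') A"
      by (rule nn_integral_indicator) (simp add: Palpha_eq[OF \<mu>'])
    finally show ?thesis .
  qed
  \<comment> \<open>Neither constant needs to be evaluated: both laws have total mass 1, so
    \<open>key\<close> on the whole space makes the constants equal.\<close>
  have "?m * 1 = ?k * 1"
  proof -
    have "emeasure (distr M seqM ?X) UNIV = 1"
      using prob_space.emeasure_space_1[OF M.prob_space_distr[OF X]] by simp
    moreover have "emeasure (Palpha \<alpha> ?\<mu>') UNIV = 1"
      using nn_integral_Palpha[OF \<mu>', of "\<lambda>_. 1"] nn_integral_tilt[OF \<mu>']
      by (simp add: Palpha_eq[OF \<mu>'])
    ultimately show ?thesis using key[of UNIV] sets.top[of seqM] by simp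
  qed
  then have mk: "?k = ?m" by simp
  have "distr M seqM ?X = Palpha \<alpha> ?\<mu>'"
  proof (rule measure_eqI)
    fix A assume "A \<in> sets (distr M seqM ?X)"
    then have "A \<in> sets seqM" by simp
    from key[OF this] show "emeasure (distr M seqM ?X) A = emeasure (Palpha \<alpha> ?\<mu>') A"
      unfolding mk using moment_pos[OF \<theta>] by (subst (asm) ennreal_mult_cancel_left) auto
  qed (simp add: Palpha_eq[OF \<mu>'])
  then show ?thesis by (simp only: \<Phi>_def fst_conv snd_conv)
qed

end
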